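(* Let $a,b\in\mathbb{N}_0$ with $(a,b)\neq(0,0)$ be such that $a+b\equiv 0\pmod 2$. Let $q=e^{2\pi i z}$ with $z$ in the upper half-plane. (i) There are positive integers $k$, $M$ and a Dirichlet character $\chi$ modulo $M$, all depending only on $a$ and $b$, such that $$f_{N^*}(z):=\sum_{n=0}^{\infty}N^*(a,b;8n+a+3b)\,q^{8n+a+3b}\in M_k(\Gamma_0(M),\chi).$$ (ii) Let $$f_N(z):=\sum_{\substack{m=0\\ m\equiv a+3b\ (\mathrm{mod}\ 8)}}^{\infty}N(a,b;m)\,q^m.$$ Then $f_N\in M_k(\Gamma_0(M),\chi)$ for certain positive integers $k$, $M$ and a Dirichlet character $\chi$ modulo $M$, all depending only on $a$ and $b$. Moreover, $$\sum_{n=0}^{\infty}N(a,b;8n+a+3b)\,q^{8n+a+3b}=f_N(z)-\sum_{\substack{\ell\in\mathbb{Z}\\ 0\leq 8\ell+a+3b<a+3b}}N(a,b;8\ell+a+3b)\,q^{8\ell+a+3b}.$$ (iii) Suppose $a+3b\equiv 0\pmod 4$ and let $$f_{\widetilde{N}}(z):=\sum_{\substack{m=0\\ m\equiv a+3b\ (\mathrm{mod}\ 8)}}^{\infty}\widetilde{N}(a,b;m)\,q^m.$$ Then $f_{\widetilde N}\in M_k(\Gamma_0(M),\chi)$ for certain positive integers $k$, $M$ and a Dirichlet character $\chi$ modulo $M$, all depending only on $a$ and $b$. Moreover, $$\sum_{n=0}^{\infty}\widetilde{N}(a,b;8n+a+3b)\,q^{8n+a+3b}=f_{\widetilde N}(z)-\sum_{\substack{\ell\in\mathbb{Z}\\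 0\leq 8\ell+a+3b<a+3b}}\widetilde{N}(a,b;8\ell+a+3b)\,q^{8\ell+a+3b}.$$
   Context: $\mathbb{N}_0=\{0,1,2,\dots\}$. For $a,b,m\in\mathbb{N}_0$ with $(a,b)\neq(0,0)$: - $N(a,b;m)$ is the number of $(x_1,\dots,x_a,y_1,\dots,y_b)\in\mathbb{Z}^{a+b}$ with $m=x_1^2+\cdots+x_a^2+3y_1^2+\cdots+3y_b^2$. - $N^*(a,b;m)$ is the number of such tuples in which all $x_i$ and $y_j$ are odd. - $\widetilde{N}(a,b;m)$ is the number of such tuples in which at least one of the $x_i$, $y_j$ is odd; equivalently $\widetilde{N}(a,b;m)=N(a,b;m)-N(a,b;m/4)$, where $N(a,b;r)=0$ if $r\notin\mathbb{N}_0$. $M_k(\Gamma_0(M),\chi)$ denotes the space of (holomorphic) modular forms of weight $k$ and character $\chi$ on $\Gamma_0(M)$. *)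

theory Defs
  imports
    "HOL-Complex_Analysis.Complex_Analysis"
    "HOL-Number_Theory.Number_Theory"
    "HOL-Real_Asymp.Real_Asymp"
begin

section \<open>Representations by the form with \<open>a\<close> coefficients 1 and \<open>b\<close> coefficients 3\<close>

text \<open>
  The vectors \<open>(x\<^sub>1, \<dots>, x\<^sub>a)\<close> and \<open>(y\<^sub>1, \<dots>, y\<^sub>b)\<close> are lists of length \<open>a\<close> and \<open>b\<close>.
\<close>

definition representations :: "nat \<Rightarrow> nat \<Rightarrow> nat \<Rightarrow> (int list \<times> int list) set" where
  "representations a b m =
     {(xs, ys). length xs = a \<and> length ys = b \<and>
                int m = (\<Sum>x\<leftarrow>xs. x\<^sup>2) + (\<Sum>y\<leftarrow>ys. 3 * y\<^sup>2)}"

definition N :: "nat \<Rightarrow> nat \<Rightarrow> nat \<Rightarrow> nat" where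
  "N a b m = card (representations a b m)"

definition Nstar :: "nat \<Rightarrow> nat \<Rightarrow> nat \<Rightarrow> nat" where
  "Nstar a b m =
     card {(xs, ys) \<in> representations a b m. (\<forall>x\<in>set xs. odd x) \<and> (\<forall>y\<in>set ys. odd y)}"

definition Ntilde :: "nat \<Rightarrow> nat \<Rightarrow> nat \<Rightarrow> nat" where
  "Ntilde a b m =
     card {(xs, ys) \<in> representations a b m. (\<exists>x\<in>set xs. odd x) \<or> (\<exists>y\<in>set ys. odd y)}"


section \<open>Modular forms for \<open>\<Gamma>\<^sub>0(M)\<close> with character\<close>

definition upper_half_plane :: "complex set" where
  "upper_half_plane = {z. Im z > 0}"

text \<open>
  The quadruple \<open>(a, b, c, d)\<close> stands for the matrix with rows \<open>(a, b)\<close> and \<open>(c, d)\<close>.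
\<close>

definition SL2Z :: "(int \<times> int \<times> int \<times> int) set" where
  "SL2Z = {(a, b, c, d). a * d - b * c = 1}"

definition Gamma0 :: "nat \<Rightarrow> (int \<times> int \<times> int \<times> int) set" where
  "Gamma0 M = {(a, b, c, d) \<in> SL2Z. int M dvd c}"

definition slash ::
  "nat \<Rightarrow> (complex \<Rightarrow> complex) \<Rightarrow> int \<times> int \<times> int \<times> int \<Rightarrow> complex \<Rightarrow> complex" where
  "slash k f = (\<lambda>(a, b, c, d) z.
     f ((of_int a * z + of_int b) / (of_int c * z + of_int d)) / (of_int c * z + of_int d) ^ k)"

definition dirichlet_character :: "nat \<Rightarrow> (int \<Rightarrow> complex) \<Rightarrow> bool" where
  "dirichlet_character M \<psi> \<longleftrightarrow>
     (\<forall>m n. \<psi> (m * n) = \<psi> m * \<psi> n) \<and>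
     (\<forall>n. \<psi> (n + int M) = \<psi> n) \<and>
     (\<forall>n. \<psi> n \<noteq> 0 \<longleftrightarrow> coprime n (int M))"

text \<open>
  A function is holomorphic at infinity if for some width \<open>h\<close> it is a function of
  \<open>exp (2 \<pi> i z / h)\<close> that extends holomorphically to the origin of the unit disc.
\<close>

definition holomorphic_at_infinity :: "(complex \<Rightarrow> complex) \<Rightarrow> bool" where
  "holomorphic_at_infinity f \<longleftrightarrow>
     (\<exists>h::nat. h > 0 \<and> (\<exists>g. g holomorphic_on ball 0 1 \<and>
        (\<forall>z\<in>upper_half_plane. f z = g (exp (2 * of_real pi * \<i> * z / of_nat h)))))"

text \<open>
  The condition at infinity is imposed on \<open>slash k f \<gamma>\<close> for all \<open>\<gamma>\<close> in the full modular group,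
  which covers all cusps of \<open>\<Gamma>\<^sub>0(M)\<close>. The values of \<open>f\<close> outside the upper half-plane are
  irrelevant.
\<close>

definition modular_forms :: "nat \<Rightarrow> nat \<Rightarrow> (int \<Rightarrow> complex) \<Rightarrow> (complex \<Rightarrow> complex) set" where
  "modular_forms k M \<psi> =
     {f. f holomorphic_on upper_half_plane \<and>
         (\<forall>(a, b, c, d)\<in>Gamma0 M. \<forall>z\<in>upper_half_plane. slash k f (a, b, c, d) z = \<psi> d * f z) \<and>
         (\<forall>\<gamma>\<in>SL2Z. holomorphic_at_infinity (slash k f \<gamma>))}"


section \<open>The generating functions\<close>

definition nome :: "complex \<Rightarrow> complex" where
  "nome z = exp (2 * of_real pi * \<i> * z)"

definition f_Nstar :: "nat \<Rightarrow> nat \<Rightarrow> complex \<Rightarrow> complex" where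
  "f_Nstar a b z =
     (\<Sum>n. of_nat (Nstar a b (8 * n + a + 3 * b)) * nome z ^ (8 * n + a + 3 * b))"

definition f_N :: "nat \<Rightarrow> nat \<Rightarrow> complex \<Rightarrow> complex" where
  "f_N a b z =
     (\<Sum>m. if [m = a + 3 * b] (mod 8) then of_nat (N a b m) * nome z ^ m else 0)"

definition f_Ntilde :: "nat \<Rightarrow> nat \<Rightarrow> complex \<Rightarrow> complex" where
  "f_Ntilde a b z =
     (\<Sum>m. if [m = a + 3 * b] (mod 8) then of_nat (Ntilde a b m) * nome z ^ m else 0)"


section \<open>Convergence of the generating functions\<close>

lemma member_le_sum_list_int:
  assumes "x \<in> set xs" "\<And>x::int. g x \<ge> (0::int)"
  shows "g x \<le> (\<Sum>x\<leftarrow>xs. g x)"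
  using assms(1)
proof (induction xs)
  case (Cons u us)
  have "(\<Sum>x\<leftarrow>us. g x) \<ge> 0"
    by (intro sum_list_nonneg) (use assms(2) in auto)
  with Cons assms(2)[of u] show ?case by (fastforce intro: order.trans)
qed auto

lemma representations_subset:
  "representations a b m \<subseteq>
     {xs. set xs \<subseteq> {-int m..int m} \<and> length xs = a} \<times>
     {ys. set ys \<subseteq> {-int m..int m} \<and> length ys = b}"
proof safe
  fix xs ys assume "(xs, ys) \<in> representations a b m"
  hence *: "length xs = a" "length ys = b"
    "int m = (\<Sum>x\<leftarrow>xs. x\<^sup>2) + (\<Sum>y\<leftarrow>ys. 3 * y\<^sup>2)"
    by (auto simp: representations_def)
  show "length xs = a" "length ys = b" by fact+
  have nn: "(\<Sum>x\<leftarrow>xs. x\<^sup>2) \<ge> 0" "(\<Sum>y\<leftarrow>ys. 3 * y\<^sup>2) \<ge> 0"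
    by (auto intro!: sum_list_nonneg)
  have bd: "u \<in> {-int m..int m}" if "u\<^sup>2 \<le> int m" for u :: int
  proof -
    have "\<bar>u\<bar> \<le> \<bar>u\<bar> * \<bar>u\<bar>" using mult_left_mono[of 1 "\<bar>u\<bar>" "\<bar>u\<bar>"] by (cases "u = 0") auto
    also have "\<dots> = u\<^sup>2" by (simp add: power2_eq_square)
    finally show ?thesis using that by auto
  qed
  show "x \<in> {-int m..int m}" if "x \<in> set xs" for x
    using member_le_sum_list_int[OF that, of "\<lambda>x. x\<^sup>2"] nn *(3) by (intro bd) auto
  show "y \<in> {-int m..int m}" if "y \<in> set ys" for y
  proof (rule bd)
    have "3 * y\<^sup>2 \<le> int m"
      using member_le_sum_list_int[OF that, of "\<lambda>y. 3 * y\<^sup>2"] nn *(3) by auto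
    thus "y\<^sup>2 \<le> int m" using zero_le_power2[of y] by linarith
  qed
qed

lemma finite_representations: "finite (representations a b m)"
  and N_le: "N a b m \<le> (2 * m + 1) ^ (a + b)"
proof -
  let ?L = "\<lambda>k. {xs. set xs \<subseteq> {-int m..int m} \<and> length xs = k}"
  have fin: "finite (?L a \<times> ?L b)"
    by (intro finite_cartesian_product finite_lists_length_eq) auto
  show "finite (representations a b m)"
    using finite_subset[OF representations_subset fin] .
  have "N a b m \<le> card (?L a \<times> ?L b)"
    unfolding N_def by (rule card_mono[OF fin representations_subset])
  also have "\<dots> = (2 * m + 1) ^ (a + b)"
    by (simp add: card_cartesian_product card_lists_length_eq power_add nat_add_distrib nat_mult_distrib)
  finally show "N a b m \<le> (2 * m + 1) ^ (a + b)" .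
qed

lemma Nstar_le_N: "Nstar a b m \<le> N a b m"
  unfolding N_def Nstar_def by (rule card_mono[OF finite_representations]) auto

lemma Ntilde_le_N: "Ntilde a b m \<le> N a b m"
  unfolding N_def Ntilde_def by (rule card_mono[OF finite_representations]) auto

lemma norm_nome_less_1:
  assumes "z \<in> upper_half_plane"
  shows "norm (nome z) < 1"
  using assms by (simp add: nome_def upper_half_plane_def norm_exp_eq_Re)

lemma summable_generating_function:
  assumes "z \<in> upper_half_plane" "\<And>m. c m \<le> N a b m"
  shows "summable (\<lambda>m. norm (of_nat (c m) * nome z ^ m))"
proof -
  define r where "r = norm (nome z)"
  have r: "0 < r" "r < 1"
    using norm_nome_less_1[OF assms(1)] by (auto simp: r_def nome_def)
  have "summable (\<lambda>m. (2 * real m + 1) ^ (a + b) * r ^ m)"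
  proof (rule summable_comparison_test_bigo)
    show "summable (\<lambda>m. norm (1 / real m ^ 2))"
      using inverse_power_summable[of 2, where ?'a = real] by (simp add: field_simps)
    show "(\<lambda>m. (2 * real m + 1) ^ (a + b) * r ^ m) \<in> O(\<lambda>m. 1 / real m ^ 2)"
      using r by real_asymp
  qed
  thus ?thesis
  proof (rule summable_comparison_test'[where N = 0])
    fix m
    have "real (c m) \<le> real ((2 * m + 1) ^ (a + b))"
      using order.trans[OF assms(2)[of m] N_le] of_nat_le_iff by blast
    thus "norm (norm (of_nat (c m) * nome z ^ m)) \<le> (2 * real m + 1) ^ (a + b) * r ^ m"
      by (simp add: norm_mult norm_power r_def mult_right_mono add_ac)
  qed
qed

lemma summable_f_Nstar:
  assumes "z \<in> upper_half_plane"
  shows "summable (\<lambda>n. of_nat (Nstar a b (8 * n + a + 3 * b)) * nome z ^ (8 * n + a + 3 * b))"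
proof -
  have "summable ((\<lambda>m. norm (of_nat (Nstar a b m) * nome z ^ m)) \<circ> (\<lambda>n. 8 * n + a + 3 * b))"
    using summable_generating_function[OF assms Nstar_le_N]
    by (rule summable_reindex) (auto simp: inj_on_def)
  thus ?thesis by (intro summable_norm_cancel[where 'a = complex]) (simp add: o_def)
qed

lemma
  assumes "z \<in> upper_half_plane"
  shows summable_f_N:
      "summable (\<lambda>m. if [m = a + 3 * b] (mod 8) then of_nat (N a b m) * nome z ^ m else 0)"
    and summable_f_Ntilde:
      "summable (\<lambda>m. if [m = a + 3 * b] (mod 8) then of_nat (Ntilde a b m) * nome z ^ m else 0)"
  by (rule summable_comparison_test'[OF summable_generating_function[OF assms, of _ a b], where N = 0],
      rule order.refl Ntilde_le_N, simp)+

end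

theory Submission
  imports Defs "HOL-Probability.Characteristic_Functions"
begin

text \<open>
  With \<open>e(x) = exp (2 \<pi> i x)\<close>, each of the three functions is on the upper half-plane a linear combination
  of products of \<open>a\<close> functions \<open>\<theta>(s z)\<close>, \<open>s \<in> {1, 4, 16}\<close>, and \<open>b\<close> functions \<open>\<theta>(s z)\<close>, \<open>s \<in> {3, 12, 48}\<close>, where
  \<open>\<theta>(z) = \<Sum>\<^sub>n e(n\<^sup>2 z)\<close>: whether \<open>x\<close> is odd, 2 mod 4 or 0 mod 4 determines \<open>x\<^sup>2\<close> mod 8.

  For a matrix \<open>(a, b; c, d)\<close> with \<open>4 s\<close> dividing \<open>c\<close> and \<open>d > 0\<close> one has
  \<open>\<theta>(s \<gamma> z) = G(s b, d) J \<theta>(s z)\<close> with the Gauss sum \<open>G(b, d) = \<Sum>\<^sub>r e(b r\<^sup>2 / d)\<close> over \<open>r\<close> mod \<open>d\<close> and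
  \<open>J\<^sup>2 = (c z + d) / d\<close>, where \<open>J\<close> does not depend on \<open>s\<close>. Indeed \<open>\<gamma> z = b / d + w\<close> with
  \<open>w = z / (d (c z + d))\<close>; split the sum over \<open>n\<close> modulo \<open>d\<close>, apply Poisson summation to each
  class, complete the square in the resulting finite sums, and apply Poisson summation backwards.

  Multiplying \<open>b\<close> by a unit modulo \<open>d\<close> changes \<open>G(b, d)\<close> only by a sign that depends on the unit, so
  the multiplier of a product of an even number of these functions depends on \<open>d\<close> alone. That
  it is a Dirichlet character modulo 192 = 4 * 48 then follows by composing matrices; no
  evaluation of Gauss sums and no reciprocity law is needed. At the cusps, invariance
  under a translation and polynomial growth in \<open>1 / Im z\<close> make the singularity at \<open>q = 0\<close> removable.
\<close>

section \<open>Poisson summation for Gaussians\<close>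

text \<open>A single theta function has half-integral weight, so square roots are unavoidable; no
  branch is ever compared, because only even powers of \<open>J\<close> enter the final formulas.
  The sign by which a unit changes a Gauss sum comes from an averaging argument: for an odd prime p
  the sums \<open>G(u, p)\<close> over all residues u add up to p, which is already the term u = 0,
  so the units contribute 0; as \<open>G\<close> takes one value on the quadratic residues and one
  on the nonresidues, the two values are opposite. Odd moduli are reduced to primes by splitting off
  squares and coprime factors. The inverse needed for completing the square is supplied by the
  determinant: \<open>a d - b c = 1\<close> makes -c an inverse of b modulo d, and divisibility of c
  by 4 allows the linear term to be halved. The character relations are read off from one theta
  product that does not vanish at \<open>\<i>\<close>. Poisson summation itself is proved for real
  parameters by comparing cosine coefficients, both sides being symmetric under x -> 1 - x, and
  reaches complex parameters by the identity theorem.\<close>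

lemma summable_on_power_abs_int:
  fixes r :: real
  assumes "0 \<le> r" "r < 1"
  shows "(\<lambda>n::int. r ^ nat \<bar>n\<bar>) summable_on UNIV"
    and "(\<Sum>\<^sub>\<infinity>n::int. r ^ nat \<bar>n\<bar>) \<le> 2 / (1 - r)"
proof -
  let ?f = "\<lambda>n::int. r ^ nat \<bar>n\<bar>"
  have geo: "((\<lambda>n::nat. r ^ n) has_sum 1 / (1 - r)) UNIV"
    using assms by (intro norm_summable_imp_has_sum geometric_sums) (auto intro!: summable_geometric)
  have sum1: "(?f has_sum 1 / (1 - r)) {0..}"
    by (rule has_sum_reindex_bij_witness[where i = nat and j = int, THEN iffD1, OF _ _ _ _ _ refl geo]) auto
  have "(?f has_sum 1 / (1 - r)) {..0}"
    by (rule has_sum_reindex_bij_witness[where i = "\<lambda>n. nat (-n)" and j = "\<lambda>n. - int n", THEN iffD1, OF _ _ _ _ _ refl geo]) auto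
  moreover from this have "?f summable_on {..<0}"
    by (rule summable_on_subset_banach[OF has_sum_imp_summable]) auto
  moreover have U: "UNIV = {0..} \<union> {..<0::int}" by auto
  ultimately show s: "?f summable_on UNIV"
    unfolding U by (intro summable_on_Un_disjoint has_sum_imp_summable[OF sum1]) auto
  have "(\<Sum>\<^sub>\<infinity>n. ?f n) = (\<Sum>\<^sub>\<infinity>n\<in>{0..}. ?f n) + (\<Sum>\<^sub>\<infinity>n\<in>{..<0}. ?f n)"
    unfolding U by (rule infsum_Un_disjoint) (use s in \<open>auto intro: summable_on_subset_banach\<close>)
  also have "(\<Sum>\<^sub>\<infinity>n\<in>{..<0}. ?f n) \<le> (\<Sum>\<^sub>\<infinity>n\<in>{..0}. ?f n)"
    by (rule infsum_mono_neutral) (use s assms in \<open>auto intro: summable_on_subset_banach\<close>)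
  also have "\<dots> = 1 / (1 - r)" by (rule infsumI) fact
  also have "(\<Sum>\<^sub>\<infinity>n\<in>{0..}. ?f n) = 1 / (1 - r)" by (rule infsumI) fact
  finally show "(\<Sum>\<^sub>\<infinity>n. ?f n) \<le> 2 / (1 - r)" by simp
qed

text \<open>Integers satisfy |n| <= n^2, so a geometric series dominates the Gaussian one.\<close>

lemma gaussian_le_power:
  fixes c :: real
  assumes "c \<ge> 0"
  shows "exp (- c * real_of_int n ^ 2) \<le> exp (- c) ^ nat \<bar>n\<bar>"
proof -
  have "real_of_int \<bar>n\<bar> \<le> real_of_int (n ^ 2)"
    using self_le_power[of "\<bar>n\<bar>" 2] by (subst of_int_le_iff) (cases "n = 0"; simp)
  hence "c * real (nat \<bar>n\<bar>) \<le> c * real_of_int n ^ 2"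
    using assms by (intro mult_left_mono) auto
  thus ?thesis by (simp add: exp_of_nat_mult[symmetric] mult_ac)
qed

text \<open>From (n + 2 x)^2 >= 0 follows (n + x)^2 >= n^2 / 2 - x^2. For |x| <= 1 this gives a
  majorant free of x, as the M-test in the shift requires.\<close>

lemma gaussian_summable:
  fixes c x :: real
  assumes "c > 0"
  shows "(\<lambda>n::int. exp (- c * (real_of_int n + x) ^ 2)) summable_on UNIV"
    and "(\<lambda>n::int. exp (- c * (real_of_int n ^ 2 / 2 - 1))) summable_on UNIV"
    and "\<bar>x\<bar> \<le> 1 \<Longrightarrow> exp (- c * (real_of_int n + x) ^ 2) \<le> exp (- c * (real_of_int n ^ 2 / 2 - 1))"
proof -
  have s: "(\<lambda>n::int. exp (- (c/2) * real_of_int n ^ 2)) summable_on UNIV"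
  proof (rule summable_on_comparison_test)
    show "(\<lambda>n::int. exp (- (c/2)) ^ nat \<bar>n\<bar>) summable_on UNIV"
      by (rule summable_on_power_abs_int) (use assms in auto)
  qed (use gaussian_le_power[of "c/2"] assms in auto)
  have le: "exp (- c * (real_of_int n + x) ^ 2) \<le> exp (- (c/2) * real_of_int n ^ 2) * exp (c * x^2)" for n x
  proof -
    have "real_of_int n ^ 2 / 2 - x ^ 2 \<le> (real_of_int n + x) ^ 2"
      using zero_le_power2[of "real_of_int n + 2 * x"] by (simp add: power2_eq_square algebra_simps)
    hence "c * (real_of_int n ^ 2 / 2 - x ^ 2) \<le> c * (real_of_int n + x) ^ 2"
      using assms by (intro mult_left_mono) auto
    thus ?thesis by (simp add: exp_add[symmetric] algebra_simps)
  qed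
  show "(\<lambda>n::int. exp (- c * (real_of_int n + x) ^ 2)) summable_on UNIV"
    by (rule summable_on_comparison_test[OF summable_on_cmult_left[OF s, of "exp (c*x^2)"]]) (use le in auto)
  have "(\<lambda>n::int. exp (- (c/2) * real_of_int n ^ 2) * exp c) summable_on UNIV"
    by (rule summable_on_cmult_left[OF s])
  thus "(\<lambda>n::int. exp (- c * (real_of_int n ^ 2 / 2 - 1))) summable_on UNIV"
    by (simp add: exp_add[symmetric] algebra_simps)
  show "exp (- c * (real_of_int n + x) ^ 2) \<le> exp (- c * (real_of_int n ^ 2 / 2 - 1))" if "\<bar>x\<bar> \<le> 1"
  proof -
    have "x ^ 2 \<le> 1" using that by (simp add: abs_square_le_1)
    hence "exp (c * x^2) \<le> exp c" using assms by auto
    hence "exp (- c * (real_of_int n + x) ^ 2) \<le> exp (- (c/2) * real_of_int n ^ 2) * exp c"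
      using le[of n x] by (meson exp_ge_zero mult_left_mono order.trans)
    thus ?thesis by (simp add: exp_add[symmetric] algebra_simps)
  qed
qed

text \<open>Up to the substitution x = c y with c^2 = 2 pi t, the integral is the real part of the
  characteristic function of the standard normal distribution.\<close>

lemma integral_gaussian_cos:
  fixes t k :: real
  assumes "t > 0"
  shows "integrable lborel (\<lambda>y. exp (- pi * t * y^2) * cos (2 * pi * k * y))"
    and "(LINT y|lborel. exp (- pi * t * y^2) * cos (2 * pi * k * y)) = exp (- pi * k^2 / t) / sqrt t"
proof -
  \<comment> \<open>The frequency that becomes 2 pi k once x = sqrt (2 pi t) y is
    substituted.\<close>
  define s where "s = 2 * pi * k / sqrt (2 * pi * t)"
  have int: "integrable lborel std_normal_density" by (rule integrable_normal_density) auto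
  have icos: "integrable lborel (\<lambda>x. std_normal_density x * cos (s * x))"
    by (rule Bochner_Integration.integrable_bound[OF int])
       (auto intro!: AE_I2 mult_left_le simp: normal_density_nonneg abs_mult)
  interpret real_distribution std_normal_distribution by (rule real_dist_normal_dist)
  have "exp (- (s^2) / 2) = Re (char std_normal_distribution s)"
    by (simp add: char_std_normal_distribution)
  also have "\<dots> = Re (CLINT x|lborel. std_normal_density x *\<^sub>R iexp (s * x))"
    unfolding char_def by (subst integral_density) (auto simp: normal_density_nonneg)
  also have "\<dots> = (LINT x|lborel. Re (std_normal_density x *\<^sub>R iexp (s * x)))"
  proof (rule integral_Re[symmetric])
    show "integrable lborel (\<lambda>x. std_normal_density x *\<^sub>R iexp (s * x))"
      by (rule Bochner_Integration.integrable_bound[OF int]) (auto simp: normal_density_nonneg)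
  qed
  also have "\<dots> = (LINT x|lborel. std_normal_density x * cos (s * x))"
    by (simp add: Re_exp)
  finally have 1: "(LINT x|lborel. std_normal_density x * cos (s * x)) = exp (- (s^2) / 2)" by simp
  define c where "c = sqrt (2 * pi * t)"
  have c: "c > 0" "c^2 = 2 * pi * t" using assms by (auto simp: c_def)
  have eq: "std_normal_density (0 + c * y) * cos (s * (0 + c * y)) =
     (1 / sqrt (2 * pi)) * (exp (- pi * t * y^2) * cos (2 * pi * k * y))" for y
  proof -
    have 1: "s * (0 + c * y) = 2 * pi * k * y" using c assms by (simp add: s_def c_def)
    have "(0 + c * y)^2 / 2 = pi * t * y^2" using c by (simp add: power_mult_distrib)
    hence "- (0 + c * y)\<^sup>2 / 2 = - pi * t * y^2" by simp
    hence 2: "std_normal_density (0 + c * y) = (1 / sqrt (2 * pi)) * exp (- pi * t * y^2)"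
      unfolding std_normal_density_def by (simp only:)
    show ?thesis unfolding 1 2 by (simp only: mult.assoc)
  qed
  have "integrable lborel (\<lambda>y. (1 / sqrt (2 * pi)) * (exp (- pi * t * y^2) * cos (2 * pi * k * y)))"
    using lborel_integrable_real_affine[OF icos, of c 0] c unfolding eq by simp
  from integrable_mult_right[OF this, of "sqrt (2 * pi)"]
  show "integrable lborel (\<lambda>y. exp (- pi * t * y^2) * cos (2 * pi * k * y))" by simp
  have "exp (- (s^2) / 2) = c * ((1 / sqrt (2 * pi)) * (LINT y|lborel. exp (- pi * t * y^2) * cos (2 * pi * k * y)))"
    using lborel_integral_real_affine[of c "\<lambda>x. std_normal_density x * cos (s * x)" 0] c 1
    unfolding eq by simp
  moreover have "c * (1 / sqrt (2 * pi)) = sqrt t"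
    using assms by (simp add: c_def real_sqrt_mult)
  moreover have "s^2 / 2 = pi * k^2 / t"
    unfolding s_def using assms by (simp add: power_divide power_mult_distrib field_simps power2_eq_square)
  ultimately show "(LINT y|lborel. exp (- pi * t * y^2) * cos (2 * pi * k * y)) = exp (- pi * k^2 / t) / sqrt t"
    using assms by (simp add: field_simps)
qed

lemma integral_cos_int:
  fixes m :: int
  shows "((\<lambda>x. cos (2 * pi * of_int m * x)) has_integral (if m = 0 then 1 else 0)) {0..1}"
proof (cases "m = 0")
  case True
  thus ?thesis using has_integral_const_real[of "1::real" 0 1] by simp
next
  case False
  have "((\<lambda>x. cos (2 * pi * of_int m * x)) has_integral
          (sin (2 * pi * of_int m * 1) / (2 * pi * of_int m) - sin (2 * pi * of_int m * 0) / (2 * pi * of_int m))) {0..1}"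
    using False
    by (intro fundamental_theorem_of_calculus)
       (auto intro!: derivative_eq_intros simp: has_real_derivative_iff_has_vector_derivative[symmetric])
  thus ?thesis using False sin_integer_2pi[of "of_int m"] by (simp add: mult_ac)
qed

text \<open>Product-to-sum leaves two integrals of pure cosines. At n = k = 0 both indicators count,
  which gives 1 instead of 1/2.\<close>

lemma integral_cos_cos_int:
  fixes n k :: int
  shows "((\<lambda>x. cos (2 * pi * of_int n * x) * cos (2 * pi * of_int k * x)) has_integral
           (((if n = k then 1 else 0) + (if n = -k then 1 else 0)) / 2)) {0..1}"
proof -
  have "((\<lambda>x. (cos (2 * pi * of_int (n - k) * x) + cos (2 * pi * of_int (n + k) * x)) / 2) has_integral
           (((if n - k = 0 then 1 else 0) + (if n + k = 0 then 1 else 0)) / 2)) {0..1}"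
    by (intro has_integral_divide has_integral_add integral_cos_int)
  moreover have "n - k = 0 \<longleftrightarrow> n = k" "n + k = 0 \<longleftrightarrow> n = -k" by auto
  moreover have "(cos (2 * pi * of_int (n - k) * x) + cos (2 * pi * of_int (n + k) * x)) / 2 =
      cos (2 * pi * of_int n * x) * cos (2 * pi * of_int k * x)" for x
    by (simp add: left_diff_distrib right_diff_distrib distrib_left distrib_right cos_add cos_diff)
  ultimately show ?thesis by simp
qed

text \<open>By the M-test the finite partial sums converge uniformly along the net of finite sets,
  and uniform convergence carries over both continuity and integration.\<close>

lemma has_sum_integral:
  fixes f :: "'i \<Rightarrow> real \<Rightarrow> real"
  assumes "\<And>n x. x \<in> {a..b} \<Longrightarrow> norm (f n x) \<le> M n" "M summable_on UNIV"
    and "\<And>n. continuous_on {a..b} (f n)"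
  shows "((\<lambda>n. integral {a..b} (f n)) has_sum integral {a..b} (\<lambda>x. \<Sum>\<^sub>\<infinity>n. f n x)) UNIV"
    and "continuous_on {a..b} (\<lambda>x. \<Sum>\<^sub>\<infinity>n. f n x)"
proof -
  have ul: "uniform_limit {a..b} (\<lambda>X y. \<Sum>x\<in>X. f x y) (\<lambda>y. \<Sum>\<^sub>\<infinity>x. f x y) (finite_subsets_at_top UNIV)"
    by (rule Weierstrass_m_test_general[OF assms(1,2)])
  have cont: "continuous_on {a..b} (\<lambda>y. \<Sum>x\<in>X. f x y)" for X
    by (intro continuous_intros assms)
  show "continuous_on {a..b} (\<lambda>x. \<Sum>\<^sub>\<infinity>n. f n x)"
    by (rule uniform_limit_theorem[OF _ ul]) (use cont in auto)
  obtain I J where IJ: "\<And>X. ((\<lambda>y. \<Sum>x\<in>X. f x y) has_integral I X) {a..b}"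
    "((\<lambda>y. \<Sum>\<^sub>\<infinity>x. f x y) has_integral J) {a..b}" "(I \<longlongrightarrow> J) (finite_subsets_at_top UNIV)"
    using uniform_limit_integral[OF ul cont] by auto
  have "\<forall>\<^sub>F X in finite_subsets_at_top UNIV. I X = (\<Sum>n\<in>X. integral {a..b} (f n))"
  proof (rule eventually_finite_subsets_at_top_weakI)
    fix X :: "'i set" assume "finite X"
    hence "integral {a..b} (\<lambda>y. \<Sum>x\<in>X. f x y) = (\<Sum>n\<in>X. integral {a..b} (f n))"
      by (intro integral_sum integrable_continuous_interval assms)
    thus "I X = (\<Sum>n\<in>X. integral {a..b} (f n))" using IJ(1)[of X] by (simp add: integral_unique)
  qed
  hence "((\<lambda>X. \<Sum>n\<in>X. integral {a..b} (f n)) \<longlongrightarrow> J) (finite_subsets_at_top UNIV)"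
    by (rule Lim_transform_eventually[OF IJ(3)])
  thus "((\<lambda>n. integral {a..b} (f n)) has_sum integral {a..b} (\<lambda>x. \<Sum>\<^sub>\<infinity>n. f n x)) UNIV"
    using IJ(2) unfolding has_sum_def by (simp add: integral_unique)
qed

text \<open>Summability is assumed, so the unordered sum may be evaluated along the symmetric
  windows [-N, N), where the unit pieces glue to the integral over [-N, N]; dominated convergence
  then gives the integral over the line.\<close>

lemma has_sum_integral_unit_intervals:
  fixes g :: "real \<Rightarrow> real"
  assumes cont: "continuous_on UNIV g" and int: "integrable lborel g"
    and summ: "(\<lambda>n::int. integral {0..1} (\<lambda>x. g (of_int n + x))) summable_on UNIV"
  shows "((\<lambda>n::int. integral {0..1} (\<lambda>x. g (of_int n + x))) has_sum (LINT x|lborel. g x)) UNIV"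
proof -
  let ?a = "\<lambda>n::int. integral {0..1} (\<lambda>x. g (of_int n + x))"
  define S where "S = (\<Sum>\<^sub>\<infinity>n. ?a n)"
  have S: "(?a has_sum S) UNIV" unfolding S_def using summ by simp
  \<comment> \<open>Every finite set of integers lies in some window, so the windows are cofinal
    among the finite sets.\<close>
  have lim: "filterlim (\<lambda>N::nat. {- int N..<int N}) (finite_subsets_at_top UNIV) sequentially"
    unfolding filterlim_finite_subsets_at_top
  proof safe
    fix A :: "int set" assume "finite A"
    define B where "B = (\<Sum>x\<in>A. \<bar>x\<bar>)"
    have B: "\<bar>x\<bar> \<le> B" if "x \<in> A" for x
      unfolding B_def using \<open>finite A\<close> that by (intro member_le_sum) auto
    have "\<forall>\<^sub>F N in sequentially. nat \<bar>B\<bar> < N" by (rule eventually_gt_at_top)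
    thus "\<forall>\<^sub>F N in sequentially. finite {- int N..<int N} \<and> A \<subseteq> {- int N..<int N} \<and> {- int N..<int N} \<subseteq> UNIV"
    proof eventually_elim
      case (elim N)
      have "x \<in> {- int N..<int N}" if "x \<in> A" for x using B[OF that] elim by auto
      thus ?case by auto
    qed
  qed
  have lim1: "(\<lambda>N. \<Sum>n\<in>{- int N..<int N}. ?a n) \<longlonglongrightarrow> S"
    using filterlim_compose[OF S[unfolded has_sum_def] lim] .
  have ci: "g integrable_on {u..v}" for u v
    by (intro integrable_continuous_interval continuous_on_subset[OF cont]) auto
  have a: "?a n = integral {of_int n..of_int n + 1} g" for n
  proof -
    have "integral {0..1} (g \<circ> (\<lambda>x. x + of_int n)) = integral {of_int n..of_int n + 1} g"
      using integral_shift[where f = g and a = 0 and b = 1 and c = "of_int n"] continuous_on_subset[OF cont]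
      by (simp add: add_ac)
    thus ?thesis by (simp add: o_def add_ac)
  qed
  have part: "(\<Sum>n\<in>{- int N..<int N}. ?a n) = integral {- real N..real N} g" for N :: nat
  proof (induction N)
    case (Suc N)
    have "{- int (Suc N)..<int (Suc N)} = insert (- int N - 1) (insert (int N) {- int N..<int N})"
      by auto
    hence "(\<Sum>n\<in>{- int (Suc N)..<int (Suc N)}. ?a n) = ?a (- int N - 1) + ?a (int N) + integral {- real N..real N} g"
      using Suc by simp
    also have "\<dots> = (integral {- real N - 1..- real N} g + integral {- real N..real N} g) + integral {real N..real N + 1} g"
      unfolding a by (simp add: algebra_simps)
    also have "\<dots> = integral {- real N - 1..real N + 1} g"
      by (simp add: Henstock_Kurzweil_Integration.integral_combine ci)
    finally show ?case by (simp add: algebra_simps minus_diff_commute)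
  qed auto
  have "(\<lambda>N. LINT x|lborel. indicator {- real N..real N} x * g x) \<longlonglongrightarrow> (LINT x|lborel. g x)"
  proof (rule integral_dominated_convergence[where w = "\<lambda>x. norm (g x)"])
    show "AE x in lborel. (\<lambda>N. indicator {- real N..real N} x * g x) \<longlonglongrightarrow> g x"
    proof (rule AE_I2)
      fix x :: real
      have "\<forall>\<^sub>F N in sequentially. nat \<lceil>\<bar>x\<bar>\<rceil> \<le> N" by (rule eventually_ge_at_top)
      hence "\<forall>\<^sub>F N in sequentially. indicator {- real N..real N} x * g x = g x"
        by eventually_elim (auto simp: indicator_def nat_ceiling_le_eq)
      thus "(\<lambda>N. indicator {- real N..real N} x * g x) \<longlonglongrightarrow> g x" by (rule tendsto_eventually)
    qed
  qed (use int in \<open>auto simp: indicator_def borel_measurable_integrable\<close>)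
  moreover have "(LINT x|lborel. indicator {- real N..real N} x * g x) = integral {- real N..real N} g" for N
  proof -
    have "set_integrable lborel {- real N..real N} g"
      by (intro borel_integrable_atLeastAtMost' continuous_on_subset[OF cont]) auto
    from set_borel_integral_eq_integral(2)[OF this] show ?thesis
      by (simp add: set_lebesgue_integral_def)
  qed
  ultimately have "(\<lambda>N. integral {- real N..real N} g) \<longlonglongrightarrow> (LINT x|lborel. g x)" by simp
  hence "S = (LINT x|lborel. g x)" using lim1 unfolding part by (metis LIMSEQ_unique)
  thus ?thesis using S by simp
qed

text \<open>By the symmetry x -> 1 - x, D is a continuous function H of cos (2 pi x). Vanishing
  cosine moments make D orthogonal to every polynomial in cos (2 pi x), and approximating H by
  polynomials forces the integral of D^2 to be 0.\<close>

lemma cos_moments_zero_imp_zero: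
  fixes D :: "real \<Rightarrow> real"
  assumes cont: "continuous_on {0..1} D" and refl: "\<And>x. x \<in> {0..1} \<Longrightarrow> D (1 - x) = D x"
    and mom: "\<And>k::nat. integral {0..1} (\<lambda>x. D x * cos (2 * pi * real k * x)) = 0"
    and x: "x \<in> {0..1}"
  shows "D x = 0"
proof -
  have ci: "(\<lambda>x. D x * h x) integrable_on {0..1}" if "continuous_on {0..1} h" for h
    by (intro integrable_continuous_interval continuous_intros cont that)
  \<comment> \<open>The extra cosine of arbitrary frequency k lets the induction on j absorb one
    factor at a time by product-to-sum.\<close>
  have pow: "integral {0..1} (\<lambda>x. D x * (cos (2 * pi * real k * x) * cos (2 * pi * x) ^ j)) = 0" for k j :: nat
  proof (induction j arbitrary: k)
    case (Suc j)
    \<comment> \<open>For k = 0 the lower frequency would be -1; evenness of the cosine replaces it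
      by 1, since k is a natural number.\<close>
    have eq: "cos (2 * pi * real k * x) * cos (2 * pi * x) ^ Suc j =
       (cos (2 * pi * real (Suc k) * x) * cos (2 * pi * x) ^ j +
        cos (2 * pi * real (if k = 0 then 1 else k - 1) * x) * cos (2 * pi * x) ^ j) / 2" for x
    proof (cases k)
      case 0
      thus ?thesis by simp
    next
      case (Suc m)
      have "2 * pi * real (Suc m) * x - 2 * pi * x = 2 * pi * real m * x"
        "2 * pi * real (Suc m) * x + 2 * pi * x = 2 * pi * real (Suc (Suc m)) * x"
        by (simp_all add: algebra_simps)
      hence "cos (2 * pi * real (Suc m) * x) * cos (2 * pi * x) =
        (cos (2 * pi * real m * x) + cos (2 * pi * real (Suc (Suc m)) * x)) / 2"
        by (simp only: cos_times_cos)
      hence "(cos (2 * pi * real (Suc m) * x) * cos (2 * pi * x)) * cos (2 * pi * x) ^ j =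
        ((cos (2 * pi * real m * x) + cos (2 * pi * real (Suc (Suc m)) * x)) / 2) * cos (2 * pi * x) ^ j"
        by (simp only:)
      thus ?thesis unfolding Suc by (simp only: power_Suc mult.assoc nat.simps diff_Suc_1 if_False) (simp add: field_simps)
    qed
    have "integral {0..1} (\<lambda>x. D x * (cos (2 * pi * real k * x) * cos (2 * pi * x) ^ Suc j)) =
      integral {0..1} (\<lambda>x. (D x * (cos (2 * pi * real (Suc k) * x) * cos (2 * pi * x) ^ j) +
        D x * (cos (2 * pi * real (if k = 0 then 1 else k - 1) * x) * cos (2 * pi * x) ^ j)) / 2)"
      unfolding eq by (intro Henstock_Kurzweil_Integration.integral_cong) (simp add: algebra_simps)
    also have "\<dots> = (integral {0..1} (\<lambda>x. D x * (cos (2 * pi * real (Suc k) * x) * cos (2 * pi * x) ^ j)) +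
      integral {0..1} (\<lambda>x. D x * (cos (2 * pi * real (if k = 0 then 1 else k - 1) * x) * cos (2 * pi * x) ^ j))) / 2"
      by (subst integral_divide, subst Henstock_Kurzweil_Integration.integral_add)
         (auto intro!: ci continuous_intros)
    also have "\<dots> = 0" unfolding Suc.IH by simp
    finally show ?case .
  qed (use mom in simp)
  have poly: "integral {0..1} (\<lambda>x. D x * p (cos (2 * pi * x))) = 0" if rp: "real_polynomial_function p" for p
  proof -
    obtain a n where p: "p = (\<lambda>x. \<Sum>i\<le>n. a i * x ^ i)"
      using real_polynomial_function_imp_sum[OF rp] by blast
    have "integral {0..1} (\<lambda>x. D x * p (cos (2 * pi * x))) =
      integral {0..1} (\<lambda>x. \<Sum>i\<le>n. a i * (D x * (cos (2 * pi * real 0 * x) * cos (2 * pi * x) ^ i)))"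
      unfolding p by (simp add: sum_distrib_left mult_ac)
    also have "\<dots> = (\<Sum>i\<le>n. a i * integral {0..1} (\<lambda>x. (D x * (cos (2 * pi * real 0 * x) * cos (2 * pi * x) ^ i))))"
      by (subst integral_sum)
         (auto intro!: integrable_continuous_interval continuous_intros cont simp del: of_nat_0 mult_zero_left mult_zero_right)
    also have "\<dots> = 0" by (simp only: pow) simp
    finally show ?thesis .
  qed
  define H where "H = (\<lambda>u. D (arccos u / (2 * pi)))"
  have Hcont: "continuous_on {-1..1} H"
    unfolding H_def
  proof (rule continuous_on_compose2[OF cont])
    show "continuous_on {-1..1} (\<lambda>u. arccos u / (2 * pi))"
      by (intro continuous_intros) auto
    have "arccos u \<ge> 0" "arccos u \<le> 2 * pi" if "u \<in> {-1..1}" for u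
      using arccos_lbound[of u] arccos_ubound[of u] that pi_gt_zero by auto
    thus "(\<lambda>u. arccos u / (2 * pi)) ` {-1..1} \<subseteq> {0..1}" by (auto simp: field_simps)
  qed
  \<comment> \<open>\<open>arccos\<close> inverts the cosine only on [0, pi], that is for x <= 1/2;
    the symmetry of D covers the other half.\<close>
  have DH: "D x = H (cos (2 * pi * x))" if "x \<in> {0..1}" for x
  proof (cases "x \<le> 1/2")
    case True
    hence "arccos (cos (2 * pi * x)) = 2 * pi * x"
      using that by (intro arccos_cos) auto
    thus ?thesis by (simp add: H_def)
  next
    case False
    hence "arccos (cos (2 * pi * (1 - x))) = 2 * pi * (1 - x)"
      using that by (intro arccos_cos) auto
    moreover have "cos (2 * pi * (1 - x)) = cos (2 * pi * x)"
      by (simp add: right_diff_distrib cos_diff)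
    ultimately have "arccos (cos (2 * pi * x)) = 2 * pi * (1 - x)" by simp
    thus ?thesis using refl[OF that] by (simp add: H_def)
  qed
  have bdd: "bounded (D ` {0..1})"
    by (intro compact_imp_bounded compact_continuous_image cont) auto
  then obtain B where B: "B > 0" "\<And>x. x \<in> {0..1} \<Longrightarrow> \<bar>D x\<bar> \<le> B"
    by (auto simp: bounded_pos)
  have DD: "(\<lambda>x. D x * D x) integrable_on {0..1}" by (rule ci) (rule cont)
  have "integral {0..1} (\<lambda>x. D x * D x) \<le> e" if e: "e > 0" for e
  proof -
    obtain p where p: "real_polynomial_function p" "\<And>u. u \<in> {-1..1} \<Longrightarrow> \<bar>H u - p u\<bar> < e / B"
      using Stone_Weierstrass_real_polynomial_function[OF _ Hcont, of "e / B"] B e by auto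
    obtain a n where pa: "p = (\<lambda>x. \<Sum>i\<le>n. a i * x ^ i)"
      using real_polynomial_function_imp_sum[OF p(1)] by blast
    have pc: "continuous_on {0..1} (\<lambda>x. p (cos (2 * pi * x)))"
      unfolding pa by (intro continuous_intros)
    \<comment> \<open>Subtracting a vanishing integral leaves D times the approximation error of H,
      which is at most B times e / B.\<close>
    have "integral {0..1} (\<lambda>x. D x * D x) = integral {0..1} (\<lambda>x. D x * D x) - integral {0..1} (\<lambda>x. D x * p (cos (2 * pi * x)))"
      using poly[OF p(1)] by simp
    also have "\<dots> = integral {0..1} (\<lambda>x. D x * D x - D x * p (cos (2 * pi * x)))"
      by (rule Henstock_Kurzweil_Integration.integral_diff[symmetric]) (use DD ci[OF pc] in auto)
    also have "\<dots> \<le> integral {0..1} (\<lambda>x::real. e)"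
    proof (rule integral_le)
      show "(\<lambda>x. D x * D x - D x * p (cos (2 * pi * x))) integrable_on {0..1}"
        by (rule Henstock_Kurzweil_Integration.integrable_diff) (use DD ci[OF pc] in auto)
      fix x :: real assume x: "x \<in> {0..1}"
      have "D x * D x - D x * p (cos (2 * pi * x)) = D x * (H (cos (2 * pi * x)) - p (cos (2 * pi * x)))"
        using DH[OF x] by (simp add: algebra_simps)
      also have "\<dots> \<le> \<bar>D x\<bar> * \<bar>H (cos (2 * pi * x)) - p (cos (2 * pi * x))\<bar>"
        by (metis abs_ge_self abs_mult)
      also have "\<dots> \<le> B * (e / B)"
        using B x p(2)[of "cos (2 * pi * x)"] by (intro mult_mono) auto
      finally show "D x * D x - D x * p (cos (2 * pi * x)) \<le> e" using B by simp
    qed auto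
    finally show ?thesis by simp
  qed
  hence "integral {0..1} (\<lambda>x. D x * D x) \<le> 0"
    using field_le_epsilon[of "integral {0..1} (\<lambda>x. D x * D x)" 0] by simp
  moreover have "integral {0..1} (\<lambda>x. D x * D x) \<ge> 0"
    by (rule Henstock_Kurzweil_Integration.integral_nonneg) (use DD in auto)
  ultimately have "((\<lambda>x. D x * D x) has_integral 0) (cbox 0 1)"
    using DD by (simp add: has_integral_integral)
  hence "D x * D x = 0"
    by (rule has_integral_0_cbox_imp_0[rotated 2])
       (use x in \<open>auto intro!: continuous_intros cont simp del: has_integral_integral\<close>)
  thus ?thesis by simp
qed

text \<open>Both sides are continuous in x and symmetric under x -> 1 - x, so comparing cosine
  coefficients suffices. On the left they unfold to an integral over the whole line, on the right
  they are read off by orthogonality.\<close>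

theorem poisson_gaussian_real:
  fixes t x :: real
  assumes t: "t > 0" and x: "x \<in> {0..1}"
  shows "(\<Sum>\<^sub>\<infinity>n::int. exp (- pi * t * (of_int n + x)^2)) =
         (\<Sum>\<^sub>\<infinity>n::int. exp (- pi * of_int n ^ 2 / t) * cos (2 * pi * of_int n * x)) / sqrt t"
proof -
  define L where "L = (\<lambda>x. \<Sum>\<^sub>\<infinity>n::int. exp (- pi * t * (of_int n + x)^2))"
  define R where "R = (\<lambda>x. \<Sum>\<^sub>\<infinity>n::int. exp (- pi * of_int n ^ 2 / t) * cos (2 * pi * of_int n * x))"
  define D where "D = (\<lambda>x. L x - R x / sqrt t)"
  let ?M = "\<lambda>n::int. exp (- (pi * t) * (of_int n ^ 2 / 2 - 1))"
  let ?M' = "\<lambda>n::int. exp (- (pi / t) * (of_int n + 0) ^ 2)"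
  have M: "?M summable_on UNIV" "?M' summable_on UNIV"
    using t by (intro gaussian_summable(1,2); simp)+
  have leM: "exp (- pi * t * (of_int n + x)^2) \<le> ?M n" if "x \<in> {0..1}" for x and n :: int
    using gaussian_summable(3)[of "pi * t" x n] t that by simp
  have L_cos: "((\<lambda>n::int. integral {0..1} (\<lambda>x. exp (- pi * t * (of_int n + x)^2) * cos (2 * pi * of_int k * x))) has_sum
      integral {0..1} (\<lambda>x. \<Sum>\<^sub>\<infinity>n::int. exp (- pi * t * (of_int n + x)^2) * cos (2 * pi * of_int k * x))) UNIV" for k :: int
  proof (rule has_sum_integral(1)[OF _ M(1)])
    fix x :: real and n :: int assume x: "x \<in> {0..1}"
    have "norm (exp (- pi * t * (of_int n + x)^2) * cos (2 * pi * of_int k * x)) \<le> exp (- pi * t * (of_int n + x)^2) * 1"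
      by (simp add: abs_mult)
    thus "norm (exp (- pi * t * (of_int n + x)^2) * cos (2 * pi * of_int k * x)) \<le> ?M n"
      using leM[OF x, of n] by linarith
  qed (intro continuous_intros)
  have shift: "cos (2 * pi * of_int k * (of_int n + x)) = cos (2 * pi * of_int k * x)" for k n :: int and x :: real
  proof -
    have "2 * pi * of_int k * (of_int n + x) = 2 * pi * of_int k * x + 2 * pi * of_int (k * n)"
      by (simp add: algebra_simps)
    thus ?thesis by (simp add: cos_add sin_integer_2pi cos_integer_2pi)
  qed
  have cont_L: "continuous_on {0..1} L" unfolding L_def
    by (rule has_sum_integral(2)[OF _ M(1)]) (use leM in \<open>auto intro!: continuous_intros\<close>)
  have cont_R: "continuous_on {0..1} R" unfolding R_def
    by (rule has_sum_integral(2)[OF _ M(2)]) (auto intro!: continuous_intros mult_left_le simp: abs_mult)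
  have L_coeff: "integral {0..1} (\<lambda>x. L x * cos (2 * pi * of_int k * x)) = exp (- pi * of_int k ^ 2 / t) / sqrt t" for k :: int
  proof -
    have "(\<Sum>\<^sub>\<infinity>n::int. exp (- pi * t * (of_int n + x)^2) * cos (2 * pi * of_int k * x)) = L x * cos (2 * pi * of_int k * x)" for x
      unfolding L_def by (rule infsum_cmult_left')
    \<comment> \<open>The cosine does not see an integer shift, so the integrals over [0, 1] become
      consecutive pieces of one integral over the line.\<close>
    hence s: "((\<lambda>n::int. integral {0..1} (\<lambda>x. exp (- pi * t * (of_int n + x)^2) * cos (2 * pi * of_int k * (of_int n + x)))) has_sum
      integral {0..1} (\<lambda>x. L x * cos (2 * pi * of_int k * x))) UNIV"
      using L_cos[of k] by (simp add: shift)
    have "continuous_on UNIV (\<lambda>y. exp (- pi * t * y^2) * cos (2 * pi * of_int k * y))"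
      by (intro continuous_intros)
    from has_sum_integral_unit_intervals[OF this integral_gaussian_cos(1)[OF t] has_sum_imp_summable[OF s]]
    have "((\<lambda>n::int. integral {0..1} (\<lambda>x. exp (- pi * t * (of_int n + x)^2) * cos (2 * pi * of_int k * (of_int n + x)))) has_sum
      exp (- pi * of_int k ^ 2 / t) / sqrt t) UNIV"
      unfolding integral_gaussian_cos(2)[OF t, of "of_int k"] .
    from has_sum_unique[OF s this] show ?thesis .
  qed
  have R_coeff: "integral {0..1} (\<lambda>x. R x * cos (2 * pi * of_int k * x)) = exp (- pi * of_int k ^ 2 / t)" for k :: int
  proof -
    let ?e = "\<lambda>n::int. exp (- pi * of_int n ^ 2 / t)"
    have "((\<lambda>n::int. integral {0..1} (\<lambda>x. ?e n * cos (2 * pi * of_int n * x) * cos (2 * pi * of_int k * x))) has_sum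
      integral {0..1} (\<lambda>x. \<Sum>\<^sub>\<infinity>n::int. ?e n * cos (2 * pi * of_int n * x) * cos (2 * pi * of_int k * x))) UNIV"
    proof (rule has_sum_integral(1)[OF _ M(2)])
      fix x :: real and n :: int
      have "norm (?e n * cos (2 * pi * of_int n * x) * cos (2 * pi * of_int k * x)) \<le> ?e n * 1 * 1"
        unfolding norm_mult by (intro mult_mono) auto
      thus "norm (?e n * cos (2 * pi * of_int n * x) * cos (2 * pi * of_int k * x)) \<le> ?M' n" by simp
    qed (intro continuous_intros)
    also have "(\<lambda>x. \<Sum>\<^sub>\<infinity>n::int. ?e n * cos (2 * pi * of_int n * x) * cos (2 * pi * of_int k * x)) = (\<lambda>x. R x * cos (2 * pi * of_int k * x))"
      unfolding R_def by (intro ext infsum_cmult_left')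
    also have "(\<lambda>n::int. integral {0..1} (\<lambda>x. ?e n * cos (2 * pi * of_int n * x) * cos (2 * pi * of_int k * x))) =
       (\<lambda>n. ?e n * (((if n = k then 1 else 0) + (if n = -k then 1 else 0)) / 2))"
    proof
      fix n :: int
      show "integral {0..1} (\<lambda>x. ?e n * cos (2 * pi * of_int n * x) * cos (2 * pi * of_int k * x)) =
        ?e n * (((if n = k then 1 else 0) + (if n = -k then 1 else 0)) / 2)"
        using integral_unique[OF has_integral_mult_right[OF integral_cos_cos_int, of "?e n" n k]] by (simp add: mult_ac)
    qed
    finally have "((\<lambda>n. ?e n * (((if n = k then 1 else 0) + (if n = -k then 1 else 0)) / 2)) has_sum
       integral {0..1} (\<lambda>x. R x * cos (2 * pi * of_int k * x))) UNIV" .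
    moreover have "((\<lambda>n. ?e n * (((if n = k then 1 else 0) + (if n = -k then 1 else 0)) / 2)) has_sum
       (\<Sum>n\<in>{k,-k}. ?e n * (((if n = k then 1 else 0) + (if n = -k then 1 else 0)) / 2))) UNIV"
      by (rule has_sum_finite_neutralI) auto
    \<comment> \<open>For k = 0 the set collapses to one element, which then carries both
      indicators; otherwise each element contributes one half.\<close>
    moreover have "(\<Sum>n\<in>{k,-k}. ?e n * (((if n = k then 1 else 0) + (if n = -k then 1 else 0)) / 2)) = ?e k"
      by (cases "k = 0") auto
    ultimately show ?thesis by (metis (no_types, lifting) has_sum_unique)
  qed
  have "D x = 0"
  proof (rule cos_moments_zero_imp_zero[where D = D and x = x])
    show "continuous_on {0..1} D"
      unfolding D_def using t by (intro continuous_on_diff continuous_on_divide continuous_on_const cont_L cont_R) simp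
    fix x :: real assume "x \<in> {0..1}"
    have "L (1 - x) = L x" unfolding L_def
      by (rule infsum_reindex_bij_witness[of _ "\<lambda>n. -n - 1" "\<lambda>n. -n - 1"])
         (auto simp: power2_eq_square algebra_simps)
    moreover have "cos (2 * pi * of_int n * (1 - x)) = cos (2 * pi * of_int n * x)" for n :: int
      using shift[of n 1 "-x"] by simp
    hence "R (1 - x) = R x" unfolding R_def by (simp only:)
    ultimately show "D (1 - x) = D x" by (simp add: D_def)
  next
    fix k :: nat
    have i: "(\<lambda>x. L x * cos (2 * pi * real k * x)) integrable_on {0..1}"
        "(\<lambda>x. R x * cos (2 * pi * real k * x)) integrable_on {0..1}"
      by (intro integrable_continuous_interval continuous_intros cont_L cont_R)+
    have "integral {0..1} (\<lambda>x. D x * cos (2 * pi * real k * x)) =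
       integral {0..1} (\<lambda>x. L x * cos (2 * pi * real k * x) - R x * cos (2 * pi * real k * x) / sqrt t)"
      by (simp add: D_def algebra_simps)
    also have "\<dots> = integral {0..1} (\<lambda>x. L x * cos (2 * pi * real k * x)) - integral {0..1} (\<lambda>x. R x * cos (2 * pi * real k * x)) / sqrt t"
      using i integrable_on_divide[OF i(2), of "sqrt t"] by (simp add: Henstock_Kurzweil_Integration.integral_diff)
    also have "\<dots> = 0"
      using L_coeff[of "int k"] R_coeff[of "int k"] by simp
    finally show "integral {0..1} (\<lambda>x. D x * cos (2 * pi * real k * x)) = 0" .
  qed (use x in auto)
  thus ?thesis by (simp add: D_def L_def R_def)
qed

section \<open>Poisson summation for complex parameters\<close>

lemma holomorphic_on_infsum:
  fixes f :: "'i \<Rightarrow> complex \<Rightarrow> complex"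
  assumes "open S" and hol: "\<And>n. f n holomorphic_on S"
    and bd: "\<And>z. z \<in> S \<Longrightarrow> \<exists>r>0. \<exists>M. cball z r \<subseteq> S \<and> M summable_on UNIV \<and> (\<forall>n. \<forall>w\<in>cball z r. norm (f n w) \<le> M n)"
  shows "(\<lambda>z. \<Sum>\<^sub>\<infinity>n. f n z) holomorphic_on S"
proof -
  have "\<exists>r>0. (\<lambda>z. \<Sum>\<^sub>\<infinity>n. f n z) holomorphic_on ball z r" if z: "z \<in> S" for z
  proof -
    obtain r M where r: "r > 0" "cball z r \<subseteq> S" "M summable_on UNIV" "\<And>n w. w \<in> cball z r \<Longrightarrow> norm (f n w) \<le> M n"
      using bd[OF z] by auto
    have ul: "uniform_limit (cball z r) (\<lambda>X y. \<Sum>x\<in>X. f x y) (\<lambda>y. \<Sum>\<^sub>\<infinity>x. f x y) (finite_subsets_at_top UNIV)"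
      by (rule Weierstrass_m_test_general[OF r(4,3)])
    have "\<forall>\<^sub>F X in finite_subsets_at_top UNIV. continuous_on (cball z r) (\<lambda>y. \<Sum>x\<in>X. f x y) \<and> (\<lambda>y. \<Sum>x\<in>X. f x y) holomorphic_on ball z r"
      using r(2) ball_subset_cball
      by (intro always_eventually allI conjI continuous_on_sum holomorphic_on_sum holomorphic_on_imp_continuous_on holomorphic_on_subset[OF hol]) auto
    from holomorphic_uniform_limit[OF this ul] show ?thesis using r(1) by auto
  qed
  thus ?thesis
    by (metis analytic_on_def analytic_on_open \<open>open S\<close>)
qed

text \<open>The shift \<open>x\<close> and the weights \<open>u\<close> cover both sides of the
  Poisson formula: a shift with weights 1 on the left, shift 0 with cosine weights on the right. The
  disc of radius Re t / 2 around t admits a uniform majorant.\<close>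

lemma holomorphic_gaussian_series:
  fixes x :: real and u :: "int \<Rightarrow> complex"
  assumes "\<And>n. norm (u n) \<le> 1"
  shows "(\<lambda>t. \<Sum>\<^sub>\<infinity>n::int. exp (- of_real pi * t * of_real (of_int n + x)^2) * u n) holomorphic_on {t. Re t > 0}"
proof (rule holomorphic_on_infsum)
  fix t :: complex assume t: "t \<in> {t. Re t > 0}"
  define c where "c = Re t / 2"
  have c: "c > 0" using t by (simp add: c_def)
  have Re: "Re w \<ge> c" if "w \<in> cball t c" for w
    using abs_Re_le_cmod[of "t - w"] that by (auto simp: c_def dist_norm)
  show "\<exists>r>0. \<exists>M. cball t r \<subseteq> {t. Re t > 0} \<and> M summable_on UNIV \<and>
      (\<forall>n. \<forall>w\<in>cball t r. norm (exp (- of_real pi * w * of_real (of_int n + x)^2) * u n) \<le> M n)"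
  proof (intro exI conjI allI ballI)
    show "(\<lambda>n::int. exp (- (pi * c) * (of_int n + x)^2)) summable_on UNIV"
      using c by (intro gaussian_summable) auto
    fix n :: int and w assume w: "w \<in> cball t c"
    have "norm (exp (- of_real pi * w * of_real (of_int n + x)^2) * u n) \<le> exp (- pi * Re w * (of_int n + x)^2) * 1"
      unfolding norm_mult using assms[of n] by (intro mult_mono) (auto simp flip: of_real_power)
    also have "\<dots> \<le> exp (- (pi * c) * (of_int n + x)^2)"
      using Re[OF w] by (auto intro!: mult_right_mono)
    finally show "norm (exp (- of_real pi * w * of_real (of_int n + x)^2) * u n) \<le> exp (- (pi * c) * (of_int n + x)^2)" .
  qed (use c Re in force)+
qed (auto intro!: holomorphic_intros open_halfspace_Re_gt)

lemma infsum_of_real_complex: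
  "(\<Sum>\<^sub>\<infinity>x\<in>A. complex_of_real (f x)) = of_real (\<Sum>\<^sub>\<infinity>x\<in>A. f x)"
proof (cases "f summable_on A")
  case True
  thus ?thesis by (intro infsumI has_sum_of_real) simp
next
  case False
  hence "\<not> (\<lambda>x. complex_of_real (f x)) summable_on A"
    using summable_on_Re by fastforce
  thus ?thesis using False by (simp add: infsum_not_exists)
qed

text \<open>On the right half-plane, which avoids the cut of \<open>csqrt\<close>, both sides are
  holomorphic. They agree on the positive real axis, so the identity theorem applies.\<close>

theorem poisson_gaussian:
  fixes t :: complex and x :: real
  assumes t: "Re t > 0" and x: "x \<in> {0..1}"
  shows "(\<Sum>\<^sub>\<infinity>n::int. exp (- of_real pi * t * of_real (of_int n + x)^2)) =
         (\<Sum>\<^sub>\<infinity>n::int. exp (- of_real pi * of_int n ^ 2 / t) * of_real (cos (2 * pi * of_int n * x))) / csqrt t"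
proof -
  define f where "f = (\<lambda>t. \<Sum>\<^sub>\<infinity>n::int. exp (- of_real pi * t * of_real (of_int n + x)^2) * (1::complex))"
  define g where "g = (\<lambda>t. \<Sum>\<^sub>\<infinity>n::int. exp (- of_real pi * t * of_real (of_int n + 0)^2) * complex_of_real (cos (2 * pi * of_int n * x)))"
  have hf: "f holomorphic_on {t. Re t > 0}" and hg: "g holomorphic_on {t. Re t > 0}"
    unfolding f_def g_def by (rule holomorphic_gaussian_series; simp)+
  define F where "F = (\<lambda>t. f t - g (1 / t) / csqrt t)"
  have "Re (1 / t) > 0" if "Re t > 0" for t :: complex
    using that by (auto simp: Re_divide complex_eq_0 intro!: divide_pos_pos add_pos_nonneg)
  hence "(\<lambda>t. g (1 / t)) holomorphic_on {t. Re t > 0}"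
    by (intro holomorphic_on_compose_gen[OF _ hg, unfolded o_def] holomorphic_intros) auto
  moreover have "csqrt holomorphic_on {t. Re t > 0}"
    by (rule holomorphic_on_csqrt[THEN holomorphic_on_subset]) (auto simp: complex_nonpos_Reals_iff)
  ultimately have hF: "F holomorphic_on {t. Re t > 0}"
    unfolding F_def by (intro holomorphic_on_diff holomorphic_on_divide hf) auto
  have zero: "F (of_real s) = 0" if s: "s > 0" for s :: real
  proof -
    have "f (of_real s) = of_real (\<Sum>\<^sub>\<infinity>n::int. exp (- pi * s * (of_int n + x)^2))"
      unfolding f_def by (simp flip: infsum_of_real_complex exp_of_real)
    moreover have "g (1 / of_real s) = of_real (\<Sum>\<^sub>\<infinity>n::int. exp (- pi * of_int n ^ 2 / s) * cos (2 * pi * of_int n * x))"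
      unfolding g_def by (simp flip: infsum_of_real_complex exp_of_real)
    ultimately show ?thesis using poisson_gaussian_real[OF s x] s by (simp add: F_def)
  qed
  have "F t = 0"
  proof (rule analytic_continuation[OF hF])
    show "open {t. Re t > 0}" by (rule open_halfspace_Re_gt)
    show "connected {t. Re t > 0}" by (intro convex_connected convex_halfspace_Re_gt)
    show "complex_of_real ` {0<..} \<subseteq> {t. Re t > 0}" by auto
    show "1 islimpt complex_of_real ` {0<..}"
    proof (rule islimptI)
      fix T :: "complex set" assume "1 \<in> T" "open T"
      then obtain e where e: "e > 0" "ball 1 e \<subseteq> T" using openE by blast
      show "\<exists>y\<in>complex_of_real ` {0<..}. y \<in> T \<and> y \<noteq> 1"
      proof (rule bexI[of _ "complex_of_real (1 + e/2)"])
        have "dist 1 (complex_of_real (1 + e/2)) < e" using e by (simp add: dist_norm)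
        thus "complex_of_real (1 + e/2) \<in> T \<and> complex_of_real (1 + e/2) \<noteq> 1"
          using e by (auto simp: subset_iff simp del: of_real_add)
      qed (rule imageI, use e in simp)
    qed
    show "F z = 0" if "z \<in> complex_of_real ` {0<..}" for z
      using that zero by auto
    show "t \<in> {t. Re t > 0}" using t by simp
  qed simp
  hence "f t = g (1 / t) / csqrt t" by (simp add: F_def)
  moreover have "- of_real pi * (1 / t) * of_real (of_int n + 0)^2 = - of_real pi * of_int n ^ 2 / t" for n :: int
    by simp
  ultimately show ?thesis unfolding f_def g_def by (simp only: mult_1_right of_real_of_int_eq of_real_add of_real_power add_0_right of_real_0)
qed


section \<open>Quadratic Gauss sums\<close>

definition zeta_pow :: "nat \<Rightarrow> int \<Rightarrow> complex" where
  "zeta_pow d n = exp (2 * of_real pi * \<i> * of_int n / of_nat d)"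

definition gauss_sum :: "int \<Rightarrow> nat \<Rightarrow> complex" where
  "gauss_sum b d = (\<Sum>r\<in>{0..<int d}. zeta_pow d (b * r\<^sup>2))"

lemma zeta_pow_add: "zeta_pow d (m + n) = zeta_pow d m * zeta_pow d n"
  by (simp add: zeta_pow_def exp_add[symmetric] ring_distribs add_divide_distrib)

lemma zeta_pow_mult_cancel:
  assumes "m > 0" "d > 0"
  shows "zeta_pow (m * d) (int m * n) = zeta_pow d n"
  using assms by (simp add: zeta_pow_def field_simps)

lemma zeta_pow_0 [simp]: "zeta_pow d 0 = 1"
  by (simp add: zeta_pow_def)

lemma zeta_pow_dvd:
  assumes "d > 0" "int d dvd n"
  shows "zeta_pow d n = 1"
proof -
  obtain k where "n = int d * k" using assms(2) by (elim dvdE)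
  hence "zeta_pow d n = exp (2 * of_int k * of_real pi * \<i>)"
    using assms(1) by (simp add: zeta_pow_def field_simps)
  thus ?thesis by (simp add: exp_integer_2pi mult_ac)
qed

lemma zeta_pow_cong:
  assumes "d > 0" "[m = n] (mod int d)"
  shows "zeta_pow d m = zeta_pow d n"
proof -
  have "zeta_pow d (n + (m - n)) = zeta_pow d n"
    using assms by (subst zeta_pow_add) (simp add: zeta_pow_dvd cong_iff_dvd_diff)
  thus ?thesis by simp
qed

lemma zeta_pow_eq_1_iff:
  assumes "d > 0"
  shows "zeta_pow d n = 1 \<longleftrightarrow> int d dvd n"
proof
  assume "zeta_pow d n = 1"
  then obtain k :: int where "Im (2 * of_real pi * \<i> * of_int n / of_nat d) = of_int (2 * k) * pi"
    unfolding zeta_pow_def exp_eq_1 by blast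
  hence "real_of_int n = of_int (int d * k)" using assms by (simp add: field_simps)
  hence "n = int d * k" by (subst (asm) of_int_eq_iff)
  thus "int d dvd n" by simp
qed (use assms in \<open>simp add: zeta_pow_dvd\<close>)

lemma zeta_pow_power: "zeta_pow d m ^ k = zeta_pow d (m * int k)"
  by (simp add: zeta_pow_def exp_of_nat_mult[symmetric] mult_ac)

lemma sum_zeta_pow:
  assumes "d > 0"
  shows "(\<Sum>r\<in>{0..<int d}. zeta_pow d (m * r)) = (if int d dvd m then of_nat d else 0)"
proof -
  have "(\<Sum>r\<in>{0..<int d}. zeta_pow d (m * r)) = (\<Sum>r<d. zeta_pow d m ^ r)"
    by (rule sum.reindex_bij_witness[of _ int nat]) (auto simp: zeta_pow_power)
  also have "\<dots> = (if int d dvd m then of_nat d else 0)"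
  proof (cases "int d dvd m")
    case False
    have "zeta_pow d m ^ d = 1" unfolding zeta_pow_power using assms by (simp add: zeta_pow_dvd)
    thus ?thesis using False by (simp add: geometric_sum zeta_pow_eq_1_iff[OF assms])
  qed (use assms in \<open>simp add: zeta_pow_dvd\<close>)
  finally show ?thesis .
qed

section \<open>Sums over residue classes\<close>

definition periodic_mod :: "nat \<Rightarrow> (int \<Rightarrow> 'a) \<Rightarrow> bool" where
  "periodic_mod d f \<longleftrightarrow> (\<forall>m n. [m = n] (mod int d) \<longrightarrow> f m = f n)"

text \<open>A map that is injective modulo d on a set of d elements hits every residue once. The
  index set is arbitrary so that multiplication by a unit, shifts and the Chinese remainder
  parametrisation are all instances.\<close>

lemma sum_residues_reindex:
  fixes f :: "int \<Rightarrow> 'a :: comm_monoid_add"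
  assumes "periodic_mod d f" "d > 0" "finite A" "card A = d"
    and inj: "\<And>x y. x \<in> A \<Longrightarrow> y \<in> A \<Longrightarrow> [h x = h y] (mod int d) \<Longrightarrow> x = y"
  shows "(\<Sum>x\<in>A. f (h x)) = (\<Sum>r\<in>{0..<int d}. f r)"
proof -
  let ?h = "\<lambda>x. h x mod int d"
  have inj': "inj_on ?h A" using inj by (auto simp: inj_on_def cong_def)
  have sub: "?h ` A \<subseteq> {0..<int d}" using assms(2) by auto
  have "card (?h ` A) = card {0..<int d}" using card_image[OF inj'] assms(4) by simp
  hence "?h ` A = {0..<int d}" by (intro card_subset_eq sub) auto
  hence "bij_betw ?h A {0..<int d}" using inj' by (simp add: bij_betw_def)
  hence "(\<Sum>x\<in>A. f (?h x)) = (\<Sum>r\<in>{0..<int d}. f r)" by (rule sum.reindex_bij_betw)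
  moreover have "f (?h x) = f (h x)" for x
    using assms(1) unfolding periodic_mod_def cong_def by (metis mod_mod_trivial)
  ultimately show ?thesis by simp
qed

lemma cong_less_imp_eq_int':
  "x \<in> {0..<int d} \<Longrightarrow> y \<in> {0..<int d} \<Longrightarrow> [x = y] (mod int d) \<Longrightarrow> x = y"
  by (auto simp: cong_def)

lemma sum_residues_mult:
  fixes f :: "int \<Rightarrow> 'a :: comm_monoid_add"
  assumes "periodic_mod d f" "d > 0" "coprime u (int d)"
  shows "(\<Sum>r\<in>{0..<int d}. f (u * r)) = (\<Sum>r\<in>{0..<int d}. f r)"
proof (rule sum_residues_reindex[OF assms(1,2)])
  fix x y assume "x \<in> {0..<int d}" "y \<in> {0..<int d}" "[u * x = u * y] (mod int d)"
  thus "x = y" using assms(3) cong_mult_lcancel cong_less_imp_eq_int' by metis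
qed auto

lemma sum_residues_shift:
  fixes f :: "int \<Rightarrow> 'a :: comm_monoid_add"
  assumes "periodic_mod d f" "d > 0"
  shows "(\<Sum>r\<in>{0..<int d}. f (r + s)) = (\<Sum>r\<in>{0..<int d}. f r)"
  by (rule sum_residues_reindex[OF assms]) (auto simp: cong_add_rcancel intro: cong_less_imp_eq_int')

lemma sum_residues_coprime:
  fixes f :: "int \<Rightarrow> 'a :: comm_monoid_add"
  assumes "periodic_mod (m * n) f" "m > 0" "n > 0" "coprime m n"
  shows "(\<Sum>r\<in>{0..<int (m * n)}. f r) = (\<Sum>x\<in>{0..<int m}. \<Sum>y\<in>{0..<int n}. f (int n * x + int m * y))"
proof -
  have cop: "coprime (int n) (int m)" "coprime (int m) (int n)"
    using assms(4) by (simp_all add: ac_simps)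
  have "(\<Sum>z\<in>{0..<int m} \<times> {0..<int n}. f (int n * fst z + int m * snd z)) = (\<Sum>r\<in>{0..<int (m * n)}. f r)"
  proof (rule sum_residues_reindex[OF assms(1)])
    fix z w assume zw: "z \<in> {0..<int m} \<times> {0..<int n}" "w \<in> {0..<int m} \<times> {0..<int n}"
      and c: "[int n * fst z + int m * snd z = int n * fst w + int m * snd w] (mod int (m * n))"
    have "[int n * fst z + int m * snd z = int n * fst w + int m * snd w] (mod int m)"
      using c by (rule cong_dvd_modulus) simp
    hence "[int n * fst z = int n * fst w] (mod int m)" by (simp add: cong_def)
    hence 1: "fst z = fst w"
      using zw cop cong_mult_lcancel[of "int n" "int m"] by (auto intro: cong_less_imp_eq_int')
    have "[int n * fst z + int m * snd z = int n * fst w + int m * snd w] (mod int n)"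
      using c by (rule cong_dvd_modulus) simp
    hence "[int m * snd z = int m * snd w] (mod int n)" by (simp add: cong_def)
    hence 2: "snd z = snd w"
      using zw cop cong_mult_lcancel[of "int m" "int n"] by (auto intro: cong_less_imp_eq_int')
    from 1 2 show "z = w" by (rule prod_eqI)
  qed (use assms in auto)
  thus ?thesis by (simp add: sum.cartesian_product case_prod_unfold)
qed

lemma sum_residues_mult_modulus:
  fixes f :: "int \<Rightarrow> 'a :: comm_monoid_add"
  assumes "m > 0" "n > 0"
  shows "(\<Sum>r\<in>{0..<int (m * n)}. f r) = (\<Sum>x\<in>{0..<int m}. \<Sum>y\<in>{0..<int n}. f (x + int m * y))"
proof -
  have "(\<Sum>r\<in>{0..<int (m * n)}. f r) = (\<Sum>z\<in>{0..<int m} \<times> {0..<int n}. f (fst z + int m * snd z))"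
  proof (rule sum.reindex_bij_witness[of _ "\<lambda>z. fst z + int m * snd z" "\<lambda>r. (r mod int m, r div int m)"])
    fix z assume z: "z \<in> {0..<int m} \<times> {0..<int n}"
    have "snd z \<le> int n - 1" using z by auto
    hence "int m * snd z \<le> int m * (int n - 1)" using assms by (intro mult_left_mono) auto
    thus "fst z + int m * snd z \<in> {0..<int (m * n)}" using z by (auto simp: algebra_simps)
    show "((fst z + int m * snd z) mod int m, (fst z + int m * snd z) div int m) = z"
      using z assms by (intro prod_eqI) (auto simp: div_add1_eq)
  next
    fix r assume r: "r \<in> {0..<int (m * n)}"
    have "r div int m < int n"
    proof (rule ccontr)
      assume "\<not> r div int m < int n"
      hence "int m * int n \<le> int m * (r div int m)" using assms by (intro mult_left_mono) auto
      also have "\<dots> \<le> r" using assms by (simp add: minus_mod_eq_mult_div[symmetric])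
      finally show False using r by simp
    qed
    thus "(r mod int m, r div int m) \<in> {0..<int m} \<times> {0..<int n}"
      using r assms by (auto simp: pos_imp_zdiv_nonneg_iff)
  qed (use assms in auto)
  thus ?thesis by (simp add: sum.cartesian_product case_prod_unfold)
qed

lemma periodic_gauss: "d > 0 \<Longrightarrow> periodic_mod d (\<lambda>r. zeta_pow d (b * r\<^sup>2))"
  unfolding periodic_mod_def by (auto intro!: zeta_pow_cong cong_mult cong_pow)

lemma gauss_sum_cong:
  assumes "d > 0" "[b = c] (mod int d)"
  shows "gauss_sum b d = gauss_sum c d"
  unfolding gauss_sum_def using assms by (intro sum.cong zeta_pow_cong cong_mult) auto

text \<open>The substitution r -> v r permutes the residues.\<close>

lemma gauss_sum_square:
  assumes "d > 0" "coprime v (int d)"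
  shows "gauss_sum (v\<^sup>2 * b) d = gauss_sum b d"
  using sum_residues_mult[OF periodic_gauss[OF assms(1), of b] assms]
  by (simp add: gauss_sum_def power_mult_distrib mult_ac)

text \<open>Chinese remainder theorem with r = n x + m y: the cross term of the square is divisible
  by m n, and each of the two squares keeps a spare factor n or m, which twists the
  coefficient.\<close>

lemma gauss_sum_coprime:
  assumes "m > 0" "n > 0" "coprime m n"
  shows "gauss_sum b (m * n) = gauss_sum (b * int n) m * gauss_sum (b * int m) n"
proof -
  have "zeta_pow (m * n) (b * (int n * x + int m * y)\<^sup>2) =
          zeta_pow m (b * int n * x\<^sup>2) * zeta_pow n (b * int m * y\<^sup>2)" for x y
  proof -
    have "b * (int n * x + int m * y)\<^sup>2 = int n * (b * int n * x\<^sup>2) + int m * (b * int m * y\<^sup>2) + int (m * n) * (2 * b * x * y)"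
      by (simp add: power2_eq_square algebra_simps)
    moreover have "zeta_pow (m * n) (int n * (b * int n * x\<^sup>2)) = zeta_pow m (b * int n * x\<^sup>2)"
      using zeta_pow_mult_cancel[OF assms(2,1), of "b * int n * x\<^sup>2"] by (simp only: mult.commute[of n m])
    moreover have "zeta_pow (m * n) (int m * (b * int m * y\<^sup>2)) = zeta_pow n (b * int m * y\<^sup>2)"
      using zeta_pow_mult_cancel[OF assms(1,2)] by simp
    moreover have "zeta_pow (m * n) (int (m * n) * (2 * b * x * y)) = 1"
      by (rule zeta_pow_dvd) (use assms in auto)
    ultimately show ?thesis by (simp only: zeta_pow_add mult_1_right)
  qed
  thus ?thesis
    unfolding gauss_sum_def using assms
    by (subst sum_residues_coprime) (auto intro!: periodic_gauss simp: sum_product simp flip: of_nat_mult)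
qed

text \<open>With r = x + p e y the term in y^2 drops out modulo p^2 e, so the sum over y is
  geometric. It vanishes unless p divides 2 b x, that is unless p divides x, and the surviving x = p
  k reproduce the Gauss sum modulo e.\<close>

lemma gauss_sum_square_modulus:
  assumes p: "prime p" "odd p" and e: "e > 0" and b: "coprime b (int p)"
  shows "gauss_sum b (p\<^sup>2 * e) = of_nat p * gauss_sum b e"
proof -
  have p0: "p > 0" using p(1) prime_gt_0_nat by blast
  let ?d = "p\<^sup>2 * e"
  have d: "?d = (p * e) * p" by (simp add: power2_eq_square)
  have inner: "(\<Sum>y\<in>{0..<int p}. zeta_pow ?d (b * (x + int (p * e) * y)\<^sup>2)) =
     (if int p dvd x then of_nat p * zeta_pow ?d (b * x\<^sup>2) else 0)" for x
  proof -
    have "zeta_pow ?d (b * (x + int (p * e) * y)\<^sup>2) = zeta_pow ?d (b * x\<^sup>2) * zeta_pow p ((2 * b * x) * y)" for y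
    proof -
      have "b * (x + int (p * e) * y)\<^sup>2 = b * x\<^sup>2 + int (p * e) * ((2 * b * x) * y) + int ?d * (b * int e * y\<^sup>2)"
        by (simp add: power2_eq_square algebra_simps)
      moreover have "zeta_pow ?d (int (p * e) * ((2 * b * x) * y)) = zeta_pow p ((2 * b * x) * y)"
        unfolding d by (rule zeta_pow_mult_cancel) (use p0 e in auto)
      moreover have "zeta_pow ?d (int ?d * (b * int e * y\<^sup>2)) = 1"
        by (rule zeta_pow_dvd) (use p0 e in auto)
      ultimately show ?thesis by (simp only: zeta_pow_add mult_1_right)
    qed
    hence "(\<Sum>y\<in>{0..<int p}. zeta_pow ?d (b * (x + int (p * e) * y)\<^sup>2)) =
      zeta_pow ?d (b * x\<^sup>2) * (\<Sum>y\<in>{0..<int p}. zeta_pow p ((2 * b * x) * y))"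
      by (simp add: sum_distrib_left)
    moreover have "int p dvd 2 * b * x \<longleftrightarrow> int p dvd x"
    proof -
      have "coprime (int p) (2 * b)"
        using p b prime_odd_nat[of p] by (simp add: coprime_commute coprime_mult_left_iff coprime_mult_right_iff)
      thus ?thesis by (rule coprime_dvd_mult_right_iff)
    qed
    ultimately show ?thesis using sum_zeta_pow[OF p0, of "2 * b * x"] by simp
  qed
  have "gauss_sum b ?d = (\<Sum>x\<in>{0..<int (p * e)}. if int p dvd x then of_nat p * zeta_pow ?d (b * x\<^sup>2) else 0)"
    unfolding gauss_sum_def d using inner[unfolded d] p0 e
    by (subst sum_residues_mult_modulus) (auto simp del: of_nat_mult)
  also have "\<dots> = (\<Sum>x\<in>{x\<in>{0..<int (p * e)}. int p dvd x}. of_nat p * zeta_pow ?d (b * x\<^sup>2))"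
    by (rule sum.inter_filter[symmetric]) auto
  also have "\<dots> = (\<Sum>r\<in>{0..<int e}. of_nat p * zeta_pow e (b * r\<^sup>2))"
  proof (rule sum.reindex_bij_witness[of _ "\<lambda>r. int p * r" "\<lambda>x. x div int p"])
    fix x assume x: "x \<in> {x\<in>{0..<int (p * e)}. int p dvd x}"
    then obtain k where k: "x = int p * k" by auto
    have "0 \<le> k" "k < int e" using x p0 unfolding k by (auto simp: zero_le_mult_iff)
    thus "x div int p \<in> {0..<int e}" using p0 by (simp add: k)
    show "int p * (x div int p) = x" using p0 by (simp add: k)
    have "zeta_pow ?d (b * x\<^sup>2) = zeta_pow ?d (int (p\<^sup>2) * (b * k\<^sup>2))"
      by (simp add: k power_mult_distrib mult_ac)
    also have "\<dots> = zeta_pow e (b * k\<^sup>2)"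
      by (rule zeta_pow_mult_cancel) (use p0 e in auto)
    finally show "of_nat p * zeta_pow e (b * (x div int p)\<^sup>2) = of_nat p * zeta_pow ?d (b * x\<^sup>2)"
      using p0 by (simp add: k)
  qed (use p0 in \<open>auto\<close>)
  also have "\<dots> = of_nat p * gauss_sum b e" by (simp add: gauss_sum_def sum_distrib_left)
  finally show ?thesis .
qed


section \<open>Effect of a unit on Gauss sums\<close>

lemma sum_gauss_sum_prime:
  assumes "prime p"
  shows "(\<Sum>u\<in>{0..<int p}. gauss_sum u p) = of_nat p"
proof -
  have p: "p > 0" using assms prime_gt_0_nat by blast
  have "(\<Sum>u\<in>{0..<int p}. gauss_sum u p) = (\<Sum>r\<in>{0..<int p}. \<Sum>u\<in>{0..<int p}. zeta_pow p (r\<^sup>2 * u))"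
    unfolding gauss_sum_def by (subst sum.swap) (simp add: mult.commute)
  \<comment> \<open>A prime divides r^2 only if it divides r, so among the residues r = 0 alone
    contributes.\<close>
  also have "\<dots> = (\<Sum>r\<in>{0..<int p}. if r = 0 then of_nat p else 0)"
  proof (rule sum.cong)
    fix r assume r: "r \<in> {0..<int p}"
    have "int p dvd r\<^sup>2 \<longleftrightarrow> int p dvd r"
      using assms by (simp add: prime_dvd_power_iff)
    also have "\<dots> \<longleftrightarrow> r = 0" using r zdvd_not_zless[of r "int p"] by (cases "r = 0") auto
    finally show "(\<Sum>u\<in>{0..<int p}. zeta_pow p (r\<^sup>2 * u)) = (if r = 0 then of_nat p else 0)"
      by (simp add: sum_zeta_pow[OF p])
  qed simp
  also have "\<dots> = of_nat p" using p by simp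
  finally show ?thesis .
qed

text \<open>Euler's criterion makes the Legendre symbol of n u congruent to (-1) (-1) = 1, and p > 2
  separates 1 from 0 and -1.\<close>

lemma mult_QuadRes_or_QuadRes:
  fixes p :: nat and u n :: int
  assumes p: "prime p" "odd p" and "coprime u (int p)" "coprime n (int p)"
    and n: "\<not> QuadRes (int p) n" and u: "\<not> QuadRes (int p) u"
  shows "QuadRes (int p) (n * u)"
proof -
  have p2: "2 < p" using prime_ge_2_nat[OF p(1)] p(2) by (cases "p = 2") auto
  have "\<not> int p dvd n" "\<not> int p dvd u"
    using assms(3,4) p2 coprime_common_divisor[of n "int p" "int p"] coprime_common_divisor[of u "int p" "int p"] by auto
  hence L: "Legendre n (int p) = -1" "Legendre u (int p) = -1"
    using n u by (auto simp: Legendre_def cong_0_iff)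
  have "[Legendre (n * u) (int p) = (n * u) ^ ((p - 1) div 2)] (mod int p)"
    by (rule euler_criterion) (use p p2 in auto)
  moreover have "[Legendre n (int p) * Legendre u (int p) = n ^ ((p - 1) div 2) * u ^ ((p - 1) div 2)] (mod int p)"
    by (intro cong_mult euler_criterion) (use p p2 in auto)
  ultimately have "[Legendre (n * u) (int p) = 1] (mod int p)"
    unfolding L by (metis cong_sym cong_trans power_mult_distrib mult_minus1_right minus_minus)
  hence dv: "int p dvd Legendre (n * u) (int p) - 1" by (simp add: cong_iff_dvd_diff)
  show ?thesis
  proof (rule ccontr)
    assume "\<not> QuadRes (int p) (n * u)"
    hence "Legendre (n * u) (int p) - 1 \<in> {-1, -2}" by (simp add: Legendre_def)
    hence "int p dvd 1 \<or> int p dvd 2" using dv by (metis dvd_minus_iff insertE singletonD)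
    thus False using p2 zdvd_imp_le[of "int p" 1] zdvd_imp_le[of "int p" 2] by auto
  qed
qed

lemma gauss_sum_QuadRes:
  assumes "prime p" "QuadRes (int p) u" "coprime u (int p)"
  shows "gauss_sum (u * b) p = gauss_sum b p"
proof -
  obtain v where v: "[v\<^sup>2 = u] (mod int p)" using assms(2) by (auto simp: QuadRes_def)
  have p: "p > 0" using assms prime_gt_0_nat by blast
  have "coprime (v\<^sup>2) (int p)" using v assms(3) by (metis cong_imp_coprime cong_sym)
  hence cv: "coprime v (int p)" by simp
  have "gauss_sum (u * b) p = gauss_sum (v\<^sup>2 * b) p"
    by (rule gauss_sum_cong[OF p]) (intro cong_mult cong_sym[OF v] cong_refl)
  thus ?thesis using gauss_sum_square[OF p cv] by simp
qed

text \<open>A quadratic residue u is absorbed as a square. For a nonresidue u,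
  \<open>A b + A (u * b)\<close> has the same value for all units b; its total over the units is 0,
  so this value is 0.\<close>

lemma gauss_sum_prime_unit:
  assumes p: "prime p" "odd p" and u: "coprime u (int p)"
  shows "\<exists>s\<in>{1,-1}. \<forall>b. coprime b (int p) \<longrightarrow> gauss_sum (u * b) p = s * gauss_sum b p"
proof (cases "QuadRes (int p) u")
  case True
  thus ?thesis using gauss_sum_QuadRes p u by (intro bexI[of _ 1]) auto
next
  case False
  have p0: "p > 1" using p prime_gt_1_nat by blast
  define A where "A = (\<lambda>b. gauss_sum b p)"
  \<comment> \<open>A factor u^2 is inserted at no cost; then n u, a product of two nonresidues and
    hence a residue, is absorbed.\<close>
  have A_nonres: "A (n * b) = A (u * b)" if n: "coprime n (int p)" "\<not> QuadRes (int p) n" for n b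
  proof -
    have "A (n * b) = A (u\<^sup>2 * (n * b))"
      unfolding A_def using p0 u by (intro gauss_sum_square[symmetric]) auto
    also have "\<dots> = A ((n * u) * (u * b))" by (simp add: power2_eq_square mult_ac)
    also have "\<dots> = A (u * b)"
      unfolding A_def
      by (rule gauss_sum_QuadRes[OF p(1) mult_QuadRes_or_QuadRes[OF p u n(1) n(2) False]]) (use n u in auto)
    finally show ?thesis .
  qed
  have const: "A b + A (u * b) = A 1 + A u" if b: "coprime b (int p)" for b
  proof (cases "QuadRes (int p) b")
    case True
    thus ?thesis using gauss_sum_QuadRes[OF p(1) True b, of 1] gauss_sum_QuadRes[OF p(1) True b, of u]
      by (simp add: A_def mult_ac)
  next
    case nr: False
    have "A (b * 1) = A (u * 1)" "A (b * u) = A (u * u)" using A_nonres[OF b nr] by blast+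
    moreover have "A (u\<^sup>2 * 1) = A 1" unfolding A_def by (rule gauss_sum_square) (use p0 u in auto)
    ultimately show ?thesis by (simp add: power2_eq_square mult_ac)
  qed
  have cop: "coprime b (int p)" if "b \<in> {1..<int p}" for b
  proof -
    have "\<not> int p dvd b" using that zdvd_not_zless[of b "int p"] by auto
    thus ?thesis using p(1) by (metis coprime_commute prime_imp_coprime prime_nat_int_transfer)
  qed
  have split: "{0..<int p} = insert 0 {1..<int p}" using p0 by auto
  have "periodic_mod p A" unfolding A_def periodic_mod_def using p0 by (auto intro!: gauss_sum_cong)
  hence "(\<Sum>b\<in>{0..<int p}. A (u * b)) = (\<Sum>b\<in>{0..<int p}. A b)"
    using p0 u by (intro sum_residues_mult) auto
  \<comment> \<open>The full sum is 2 p, and the term b = 0 alone already equals 2 p, which leaves 0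
    for the units.\<close>
  hence "(\<Sum>b\<in>{0..<int p}. A b + A (u * b)) = 2 * of_nat p"
    using sum_gauss_sum_prime[OF p(1)] by (simp add: sum.distrib A_def)
  moreover have "A 0 = of_nat p" by (simp add: A_def gauss_sum_def)
  ultimately have "(\<Sum>b\<in>{1..<int p}. A b + A (u * b)) = 0" unfolding split by simp
  moreover have "(\<Sum>b\<in>{1..<int p}. A b + A (u * b)) = of_int (int p - 1) * (A 1 + A u)"
    using const cop p0 by (simp add: of_nat_diff)
  ultimately have z: "A 1 + A u = 0" using p0 by simp
  hence "A (u * b) = - A b" if "coprime b (int p)" for b
    using const[OF that] by (simp add: add_eq_0_iff)
  thus ?thesis by (intro bexI[of _ "-1"]) (auto simp: A_def)
qed

text \<open>Strong induction removes either p^2, which scales the sum by p and leaves the sign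
  alone, or a prime p coprime to the cofactor, where the signs multiply. The sign is in effect the
  Jacobi symbol of u over d.\<close>

lemma gauss_sum_unit:
  assumes "odd d" "coprime u (int d)"
  shows "\<exists>s\<in>{1,-1}. \<forall>b. coprime b (int d) \<longrightarrow> gauss_sum (u * b) d = s * gauss_sum b d"
  using assms
proof (induction d rule: less_induct)
  case (less d)
  show ?case
  proof (cases "d = 1")
    case True
    have "gauss_sum (u * b) d = gauss_sum b d" for b
      unfolding True by (rule gauss_sum_cong) (auto simp: cong_def)
    thus ?thesis by auto
  next
    case False
    then obtain p where p: "prime p" "p dvd d" using prime_factor_nat by blast
    then obtain m where d: "d = p * m" by auto
    have odds: "odd p" "odd m" using less.prems by (auto simp: d)
    have p1: "p > 1" using p prime_gt_1_nat by blast
    have m0: "m > 0" using odds by (cases m) auto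
    show ?thesis
    proof (cases "p dvd m")
      case True
      then obtain e where m: "m = p * e" by auto
      have e0: "e > 0" "odd e" using m0 odds by (auto simp: m)
      have d': "d = p\<^sup>2 * e" by (simp add: d m power2_eq_square)
      have "e < d" unfolding d' using e0 one_less_power[of p 2] p1 by simp
      moreover have "coprime u (int e)" using less.prems(2) by (simp add: d')
      ultimately obtain s where s: "s \<in> {1,-1}" "\<And>b. coprime b (int e) \<Longrightarrow> gauss_sum (u * b) e = s * gauss_sum b e"
        using less.IH[of e] e0 by blast
      have "gauss_sum (u * b) d = s * gauss_sum b d" if "coprime b (int d)" for b
      proof -
        have c: "coprime b (int p)" "coprime b (int e)" "coprime (u * b) (int p)"
          using that less.prems(2) by (auto simp: d')
        show ?thesis
          unfolding d' gauss_sum_square_modulus[OF p(1) odds(1) e0(1) c(1)]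
            gauss_sum_square_modulus[OF p(1) odds(1) e0(1) c(3)] s(2)[OF c(2)] by simp
      qed
      thus ?thesis using s(1) by blast
    next
      case False
      hence cpm: "coprime p m" using p(1) by (simp add: prime_imp_coprime_nat)
      have "coprime u (int p)" "coprime u (int m)" using less.prems(2) by (auto simp: d)
      moreover have "m < d" using p1 m0 by (simp add: d)
      ultimately obtain s s' where s: "s \<in> {1,-1}" "\<And>b. coprime b (int m) \<Longrightarrow> gauss_sum (u * b) m = s * gauss_sum b m"
        and s': "s' \<in> {1,-1}" "\<And>b. coprime b (int p) \<Longrightarrow> gauss_sum (u * b) p = s' * gauss_sum b p"
        using less.IH[of m] odds gauss_sum_prime_unit[OF p(1) odds(1)] by metis
      have "gauss_sum (u * b) d = (s' * s) * gauss_sum b d" if "coprime b (int d)" for b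
      proof -
        \<comment> \<open>The splitting twists b by the complementary factor; the twisted
          coefficients are still units, so both sign rules apply.\<close>
        have "coprime (int p) (int m)" "coprime (int m) (int p)" using cpm by (simp_all add: ac_simps)
        hence c: "coprime (b * int m) (int p)" "coprime (b * int p) (int m)"
          using that by (auto simp: d)
        show ?thesis
          using gauss_sum_coprime[of p m "u * b"] gauss_sum_coprime[of p m b] s(2)[OF c(2)] s'(2)[OF c(1)] p1 m0 cpm
          by (simp add: d mult_ac)
      qed
      moreover have "s' * s \<in> {1,-1}" using s(1) s'(1) by auto
      ultimately show ?thesis by blast
    qed
  qed
qed

text \<open>With an even number of factors the quadratic characters cancel.\<close>

lemma gauss_sum_power_eq:
  assumes "odd d" "even (m + n)" "coprime k (int d)"
    and "coprime b (int d)" "coprime b' (int d)"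
  shows "gauss_sum b d ^ m * gauss_sum (k * b) d ^ n = gauss_sum b' d ^ m * gauss_sum (k * b') d ^ n"
proof -
  have d: "d > 0" using assms(1) by (cases d) auto
  obtain c where c: "[b * c = 1] (mod int d)" using cong_solve_coprime_int[OF assms(4)] by auto
  \<comment> \<open>A representative of the quotient of b' by b modulo d.\<close>
  define u where "u = b' * c"
  have "coprime c (int d)" using c by (metis cong_imp_coprime cong_sym coprime_1_left coprime_mult_left_iff)
  hence u: "coprime u (int d)" using assms(5) by (simp add: u_def)
  have "[u * b = b'] (mod int d)"
    using cong_scalar_left[OF c, of b'] by (simp add: u_def mult_ac)
  hence "[b' = u * b] (mod int d)" "[k * b' = u * (k * b)] (mod int d)"
    using cong_scalar_left[of "u * b" b' "int d" k] by (auto intro: cong_sym simp: mult.left_commute)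
  hence eq: "gauss_sum b' d = gauss_sum (u * b) d" "gauss_sum (k * b') d = gauss_sum (u * (k * b)) d"
    using d by (auto intro: gauss_sum_cong)
  obtain s where s: "s \<in> {1,-1}" "\<And>b. coprime b (int d) \<Longrightarrow> gauss_sum (u * b) d = s * gauss_sum b d"
    using gauss_sum_unit[OF assms(1) u] by blast
  have "s ^ (m + n) = 1" using s(1) assms(2) by auto
  moreover have "gauss_sum (u * b) d = s * gauss_sum b d" "gauss_sum (u * (k * b)) d = s * gauss_sum (k * b) d"
    using assms by (auto intro: s(2))
  ultimately show ?thesis unfolding eq
    by (simp add: power_mult_distrib power_add)
qed


section \<open>Transformation of the theta function\<close>

definition theta :: "complex \<Rightarrow> complex" where
  "theta z = (\<Sum>\<^sub>\<infinity>n::int. exp (2 * of_real pi * \<i> * of_int n ^ 2 * z))"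

lemma norm_theta_term:
  "norm (exp (2 * of_real pi * \<i> * of_int n ^ 2 * z)) = exp (- (2 * pi * Im z) * real_of_int n ^ 2)"
  by (simp add: norm_exp_eq_Re flip: of_int_power)

lemma theta_abs_summable:
  assumes "Im z > 0"
  shows "(\<lambda>n::int. norm (exp (2 * of_real pi * \<i> * of_int n ^ 2 * z))) summable_on UNIV"
  unfolding norm_theta_term using gaussian_summable(1)[of "2 * pi * Im z" 0] assms by simp

text \<open>The geometric majorant sums to at most 2 / (1 - exp (-x)) with x = 2 pi Im z, and 1 -
  exp (-x) >= x / (1 + x) turns this into a bound polynomial in 1 / Im z on the whole
  half-plane.\<close>

lemma norm_theta_le:
  assumes z: "Im z > 0"
  shows "norm (theta z) \<le> 2 * (1 + 1 / Im z)"
proof -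
  define x where "x = 2 * pi * Im z"
  have x: "x > 0" "x \<ge> Im z"
    using z pi_gt3 by (auto simp: x_def)
  have "norm (theta z) \<le> (\<Sum>\<^sub>\<infinity>n::int. norm (exp (2 * of_real pi * \<i> * of_int n ^ 2 * z)))"
    unfolding theta_def by (rule norm_infsum_bound[OF theta_abs_summable[OF z]])
  also have "\<dots> \<le> (\<Sum>\<^sub>\<infinity>n::int. exp (- x) ^ nat \<bar>n\<bar>)"
  proof (rule infsum_mono)
    show "(\<lambda>n::int. exp (- x) ^ nat \<bar>n\<bar>) summable_on UNIV"
      by (rule summable_on_power_abs_int) (use x in auto)
    show "norm (exp (2 * of_real pi * \<i> * of_int n ^ 2 * z)) \<le> exp (- x) ^ nat \<bar>n\<bar>" for n :: int
      unfolding norm_theta_term x_def[symmetric] by (rule gaussian_le_power) (use x in simp)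
  qed (rule theta_abs_summable[OF z])
  also have "\<dots> \<le> 2 / (1 - exp (- x))"
    by (rule summable_on_power_abs_int) (use x in auto)
  also have "\<dots> \<le> 2 / (x / (1 + x))"
  proof (rule divide_left_mono)
    have "1 + x \<le> exp x" by (rule exp_ge_add_one_self)
    hence "exp (- x) \<le> 1 / (1 + x)" using x by (simp add: exp_minus field_simps)
    also have "1 / (1 + x) = 1 - x / (1 + x)" using x by (simp add: field_simps)
    finally show "x / (1 + x) \<le> 1 - exp (- x)" by simp
    show "0 < (1 - exp (- x)) * (x / (1 + x))" using x by simp
  qed simp
  also have "\<dots> = 2 * (1 + 1 / x)" using x by (simp add: field_simps)
  also have "\<dots> \<le> 2 * (1 + 1 / Im z)"
    using x z divide_left_mono[of "Im z" x 1] by simp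
  finally show ?thesis .
qed

text \<open>The map t = -2 i z carries the upper half-plane to the right half-plane, where the
  Gaussian series is holomorphic.\<close>

lemma theta_holomorphic: "theta holomorphic_on {z. Im z > 0}"
proof -
  define g :: "complex \<Rightarrow> complex" where
    "g = (\<lambda>t. \<Sum>\<^sub>\<infinity>n::int. exp (- of_real pi * t * of_real (of_int n + 0)^2) * 1)"
  have "g holomorphic_on {t. Re t > 0}"
    unfolding g_def by (rule holomorphic_gaussian_series) simp
  hence "g \<circ> (\<lambda>z. -2 * \<i> * z) holomorphic_on {z. Im z > 0}"
    by (rule holomorphic_on_compose_gen[rotated]) (auto intro!: holomorphic_intros)
  also have "g \<circ> (\<lambda>z. -2 * \<i> * z) = theta"
    by (auto simp: g_def theta_def fun_eq_iff mult_ac)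
  finally show ?thesis .
qed

text \<open>All terms are positive reals there, and n = 0 alone contributes 1. This provides a theta
  product with a value that can be cancelled.\<close>

lemma theta_nonzero_imaginary_axis:
  assumes "y > 0"
  shows "theta (\<i> * of_real y) \<noteq> 0"
proof -
  define h where "h = (\<lambda>n::int. exp (- (2 * pi * y) * (real_of_int n + 0) ^ 2))"
  have "exp (2 * of_real pi * \<i> * of_int n ^ 2 * (\<i> * of_real y)) = complex_of_real (h n)" for n
  proof -
    have e: "2 * of_real pi * \<i> * of_int n ^ 2 * (\<i> * of_real y) = complex_of_real (- (2 * pi * y) * (of_int n + 0) ^ 2)"
      by (simp add: mult_ac)
    show ?thesis unfolding e exp_of_real h_def ..
  qed
  hence eq: "theta (\<i> * of_real y) = of_real (\<Sum>\<^sub>\<infinity>n. h n)"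
    unfolding theta_def by (simp only: infsum_of_real_complex)
  have "h summable_on UNIV"
    unfolding h_def by (rule gaussian_summable) (use assms in simp)
  hence "sum h {0} \<le> (\<Sum>\<^sub>\<infinity>n. h n)"
    by (rule finite_sum_le_infsum) (auto simp: h_def)
  moreover have "sum h {0} = 1" by (simp add: h_def)
  ultimately show ?thesis unfolding eq of_real_eq_0_iff by linarith
qed

lemma theta_inversion:
  assumes z: "Im z > 0"
  shows "theta z = (\<Sum>\<^sub>\<infinity>m::int. exp (- of_real pi * of_int m ^ 2 / (-2 * \<i> * z))) / csqrt (-2 * \<i> * z)"
proof -
  have "theta z = (\<Sum>\<^sub>\<infinity>n::int. exp (- of_real pi * (-2 * \<i> * z) * of_real (of_int n + 0)^2))"
    unfolding theta_def by (simp add: mult_ac)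
  also have "\<dots> = (\<Sum>\<^sub>\<infinity>m::int. exp (- of_real pi * of_int m ^ 2 / (-2 * \<i> * z)) * of_real (cos (2 * pi * of_int m * 0))) / csqrt (-2 * \<i> * z)"
    by (rule poisson_gaussian) (use z in auto)
  finally show ?thesis by simp
qed

lemma infsum_int_residues:
  fixes f :: "int \<Rightarrow> complex"
  assumes "f summable_on UNIV" "d > 0"
  shows "(\<Sum>\<^sub>\<infinity>n. f n) = (\<Sum>r\<in>{0..<int d}. \<Sum>\<^sub>\<infinity>m. f (r + int d * m))"
    and "\<And>r. (\<lambda>m. f (r + int d * m)) summable_on UNIV"
proof -
  let ?h = "\<lambda>(r, m). r + int d * m"
  have bij: "bij_betw ?h ({0..<int d} \<times> UNIV) UNIV"
    by (rule bij_betw_byWitness[of _ "\<lambda>n. (n mod int d, n div int d)"]) (use assms(2) in auto)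
  have eq: "(\<lambda>z. f (?h z)) = (\<lambda>(r, m). f (r + int d * m))" by auto
  have "(\<lambda>z. f (?h z)) summable_on ({0..<int d} \<times> UNIV)"
    using assms(1) by (subst summable_on_reindex_bij_betw[OF bij])
  hence s: "(\<lambda>(r, m). f (r + int d * m)) summable_on ({0..<int d} \<times> UNIV)" unfolding eq .
  have "(\<Sum>\<^sub>\<infinity>n. f n) = (\<Sum>\<^sub>\<infinity>z\<in>{0..<int d} \<times> UNIV. f (?h z))"
    by (rule infsum_reindex_bij_betw[OF bij, symmetric])
  also have "\<dots> = (\<Sum>\<^sub>\<infinity>r\<in>{0..<int d}. \<Sum>\<^sub>\<infinity>m. f (r + int d * m))"
    unfolding eq by (rule infsum_Sigma'_banach[OF s, symmetric])
  finally show "(\<Sum>\<^sub>\<infinity>n. f n) = (\<Sum>r\<in>{0..<int d}. \<Sum>\<^sub>\<infinity>m. f (r + int d * m))" by simp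
  show "(\<lambda>m. f (r + int d * m)) summable_on UNIV" for r
  proof -
    have "inj (\<lambda>m. r + int d * m)" using assms(2) by (auto simp: inj_on_def)
    from summable_on_reindex[OF this, of f] show ?thesis
      using summable_on_subset_banach[OF assms(1)] by (auto simp: o_def)
  qed
qed

text \<open>By hypothesis -4 c inverts b modulo d, so b r^2 + m r is congruent to c m^2 + b (r - 2 c
  m)^2, and the shift of r disappears in the sum. The cosine may stand for e(m r / d) because r ->
  -r only exchanges the two exponentials of which it is the mean.\<close>

lemma gauss_sum_linear:
  assumes d: "d > 0" and "a * int d - b * (4 * c) = 1"
  shows "(\<Sum>r\<in>{0..<int d}. zeta_pow d (b * r\<^sup>2) * of_real (cos (2 * pi * of_int m * (of_int r / of_nat d)))) =
           zeta_pow d (c * m\<^sup>2) * gauss_sum b d"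
proof -
  let ?f = "\<lambda>r. zeta_pow d (b * r\<^sup>2 + m * r)"
  have per: "periodic_mod d ?f"
    unfolding periodic_mod_def using d by (auto intro!: zeta_pow_cong cong_add cong_mult cong_pow)
  have neg: "(\<Sum>r\<in>{0..<int d}. ?f (-1 * r)) = (\<Sum>r\<in>{0..<int d}. ?f r)"
    by (rule sum_residues_mult[OF per d]) simp
  have cos: "of_real (cos (2 * pi * of_int m * (of_int r / of_nat d))) = (zeta_pow d (m * r) + zeta_pow d (m * (-1 * r))) / 2" for r
  proof -
    define x where "x = complex_of_real (2 * pi * of_int m * (of_int r / of_nat d))"
    have "zeta_pow d (m * r) = exp (\<i> * x)" "zeta_pow d (m * (-1 * r)) = exp (- (\<i> * x))"
      by (simp_all add: zeta_pow_def x_def mult_ac)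
    thus ?thesis unfolding cos_of_real[symmetric] x_def[symmetric] cos_exp_eq by (simp only: mult_minus_left)
  qed
  have "(\<Sum>r\<in>{0..<int d}. zeta_pow d (b * r\<^sup>2) * of_real (cos (2 * pi * of_int m * (of_int r / of_nat d)))) =
     (\<Sum>r\<in>{0..<int d}. (?f r + ?f (-1 * r)) / 2)"
    unfolding cos zeta_pow_add by (intro sum.cong) (simp_all add: algebra_simps)
  also have "\<dots> = (\<Sum>r\<in>{0..<int d}. ?f r)"
    using neg by (simp add: sum.distrib flip: sum_divide_distrib)
  also have "\<dots> = (\<Sum>r\<in>{0..<int d}. zeta_pow d (c * m\<^sup>2) * zeta_pow d (b * (r + (- 2 * c * m))\<^sup>2))"
  proof (rule sum.cong)
    fix r
    have "b * r\<^sup>2 + m * r - (c * m\<^sup>2 + b * (r + (- 2 * c * m))\<^sup>2) = (m * r - c * m\<^sup>2) * (1 + b * (4 * c))"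
      by (simp add: power2_eq_square algebra_simps)
    also have "1 + b * (4 * c) = a * int d" using assms(2) by simp
    finally have "[b * r\<^sup>2 + m * r = c * m\<^sup>2 + b * (r + (- 2 * c * m))\<^sup>2] (mod int d)"
      by (simp add: cong_iff_dvd_diff)
    thus "?f r = zeta_pow d (c * m\<^sup>2) * zeta_pow d (b * (r + (- 2 * c * m))\<^sup>2)"
      unfolding zeta_pow_add[symmetric] by (rule zeta_pow_cong[OF d])
  qed simp
  also have "\<dots> = zeta_pow d (c * m\<^sup>2) * gauss_sum b d"
    unfolding gauss_sum_def sum_distrib_left[symmetric]
    using sum_residues_shift[OF periodic_gauss[OF d, of b] d, of "- 2 * c * m"] by simp
  finally show ?thesis .
qed

lemma has_sum_sum:
  fixes f :: "'i \<Rightarrow> 'j \<Rightarrow> 'a :: topological_comm_monoid_add"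
  assumes "\<And>i. i \<in> A \<Longrightarrow> (f i has_sum S i) B"
  shows "((\<lambda>x. \<Sum>i\<in>A. f i x) has_sum (\<Sum>i\<in>A. S i)) B"
  using assms by (induction A rule: infinite_finite_induct) (auto intro: has_sum_add)

text \<open>The automorphy factor stays a quotient of two principal square roots, one from each use
  of Poisson summation; simplifying it would raise a question of branches that its later even powers
  avoid.\<close>

theorem theta_transformation:
  fixes a b c :: int and d :: nat
  assumes det: "a * int d - b * (4 * c) = 1" and d: "d > 0" and z: "Im z > 0"
  shows "theta ((of_int a * z + of_int b) / (of_int (4 * c) * z + of_nat d)) =
           gauss_sum b d * (csqrt (-2 * \<i> * z) / csqrt (-2 * \<i> * z * of_nat d / (of_int (4 * c) * z + of_nat d))) * theta z"
proof -
  define j where "j = of_int (4 * c) * z + of_nat d"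
  define w where "w = z / (of_nat d * j)"
  \<comment> \<open>Writing n = r + d m as d (m + r / d) multiplies the Gaussian parameter -2 i w by
    d^2, which gives \<open>T\<close>.\<close>
  define T where "T = -2 * \<i> * z * of_nat d / j"
  have j: "j \<noteq> 0"
  proof
    assume "j = 0"
    hence "Im j = 0" "Re j = 0" by simp_all
    thus False using z d by (cases "c = 0") (auto simp: j_def)
  qed
  have z0: "z \<noteq> 0" using z by auto
  have gz: "(of_int a * z + of_int b) / j = of_int b / of_nat d + w"
  proof -
    have "(of_int a * of_nat d - of_int b * of_int (4 * c) :: complex) = of_int (a * int d - b * (4 * c))" by simp
    hence "of_int a * of_nat d = (1 :: complex) + of_int b * of_int (4 * c)" unfolding det by (simp add: algebra_simps)
    hence "(of_int a * z + of_int b) * of_nat d = of_int b * j + z"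
      by (simp add: j_def algebra_simps)
    moreover have "of_int b / of_nat d + w = (of_int b * j + z) / (of_nat d * j)"
      using j d by (simp add: w_def add_divide_distrib)
    moreover have "(of_int a * z + of_int b) / j = ((of_int a * z + of_int b) * of_nat d) / (of_nat d * j)"
      using d by (simp add: mult.commute)
    ultimately show ?thesis by (simp only:)
  qed
  \<comment> \<open>In z times the conjugate of d j, the part of j proportional to z contributes a
    real number, so only d^2 Im z remains.\<close>
  have Imw: "Im w > 0"
  proof -
    have "Im (z * cnj (of_nat d * j)) = (real d)\<^sup>2 * Im z"
      by (simp add: j_def power2_eq_square algebra_simps)
    thus ?thesis using d z unfolding w_def Im_complex_div_gt_0 by simp
  qed
  have T: "T = (-2 * \<i> * w) * of_nat d ^ 2"
    unfolding T_def w_def power2_eq_square using d j by (simp add: divide_simps)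
  have ReT: "Re T > 0"
  proof -
    have "T = complex_of_real ((real d)\<^sup>2) * (-2 * \<i> * w)" unfolding T by simp
    hence "Re T = (real d)\<^sup>2 * (2 * Im w)"
      by (simp only: Re_complex_of_real Im_complex_of_real times_complex.simps) simp
    thus ?thesis using Imw d by simp
  qed
  have inner: "(\<Sum>\<^sub>\<infinity>m. exp (2 * of_real pi * \<i> * of_int (r + int d * m) ^ 2 * w)) =
      (\<Sum>\<^sub>\<infinity>m::int. exp (- of_real pi * of_int m ^ 2 / T) * of_real (cos (2 * pi * of_int m * (of_int r / of_nat d)))) / csqrt T"
    if r: "r \<in> {0..<int d}" for r
  proof -
    have "2 * of_real pi * \<i> * of_int (r + int d * m) ^ 2 * w = - of_real pi * T * of_real (of_int m + of_int r / of_nat d)^2" for m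
    proof -
      have "of_int (r + int d * m) = of_nat d * complex_of_real (of_int m + of_int r / of_nat d)"
        using d by (simp add: field_simps)
      hence "of_int (r + int d * m) ^ 2 = of_nat d ^ 2 * complex_of_real (of_int m + of_int r / of_nat d) ^ 2"
        by (simp only: power_mult_distrib)
      thus ?thesis unfolding T by (simp only: mult_ac mult_minus_left mult_minus_right minus_minus)
    qed
    moreover have "of_int r / real d \<in> {0..1}" using r d by (auto simp: field_simps)
    ultimately show ?thesis by (simp only: poisson_gaussian[OF ReT])
  qed
  have summ: "(\<lambda>m::int. exp (- of_real pi * of_int m ^ 2 / T) * of_real (cos (2 * pi * of_int m * (of_int r / of_nat d)))) summable_on UNIV" for r
  proof (rule abs_summable_summable, rule Infinite_Sum.abs_summable_on_comparison_test')
    have "Re (1 / T) > 0" using ReT by (auto simp: Re_divide intro!: divide_pos_pos add_pos_nonneg)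
    thus "(\<lambda>m::int. exp (- (pi * Re (1 / T)) * (of_int m + 0) ^ 2)) summable_on UNIV"
      by (intro gaussian_summable) auto
    fix m :: int
    have "Re (- of_real pi * of_int m ^ 2 / T) = - (pi * Re (1 / T)) * (of_int m + 0) ^ 2"
    proof -
      have "- of_real pi * of_int m ^ 2 / T = of_real (- pi * of_int m ^ 2) * (1 / T)" by simp
      thus ?thesis by (simp only: Re_complex_of_real Im_complex_of_real times_complex.simps) simp
    qed
    hence "norm (exp (- of_real pi * of_int m ^ 2 / T)) = exp (- (pi * Re (1 / T)) * (of_int m + 0) ^ 2)"
      by (simp only: norm_exp_eq_Re)
    thus "norm (exp (- of_real pi * of_int m ^ 2 / T) * of_real (cos (2 * pi * of_int m * (of_int r / of_nat d)))) \<le> exp (- (pi * Re (1 / T)) * (of_int m + 0) ^ 2)"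
      by (simp only: norm_mult norm_of_real) (intro mult_left_le, auto)
  qed
  have split: "exp (2 * of_real pi * \<i> * of_int n ^ 2 * (of_int b / of_nat d + w)) =
      zeta_pow d (b * n\<^sup>2) * exp (2 * of_real pi * \<i> * of_int n ^ 2 * w)" for n
    by (simp add: zeta_pow_def exp_add[symmetric] algebra_simps)
  have "Im (of_int b / of_nat d + w) > 0" using Imw by simp
  from abs_summable_summable[OF theta_abs_summable[OF this]]
  have s: "(\<lambda>n. zeta_pow d (b * n\<^sup>2) * exp (2 * of_real pi * \<i> * of_int n ^ 2 * w)) summable_on UNIV"
    unfolding split .
  have "theta ((of_int a * z + of_int b) / j) = (\<Sum>\<^sub>\<infinity>n. zeta_pow d (b * n\<^sup>2) * exp (2 * of_real pi * \<i> * of_int n ^ 2 * w))"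
    unfolding theta_def gz split ..
  also have "\<dots> = (\<Sum>r\<in>{0..<int d}. \<Sum>\<^sub>\<infinity>m. zeta_pow d (b * (r + int d * m)\<^sup>2) * exp (2 * of_real pi * \<i> * of_int (r + int d * m) ^ 2 * w))"
    by (rule infsum_int_residues(1)[OF s d])
  also have "\<dots> = (\<Sum>r\<in>{0..<int d}. zeta_pow d (b * r\<^sup>2) * (\<Sum>\<^sub>\<infinity>m. exp (2 * of_real pi * \<i> * of_int (r + int d * m) ^ 2 * w)))"
  proof (rule sum.cong)
    fix r
    have "zeta_pow d (b * (r + int d * m)\<^sup>2) = zeta_pow d (b * r\<^sup>2)" for m
      by (intro zeta_pow_cong[OF d] cong_mult cong_pow) (auto simp: cong_def)
    thus "(\<Sum>\<^sub>\<infinity>m. zeta_pow d (b * (r + int d * m)\<^sup>2) * exp (2 * of_real pi * \<i> * of_int (r + int d * m) ^ 2 * w)) =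
       zeta_pow d (b * r\<^sup>2) * (\<Sum>\<^sub>\<infinity>m. exp (2 * of_real pi * \<i> * of_int (r + int d * m) ^ 2 * w))"
      by (simp only: infsum_cmult_right')
  qed simp
  also have "\<dots> = (\<Sum>r\<in>{0..<int d}. \<Sum>\<^sub>\<infinity>m::int. zeta_pow d (b * r\<^sup>2) * (exp (- of_real pi * of_int m ^ 2 / T) * of_real (cos (2 * pi * of_int m * (of_int r / of_nat d))))) / csqrt T"
    unfolding sum_divide_distrib by (intro sum.cong) (simp_all only: inner infsum_cmult_right' times_divide_eq_right)
  also have "(\<Sum>r\<in>{0..<int d}. \<Sum>\<^sub>\<infinity>m::int. zeta_pow d (b * r\<^sup>2) * (exp (- of_real pi * of_int m ^ 2 / T) * of_real (cos (2 * pi * of_int m * (of_int r / of_nat d))))) =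
     (\<Sum>\<^sub>\<infinity>m::int. \<Sum>r\<in>{0..<int d}. zeta_pow d (b * r\<^sup>2) * (exp (- of_real pi * of_int m ^ 2 / T) * of_real (cos (2 * pi * of_int m * (of_int r / of_nat d)))))"
    by (rule infsumI[symmetric]) (intro has_sum_sum has_sum_infsum summable_on_cmult_right summ)
  also have "(\<lambda>m::int. \<Sum>r\<in>{0..<int d}. zeta_pow d (b * r\<^sup>2) * (exp (- of_real pi * of_int m ^ 2 / T) * of_real (cos (2 * pi * of_int m * (of_int r / of_nat d))))) =
      (\<lambda>m. gauss_sum b d * exp (- of_real pi * of_int m ^ 2 / (-2 * \<i> * z)))"
  proof
    fix m :: int
    have "(\<Sum>r\<in>{0..<int d}. zeta_pow d (b * r\<^sup>2) * (exp (- of_real pi * of_int m ^ 2 / T) * of_real (cos (2 * pi * of_int m * (of_int r / of_nat d))))) =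
      exp (- of_real pi * of_int m ^ 2 / T) * (\<Sum>r\<in>{0..<int d}. zeta_pow d (b * r\<^sup>2) * of_real (cos (2 * pi * of_int m * (of_int r / of_nat d))))"
      unfolding sum_distrib_left by (intro sum.cong) (simp_all only: mult_ac)
    also have "\<dots> = gauss_sum b d * (exp (- of_real pi * of_int m ^ 2 / T) * zeta_pow d (c * m\<^sup>2))"
      unfolding gauss_sum_linear[OF d det] by (simp only: mult_ac)
    also have "exp (- of_real pi * of_int m ^ 2 / T) * zeta_pow d (c * m\<^sup>2) = exp (- of_real pi * of_int m ^ 2 / (-2 * \<i> * z))"
    proof -
      define q where "q = -2 * \<i> * z"
      have q: "q \<noteq> 0" "z = \<i> / 2 * q" using z0 by (simp_all add: q_def)
      \<comment> \<open>1 / T exceeds 1 / q by 2 i c / d, and this excess is what the factor e(c m^2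
        / d) from completing the square cancels.\<close>
      have "1 / T = j / (q * of_nat d)" by (simp add: T_def q_def)
      also have "\<dots> = (of_int (4 * c) * (\<i> / 2 * q) + of_nat d) / (q * of_nat d)"
        unfolding j_def q(2)[symmetric] ..
      also have "\<dots> = \<i> * (2 * of_int c / of_nat d) + 1 / q"
        using d q(1) by (simp add: add_divide_distrib)
      finally have "- of_real pi * of_int m ^ 2 * (1 / T) = - of_real pi * of_int m ^ 2 * (\<i> * (2 * of_int c / of_nat d) + 1 / q)"
        by (simp only:)
      hence "- of_real pi * of_int m ^ 2 / T + 2 * of_real pi * \<i> * of_int (c * m\<^sup>2) / of_nat d = - of_real pi * of_int m ^ 2 / (-2 * \<i> * z)"
        unfolding q_def[symmetric] by (simp add: ring_distribs)
      thus ?thesis unfolding zeta_pow_def exp_add[symmetric] by (simp only:)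
    qed
    finally show "(\<Sum>r\<in>{0..<int d}. zeta_pow d (b * r\<^sup>2) * (exp (- of_real pi * of_int m ^ 2 / T) * of_real (cos (2 * pi * of_int m * (of_int r / of_nat d))))) =
      gauss_sum b d * exp (- of_real pi * of_int m ^ 2 / (-2 * \<i> * z))" .
  qed
  also have "(\<Sum>\<^sub>\<infinity>m. gauss_sum b d * exp (- of_real pi * of_int m ^ 2 / (-2 * \<i> * z))) = gauss_sum b d * (csqrt (-2 * \<i> * z) * theta z)"
    unfolding infsum_cmult_right' theta_inversion[OF z] using z0 by simp
  finally show ?thesis unfolding T_def j_def by (simp add: mult_ac)
qed


section \<open>Products of theta functions as modular forms\<close>

text \<open>The principal root is singled out by its half-plane, which positive scaling preserves.
  This is what makes \<open>theta_factor\<close> the same for all scalings s.\<close>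

lemma csqrt_of_real_pos_mult:
  assumes "s > 0"
  shows "csqrt (of_real s * w) = of_real (sqrt s) * csqrt w"
proof (rule csqrt_unique)
  show "(of_real (sqrt s) * csqrt w)\<^sup>2 = of_real s * w"
    using assms by (simp add: power_mult_distrib flip: of_real_power)
  show "0 < Re (of_real (sqrt s) * csqrt w) \<or> Re (of_real (sqrt s) * csqrt w) = 0 \<and> 0 \<le> Im (of_real (sqrt s) * csqrt w)"
    using csqrt_principal[of w] assms by (auto simp: zero_less_mult_iff)
qed

text \<open>A square root of \<open>(c z + d) / d\<close>; it does not change under \<open>(z, c) \<mapsto> (s z, c / s)\<close>.\<close>

definition theta_factor :: "int \<Rightarrow> nat \<Rightarrow> complex \<Rightarrow> complex" where
  "theta_factor c d z = csqrt (-2 * \<i> * z) / csqrt (-2 * \<i> * z * of_nat d / (of_int c * z + of_nat d))"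

lemma denominator_nonzero:
  assumes "Im z > 0" "c \<noteq> 0 \<or> d \<noteq> 0"
  shows "of_int c * z + of_int d \<noteq> 0"
proof
  assume "of_int c * z + of_int d = 0"
  hence "Im (of_int c * z + of_int d) = 0" "Re (of_int c * z + of_int d) = 0" by simp_all
  thus False using assms by auto
qed

lemma theta_factor_square:
  assumes "Im z > 0" "d > 0"
  shows "theta_factor c d z ^ 2 = (of_int c * z + of_nat d) / of_nat d"
  using assms denominator_nonzero[of z c "int d"] by (auto simp: theta_factor_def power_divide)

text \<open>The unscaled formula is applied at s z to the conjugated matrix (a, s b; c / s, d),
  whose lower left entry is divisible by 4 because 4 s divides c.\<close>

lemma theta_scaled_transformation:
  fixes a b c :: int and d s :: nat
  assumes det: "a * int d - b * c = 1" and s: "s > 0" "4 * int s dvd c" and d: "d > 0" and z: "Im z > 0"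
  shows "theta (of_nat s * ((of_int a * z + of_int b) / (of_int c * z + of_nat d))) =
           gauss_sum (int s * b) d * theta_factor c d z * theta (of_nat s * z)"
proof -
  obtain c' where c: "c = 4 * int s * c'" using s(2) by auto
  have "theta ((of_int a * (of_nat s * z) + of_int (int s * b)) / (of_int (4 * c') * (of_nat s * z) + of_nat d)) =
     gauss_sum (int s * b) d * (csqrt (-2 * \<i> * (of_nat s * z)) / csqrt (-2 * \<i> * (of_nat s * z) * of_nat d / (of_int (4 * c') * (of_nat s * z) + of_nat d))) * theta (of_nat s * z)"
    by (rule theta_transformation) (use det d z s in \<open>auto simp: c mult_ac\<close>)
  moreover have "of_int (4 * c') * (of_nat s * z) + of_nat d = of_int c * z + of_nat d"
    by (simp add: c)
  moreover have "of_int a * (of_nat s * z) + of_int (int s * b) = of_nat s * (of_int a * z + of_int b)"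
    by (simp add: algebra_simps)
  moreover have "csqrt (-2 * \<i> * (of_nat s * z)) / csqrt (-2 * \<i> * (of_nat s * z) * of_nat d / (of_int c * z + of_nat d)) = theta_factor c d z"
  proof -
    have "-2 * \<i> * (of_nat s * z) = of_real (real s) * (-2 * \<i> * z)"
      "-2 * \<i> * (of_nat s * z) * of_nat d / (of_int c * z + of_nat d) = of_real (real s) * (-2 * \<i> * z * of_nat d / (of_int c * z + of_nat d))"
      by simp_all
    moreover have "real s > 0" using s by simp
    ultimately show ?thesis unfolding theta_factor_def by (simp only: csqrt_of_real_pos_mult) simp
  qed
  ultimately show ?thesis by (simp only: times_divide_eq_right)
qed

text \<open>A bound in 1 / Im z alone, uniform in Re z, can be pulled back along any Moebius
  transformation and so serves all cusps at once.\<close>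

definition poly_growth :: "(complex \<Rightarrow> complex) \<Rightarrow> bool" where
  "poly_growth f \<longleftrightarrow> (\<exists>C A. \<forall>z. Im z > 0 \<longrightarrow> norm (f z) \<le> C * (1 + 1 / Im z) ^ A)"

text \<open>
  Functions that transform like a product of \<open>p\<close> functions \<open>theta (s z)\<close> with \<open>s \<in> {1, 4, 16}\<close>
  and \<open>q\<close> functions \<open>theta (s z)\<close> with \<open>s \<in> {3, 12, 48}\<close>.
\<close>

definition theta_type :: "nat \<Rightarrow> nat \<Rightarrow> (complex \<Rightarrow> complex) set" where
  "theta_type p q = {f. f holomorphic_on upper_half_plane \<and> poly_growth f \<and>
     (\<forall>a b c d z. (a, b, c, int d) \<in> Gamma0 192 \<longrightarrow> d > 0 \<longrightarrow> Im z > 0 \<longrightarrow>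
        f ((of_int a * z + of_int b) / (of_int c * z + of_nat d)) =
          gauss_sum b d ^ p * gauss_sum (3 * b) d ^ q * theta_factor c d z ^ (p + q) * f z)}"

lemma poly_growthD:
  assumes "poly_growth f"
  shows "\<exists>C A. C \<ge> 0 \<and> (\<forall>z. Im z > 0 \<longrightarrow> norm (f z) \<le> C * (1 + 1 / Im z) ^ A)"
proof -
  obtain C A where CA: "\<And>z. Im z > 0 \<Longrightarrow> norm (f z) \<le> C * (1 + 1 / Im z) ^ A"
    using assms by (auto simp: poly_growth_def)
  \<comment> \<open>The bound at a single point already shows that C is not negative.\<close>
  have "0 \<le> C * (1 + 1 / Im \<i>) ^ A" using CA[of \<i>] norm_ge_zero[of "f \<i>"] by (simp del: norm_ge_zero)
  moreover have "(1 + 1 / Im \<i>) ^ A > 0" by simp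
  ultimately have "C \<ge> 0" by (metis not_le zero_le_mult_iff)
  thus ?thesis using CA by blast
qed

lemma poly_growth_mult:
  assumes "poly_growth f" "poly_growth g"
  shows "poly_growth (\<lambda>z. f z * g z)"
proof -
  obtain C A where 1: "C \<ge> 0" "\<And>z. Im z > 0 \<Longrightarrow> norm (f z) \<le> C * (1 + 1 / Im z) ^ A"
    using poly_growthD[OF assms(1)] by blast
  obtain C' A' where 2: "C' \<ge> 0" "\<And>z. Im z > 0 \<Longrightarrow> norm (g z) \<le> C' * (1 + 1 / Im z) ^ A'"
    using poly_growthD[OF assms(2)] by blast
  have "norm (f z * g z) \<le> (C * C') * (1 + 1 / Im z) ^ (A + A')" if "Im z > 0" for z
  proof -
    have "norm (f z) * norm (g z) \<le> (C * (1 + 1 / Im z) ^ A) * (C' * (1 + 1 / Im z) ^ A')"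
      by (intro mult_mono 1 2 that mult_nonneg_nonneg zero_le_power) (use that in auto)
    thus ?thesis by (simp add: norm_mult power_add mult_ac)
  qed
  thus ?thesis unfolding poly_growth_def by blast
qed

lemma poly_growth_add:
  assumes "poly_growth f" "poly_growth g"
  shows "poly_growth (\<lambda>z. f z + g z)"
proof -
  obtain C A where 1: "C \<ge> 0" "\<And>z. Im z > 0 \<Longrightarrow> norm (f z) \<le> C * (1 + 1 / Im z) ^ A"
    using poly_growthD[OF assms(1)] by blast
  obtain C' A' where 2: "C' \<ge> 0" "\<And>z. Im z > 0 \<Longrightarrow> norm (g z) \<le> C' * (1 + 1 / Im z) ^ A'"
    using poly_growthD[OF assms(2)] by blast
  have "norm (f z + g z) \<le> (C + C') * (1 + 1 / Im z) ^ (A + A')" if z: "Im z > 0" for z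
  proof -
    have "norm (f z) \<le> C * (1 + 1 / Im z) ^ (A + A')"
      using 1(2)[OF z] by (rule order.trans) (use 1(1) z in \<open>intro mult_left_mono power_increasing; simp\<close>)
    moreover have "norm (g z) \<le> C' * (1 + 1 / Im z) ^ (A + A')"
      using 2(2)[OF z] by (rule order.trans) (use 2(1) z in \<open>intro mult_left_mono power_increasing; simp\<close>)
    ultimately show ?thesis using norm_triangle_ineq[of "f z" "g z"] by (simp add: distrib_right)
  qed
  thus ?thesis unfolding poly_growth_def by blast
qed

lemma poly_growth_const: "poly_growth (\<lambda>_. c)"
  unfolding poly_growth_def by (rule exI[of _ "norm c"], rule exI[of _ 0]) simp

lemma theta_type_mult:
  assumes "f \<in> theta_type p q" "g \<in> theta_type p' q'"
  shows "(\<lambda>z. f z * g z) \<in> theta_type (p + p') (q + q')"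
  using assms unfolding theta_type_def
  by (auto intro!: holomorphic_on_mult poly_growth_mult simp: power_add mult_ac)

lemma theta_type_add:
  assumes "f \<in> theta_type p q" "g \<in> theta_type p q"
  shows "(\<lambda>z. f z + g z) \<in> theta_type p q"
  using assms unfolding theta_type_def
  by (auto intro!: holomorphic_on_add poly_growth_add simp: distrib_left)

lemma theta_type_const: "(\<lambda>_. c) \<in> theta_type 0 0"
  by (auto simp: theta_type_def poly_growth_const)

lemma theta_type_zero: "(\<lambda>_. 0) \<in> theta_type p q"
  by (auto simp: theta_type_def poly_growth_const)

lemma theta_type_diff:
  assumes "f \<in> theta_type p q" "g \<in> theta_type p q"
  shows "(\<lambda>z. f z - g z) \<in> theta_type p q"
proof -
  have "(\<lambda>z. -1 * g z) \<in> theta_type p q"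
    using theta_type_mult[OF theta_type_const[of "-1"] assms(2)] by simp
  from theta_type_add[OF assms(1) this] show ?thesis by simp
qed

lemma theta_type_sum:
  assumes "\<And>i. i \<in> I \<Longrightarrow> f i \<in> theta_type p q"
  shows "(\<lambda>z. \<Sum>i\<in>I. f i z) \<in> theta_type p q"
  using assms by (induction I rule: infinite_finite_induct) (auto intro: theta_type_zero theta_type_add)

lemma poly_growth_theta_scaled:
  assumes "s > 0"
  shows "poly_growth (\<lambda>z. theta (of_nat s * z))"
proof -
  have "norm (theta (of_nat s * z)) \<le> 2 * (1 + 1 / Im z) ^ 1" if z: "Im z > 0" for z
  proof -
    have "Im z \<le> real s * Im z" using z assms by simp
    hence "1 / (real s * Im z) \<le> 1 / Im z" using z by (intro divide_left_mono) auto
    thus ?thesis using norm_theta_le[of "of_nat s * z"] z assms by simp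
  qed
  thus ?thesis unfolding poly_growth_def by blast
qed

lemma theta_scaled_holomorphic:
  assumes "s > 0"
  shows "(\<lambda>z. theta (of_nat s * z)) holomorphic_on upper_half_plane"
proof -
  have "theta \<circ> (\<lambda>z. of_nat s * z) holomorphic_on upper_half_plane"
    by (rule holomorphic_on_compose_gen[OF _ theta_holomorphic])
       (use assms in \<open>auto simp: upper_half_plane_def intro!: holomorphic_intros\<close>)
  thus ?thesis by (simp add: o_def)
qed

lemma Gamma0_coprime:
  assumes "(a, b, c, d) \<in> Gamma0 M"
  shows "coprime d (int M)" "coprime b d"
proof -
  have det: "a * d - b * c = 1" and "int M dvd c" using assms by (auto simp: Gamma0_def SL2Z_def)
  show "coprime d (int M)"
  proof (rule coprimeI)
    fix x assume "x dvd d" "x dvd int M"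
    hence "x dvd a * d - b * c" using \<open>int M dvd c\<close> by (meson dvd_diff dvd_mult dvd_trans)
    thus "is_unit x" using det by simp
  qed
  show "coprime b d"
  proof (rule coprimeI)
    fix x assume "x dvd b" "x dvd d"
    hence "x dvd a * d - b * c" by (meson dvd_diff dvd_mult dvd_mult2)
    thus "is_unit x" using det by simp
  qed
qed

text \<open>The scaling k v^2 puts k v^2 b into the Gauss sum. Since v divides 192 it is a unit
  modulo d, so the square drops out and all scalings with the same k share one multiplier.\<close>

lemma theta_scaled_type:
  fixes v k :: nat
  assumes v: "v \<in> {1, 2, 4}"
  shows "(\<lambda>z. theta (of_nat (v\<^sup>2) * z)) \<in> theta_type 1 0"
    and "(\<lambda>z. theta (of_nat (3 * v\<^sup>2) * z)) \<in> theta_type 0 1"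
proof -
  have trans: "theta (of_nat (k * v\<^sup>2) * ((of_int a * z + of_int b) / (of_int c * z + of_nat d))) =
      gauss_sum (int k * b) d * theta_factor c d z * theta (of_nat (k * v\<^sup>2) * z)"
    if k: "k \<in> {1, 3}" and G: "(a, b, c, int d) \<in> Gamma0 192" and d: "d > 0" and z: "Im z > 0" for k a b c d z
  proof -
    have det: "a * int d - b * c = 1" and c: "192 dvd c" using G by (auto simp: Gamma0_def SL2Z_def)
    have "4 * int (k * v\<^sup>2) dvd 192" using v k by auto
    hence dv: "4 * int (k * v\<^sup>2) dvd c" using c dvd_trans by blast
    have "coprime (int d) 192" using Gamma0_coprime(1)[OF G] by simp
    moreover have "int v dvd 192" using v by auto
    ultimately have "coprime (int v) (int d)" by (metis coprime_commute coprime_divisors dvd_refl)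
    from gauss_sum_square[OF d this, of "int k * b"]
    have "gauss_sum (int (k * v\<^sup>2) * b) d = gauss_sum (int k * b) d" by (simp add: mult_ac)
    thus ?thesis using theta_scaled_transformation[OF det _ dv d z] k v by auto
  qed
  have v0: "v\<^sup>2 > 0" "3 * v\<^sup>2 > 0" using v by auto
  show "(\<lambda>z. theta (of_nat (v\<^sup>2) * z)) \<in> theta_type 1 0"
    unfolding theta_type_def mem_Collect_eq
    using poly_growth_theta_scaled[OF v0(1)] theta_scaled_holomorphic[OF v0(1)] trans[of 1] by auto
  show "(\<lambda>z. theta (of_nat (3 * v\<^sup>2) * z)) \<in> theta_type 0 1"
    unfolding theta_type_def mem_Collect_eq
    using poly_growth_theta_scaled[OF v0(2)] theta_scaled_holomorphic[OF v0(2)] trans[of 3] by auto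
qed

text \<open>Periodicity makes f a function g of q on the punctured disc, whatever branch of the
  logarithm is used. On the strip f grows at most polynomially in Im z, hence in log |q|, so q g(q)
  tends to 0 and the singularity at q = 0 is removable.\<close>

lemma holomorphic_at_infinityI:
  fixes f :: "complex \<Rightarrow> complex" and h :: nat
  assumes h: "h > 0" and hol: "f holomorphic_on upper_half_plane"
    and per: "\<And>z. Im z > 0 \<Longrightarrow> f (z + of_nat h) = f z"
    and K: "K \<ge> 0" and bd: "\<And>z. Im z \<ge> 1 \<Longrightarrow> \<bar>Re z\<bar> \<le> h \<Longrightarrow> norm (f z) \<le> C * (1 + K * Im z) ^ A"
  shows "holomorphic_at_infinity f"
proof -
  define l where "l = (\<lambda>q. of_nat h * Ln q / (2 * of_real pi * \<i>))"
  define e where "e = (\<lambda>z. exp (2 * of_real pi * \<i> * z / of_nat h))"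
  define g where "g = (\<lambda>q. f (l q))"
  have h': "real h > 0" using h by simp
  have Im_l: "Im (l q) = - h * ln (norm q) / (2 * pi)" "Re (l q) = h * Arg q / (2 * pi)" if "q \<noteq> 0" for q
    using that by (simp_all add: l_def Im_divide Re_divide power2_eq_square Arg_def field_simps)
  have norm_e: "norm (e z) = exp (- (2 * pi * Im z / h))" for z
  proof -
    have "2 * of_real pi * \<i> * z / of_nat h = of_real (2 * pi / h) * (\<i> * z)" by simp
    thus ?thesis unfolding e_def norm_exp_eq_Re by (simp only: Re_complex_of_real Im_complex_of_real times_complex.simps) simp
  qed
  have per_int: "f (z + of_int n * of_nat h) = f z" if z: "Im z > 0" for z n
  proof -
    have nat: "f (z + of_nat n * of_nat h) = f z" if "Im z > 0" for z n
    proof (induction n)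
      case (Suc n)
      have "f (z + of_nat (Suc n) * of_nat h) = f ((z + of_nat n * of_nat h) + of_nat h)"
        by (simp add: algebra_simps)
      also have "\<dots> = f (z + of_nat n * of_nat h)" by (rule per) (use that in simp)
      finally show ?case using Suc by simp
    qed simp
    show ?thesis
    proof (cases "n \<ge> 0")
      case True
      thus ?thesis using nat[OF z, of "nat n"] by simp
    next
      case False
      thus ?thesis using nat[of "z + of_int n * of_nat h" "nat (-n)"] z by (simp add: algebra_simps)
    qed
  qed
  have e_eq: "f z = f w" if "e z = e w" "Im z > 0" for z w
  proof -
    from that(1) obtain n :: int where "2 * of_real pi * \<i> * z / of_nat h = 2 * of_real pi * \<i> * w / of_nat h + of_int (2 * n) * of_real pi * \<i>"
      unfolding e_def exp_eq by (auto simp: mult_ac)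
    hence "2 * of_real pi * \<i> * z / of_nat h = 2 * of_real pi * \<i> * ((w + of_int n * of_nat h) / of_nat h)"
      using h by (simp add: field_simps)
    hence "z = w + of_int n * of_nat h" using h by simp
    moreover from this have "Im w > 0" using that(2) by simp
    ultimately show ?thesis using per_int by simp
  qed
  have e_l: "e (l q) = q" if "q \<noteq> 0" for q
    using that h by (simp add: e_def l_def)
  have l_UHP: "Im (l q) > 0" if "q \<noteq> 0" "norm q < 1" for q
    using that h' by (simp add: Im_l divide_neg_pos mult_pos_neg)
  have ev: "g holomorphic_on ball 0 1 - {0}"
  proof -
    have "\<exists>r>0. g holomorphic_on ball q r" if q: "q \<in> ball 0 1 - {0}" for q
    proof -
      have q0: "q \<noteq> 0" "norm q < 1" using q by auto
      \<comment> \<open>The branch \<open>l\<close> jumps across the negative axis. The branch based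
        at q is holomorphic nearby and differs from \<open>l\<close> by a multiple of h, which f
        does not see.\<close>
      define m where "m = (\<lambda>w. l q + of_nat h * Ln (w / q) / (2 * of_real pi * \<i>))"
      \<comment> \<open>The disc stays inside the unit disc, and w / q stays within distance 1 of 1,
        away from the cut.\<close>
      define r where "r = min (norm q) (1 - norm q)"
      have r: "r > 0" using q0 by (simp add: r_def)
      have w: "w \<noteq> 0 \<and> norm w < 1 \<and> w / q \<notin> \<real>\<^sub>\<le>\<^sub>0" if "w \<in> ball q r" for w
      proof -
        have d: "norm (w - q) < norm q" "norm (w - q) < 1 - norm q" using that by (auto simp: r_def dist_norm norm_minus_commute)
        have "norm w < 1" using norm_triangle_ineq[of "w - q" q] d by simp
        moreover have "w \<noteq> 0" using d by auto
        moreover have "norm (w / q - 1) < 1"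
        proof -
          have "w / q - 1 = (w - q) / q" using q0 by (simp add: diff_divide_distrib)
          thus ?thesis using d q0 by (simp add: norm_divide)
        qed
        hence "\<bar>Re (w / q) - 1\<bar> < 1" using abs_Re_le_cmod[of "w / q - 1"] by simp
        hence "Re (w / q) > 0" by linarith
        ultimately show ?thesis by (auto simp: complex_nonpos_Reals_iff)
      qed
      have em: "e (m v) = v" if "v \<in> ball q r" for v
      proof -
        have "e (m v) = e (l q) * exp (Ln (v / q))"
          using h by (simp add: e_def m_def ring_distribs add_divide_distrib exp_add)
        thus ?thesis using w[OF that] q0 e_l[OF q0(1)] by simp
      qed
      have Imm: "Im (m v) > 0" if "v \<in> ball q r" for v
      proof -
        have "exp (- (2 * pi * Im (m v) / h)) < 1" using norm_e[of "m v"] em[OF that] w[OF that] by simp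
        thus ?thesis using h' by (simp add: zero_less_divide_iff zero_less_mult_iff)
      qed
      have "f \<circ> m holomorphic_on ball q r"
      proof (rule holomorphic_on_compose_gen[OF _ hol])
        show "m holomorphic_on ball q r" unfolding m_def
          using w q0 by (intro holomorphic_intros) auto
        show "m ` ball q r \<subseteq> upper_half_plane" using Imm by (auto simp: upper_half_plane_def)
      qed
      hence "g holomorphic_on ball q r"
      proof (rule holomorphic_transform)
        fix v assume v: "v \<in> ball q r"
        have "e (m v) = e (l v)" using em[OF v] e_l w[OF v] by simp
        from e_eq[OF this Imm[OF v]] show "(f \<circ> m) v = g v" by (simp add: g_def)
      qed
      thus ?thesis using r by blast
    qed
    thus ?thesis
      by (meson analytic_on_def analytic_imp_holomorphic)
  qed
  have lim: "((\<lambda>q. (q - 0) * g q) \<longlongrightarrow> 0) (at 0)"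
  proof (rule Lim_null_comparison)
    define y where "y = (\<lambda>q::complex. - h * ln (norm q) / (2 * pi))"
    have n0: "filterlim (\<lambda>q::complex. norm q) (at_right 0) (at 0)"
      by (rule filterlim_at_withinI) (auto simp: eventually_at_filter intro!: tendsto_norm_zero tendsto_ident_at)
    have "filterlim (\<lambda>x::real. - h * ln x / (2 * pi)) at_top (at_right 0)"
      using h' by real_asymp
    hence ytop: "filterlim y at_top (at 0)"
      unfolding y_def by (rule filterlim_compose[OF _ n0])
    have "((\<lambda>t::real. exp (- (2 * pi * t / h)) * (C * (1 + K * t) ^ A)) \<longlongrightarrow> 0) at_top"
    proof -
      have s: "((\<lambda>t::real. exp (- (2 * pi * t / h)) * (C * (1 + c * t) ^ A)) \<longlongrightarrow> 0) at_top" if "c > 0" for c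
        using h' that by real_asymp
      show ?thesis
      proof (cases "K = 0")
        case True
        have "((\<lambda>t::real. exp (- (2 * pi * t / h)) * C) \<longlongrightarrow> 0) at_top"
          using h' by real_asymp
        thus ?thesis by (simp add: True)
      qed (use s K in auto)
    qed
    thus "((\<lambda>q. exp (- (2 * pi * y q / h)) * (C * (1 + K * y q) ^ A)) \<longlongrightarrow> 0) (at 0)"
      by (rule filterlim_compose[OF _ ytop])
    have "\<forall>\<^sub>F q in at 0. 1 \<le> y q" using ytop by (simp add: filterlim_at_top)
    moreover have "\<forall>\<^sub>F q::complex in at 0. q \<noteq> 0" by (simp add: eventually_at_filter)
    ultimately show "\<forall>\<^sub>F q in at 0. norm ((q - 0) * g q) \<le> exp (- (2 * pi * y q / h)) * (C * (1 + K * y q) ^ A)"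
    proof eventually_elim
      case (elim q)
      have 1: "Im (l q) = y q" using elim by (simp add: Im_l y_def)
      \<comment> \<open>The range of the principal argument keeps \<open>l q\<close> in the strip
        where the growth bound is available.\<close>
      have "\<bar>Arg q\<bar> \<le> pi" using mpi_less_Arg[of q] Arg_le_pi[of q] by linarith
      also have "pi \<le> 2 * pi" using pi_gt_zero by simp
      finally have "real h * \<bar>Arg q\<bar> / (2 * pi) \<le> real h * (2 * pi) / (2 * pi)"
        by (intro divide_right_mono mult_left_mono) auto
      hence "\<bar>Re (l q)\<bar> \<le> h" using elim by (simp add: Im_l abs_mult)
      hence 2: "norm (g q) \<le> C * (1 + K * y q) ^ A"
        using bd[of "l q"] elim 1 by (simp add: g_def)
      have 3: "norm q = exp (- (2 * pi * y q / h))" using norm_e[of "l q"] e_l[of q] elim 1 by simp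
      show ?case unfolding norm_mult diff_zero 3[symmetric] by (rule mult_left_mono[OF 2]) simp
    qed
  qed
  have "0 \<in> interior (ball 0 1 :: complex set)" by simp
  from holomorphic_on_extend_lim[OF ev this] lim
  obtain G where G: "G holomorphic_on ball 0 1" "\<And>q. q \<in> ball 0 1 - {0} \<Longrightarrow> G q = g q" by auto
  have "f z = G (e z)" if z: "Im z > 0" for z
  proof -
    have n: "norm (e z) < 1" unfolding norm_e using z h' by simp
    have ez: "e z \<noteq> 0" by (simp add: e_def)
    have "e z = e (l (e z))" using e_l[OF ez] by simp
    from e_eq[OF this z] have "f z = g (e z)" by (simp add: g_def)
    also have "\<dots> = G (e z)" by (rule G(2)[symmetric]) (use n ez in auto)
    finally show ?thesis .
  qed
  thus ?thesis unfolding holomorphic_at_infinity_def using h G(1)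
    by (auto simp: e_def upper_half_plane_def intro!: exI[of _ h] exI[of _ G])
qed

section \<open>The slash action and the multiplier\<close>

lemma slash_apply:
  "slash k f (a, b, c, d) z = f ((of_int a * z + of_int b) / (of_int c * z + of_int d)) / (of_int c * z + of_int d) ^ k"
  by (simp add: slash_def)

lemma Im_moebius:
  assumes det: "a * d - b * c = 1" and z: "Im z > 0"
  shows "Im ((of_int a * z + of_int b) / (of_int c * z + of_int d)) = Im z / norm (of_int c * z + of_int d) ^ 2"
proof -
  have "Im ((of_int a * z + of_int b) * cnj (of_int c * z + of_int d)) = of_int (a * d - b * c) * Im z"
    by (simp add: algebra_simps)
  thus ?thesis unfolding det by (simp add: Im_divide cmod_power2 algebra_simps)
qed

lemma SL2Z_row_nonzero: "a * d - b * c = (1::int) \<Longrightarrow> c \<noteq> 0 \<or> d \<noteq> 0"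
  by auto

lemma Im_moebius_pos:
  assumes "a * d - b * c = 1" "Im z > 0"
  shows "Im ((of_int a * z + of_int b) / (of_int c * z + of_int d)) > 0"
  unfolding Im_moebius[OF assms] using assms denominator_nonzero[OF assms(2) SL2Z_row_nonzero[OF assms(1)]] by simp

lemma slash_slash:
  assumes det: "a' * d' - b' * c' = 1" and z: "Im z > 0"
  shows "slash k (slash k f (a, b, c, d)) (a', b', c', d') z =
           slash k f (a * a' + b * c', a * b' + b * d', c * a' + d * c', c * b' + d * d') z"
proof -
  define j where "j = of_int c' * z + of_int d'"
  define w where "w = of_int a' * z + of_int b'"
  have j: "j \<noteq> 0" unfolding j_def by (rule denominator_nonzero[OF z SL2Z_row_nonzero[OF det]])
  have lin: "of_int (x * a' + y * c') * z + of_int (x * b' + y * d') = of_int x * w + of_int y * j" for x y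
    by (simp add: w_def j_def algebra_simps)
  have div: "of_int x * (w / j) + of_int y = (of_int x * w + of_int y * j) / j" for x y
    using j by (simp add: add_divide_distrib)
  show ?thesis
    unfolding slash_apply lin w_def[symmetric] j_def[symmetric] div
    using j by (simp add: power_divide)
qed

text \<open>For even p + q the product of Gauss sums does not depend on the unit b, so b = 1 is
  taken; the power of d comes from the square of the theta factor. For d < 0 the matrix is negated,
  which costs (-1)^k in weight k = (p + q) / 2.\<close>

definition theta_mult :: "nat \<Rightarrow> nat \<Rightarrow> int \<Rightarrow> complex" where
  "theta_mult p q d = (if d > 0 then 1 else (-1) ^ ((p + q) div 2)) *
     (gauss_sum 1 (nat \<bar>d\<bar>) ^ p * gauss_sum 3 (nat \<bar>d\<bar>) ^ q / of_int \<bar>d\<bar> ^ ((p + q) div 2))"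

lemma Gamma0_192_facts:
  assumes "(a, b, c, d) \<in> Gamma0 192"
  shows "a * d - b * c = 1" "192 dvd c" "d \<noteq> 0" "odd d" "coprime 3 d" "coprime b d"
proof -
  show "a * d - b * c = 1" "192 dvd c" using assms by (auto simp: Gamma0_def SL2Z_def)
  have cop: "coprime d 192" using Gamma0_coprime(1)[OF assms] by simp
  thus "d \<noteq> 0" by auto
  have "coprime d 2" "coprime d 3"
    using coprime_divisors[of d d 2 192] coprime_divisors[of d d 3 192] cop by auto
  thus "odd d" "coprime 3 d" by (simp_all add: coprime_commute)
  show "coprime b d" by (rule Gamma0_coprime(2)[OF assms])
qed

lemma slash_theta_type:
  assumes f: "f \<in> theta_type p q" and ev: "even (p + q)"
    and G: "(a, b, c, d) \<in> Gamma0 192" and z: "Im z > 0"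
  shows "slash ((p + q) div 2) f (a, b, c, d) z = theta_mult p q d * f z"
proof -
  let ?k = "(p + q) div 2"
  have pos: "slash ?k f (a, b, c, d) z = theta_mult p q d * f z"
    if G: "(a, b, c, d) \<in> Gamma0 192" and d: "d > 0" for a b c d
  proof -
    define n where "n = nat d"
    have n: "d = int n" "n > 0" using d by (simp_all add: n_def)
    note facts = Gamma0_192_facts[OF G]
    have j: "of_int c * z + of_nat n \<noteq> 0"
      using denominator_nonzero[OF z SL2Z_row_nonzero[OF facts(1)]] by (simp add: n)
    have "f ((of_int a * z + of_int b) / (of_int c * z + of_nat n)) =
          gauss_sum b n ^ p * gauss_sum (3 * b) n ^ q * theta_factor c n z ^ (p + q) * f z"
      using f G n z by (auto simp: theta_type_def)
    also have "gauss_sum b n ^ p * gauss_sum (3 * b) n ^ q = gauss_sum 1 n ^ p * gauss_sum (3 * 1) n ^ q"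
      by (rule gauss_sum_power_eq) (use facts ev in \<open>auto simp: n\<close>)
    \<comment> \<open>Evenness of p + q enters here: the power of a root becomes a power of its
      known square.\<close>
    also have "theta_factor c n z ^ (p + q) = (theta_factor c n z ^ 2) ^ ?k"
      using ev by (simp flip: power_mult)
    also have "\<dots> = (of_int c * z + of_nat n) ^ ?k / of_nat n ^ ?k"
      using theta_factor_square[OF z n(2)] by (simp add: power_divide)
    finally show ?thesis
      using j n by (simp add: slash_apply theta_mult_def)
  qed
  show ?thesis
  proof (cases "d > 0")
    case False
    have d: "d < 0" using False Gamma0_192_facts(3)[OF G] by simp
    have "(-a, -b, -c, -d) \<in> Gamma0 192" using G by (auto simp: Gamma0_def SL2Z_def)
    from pos[OF this] d have "slash ?k f (-a, -b, -c, -d) z = theta_mult p q (-d) * f z" by simp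
    moreover have "theta_mult p q d = (-1) ^ ?k * theta_mult p q (-d)"
      using d by (simp add: theta_mult_def)
    moreover have "slash ?k f (a, b, c, d) z = (-1) ^ ?k * slash ?k f (-a, -b, -c, -d) z"
    proof -
      define u v where "u = of_int a * z + of_int b" and "v = of_int c * z + of_int d"
      have uv: "of_int (-a) * z + of_int (-b) = - u" "of_int (-c) * z + of_int (-d) = - v"
        by (simp_all add: u_def v_def)
      have "(- v) ^ ?k = (-1) ^ ?k * v ^ ?k" by (simp flip: power_mult_distrib)
      moreover have "(-1) ^ ?k * (-1 :: complex) ^ ?k = 1" by (simp flip: power_mult_distrib)
      ultimately show ?thesis unfolding slash_apply uv u_def[symmetric] v_def[symmetric]
        by (simp add: field_simps)
    qed
    ultimately show ?thesis by simp
  qed (use pos G in blast)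
qed

text \<open>A nonzero value of one function turns identities between transformed functions into
  identities between multipliers.\<close>

lemma theta_type_witness:
  obtains F z where "F \<in> theta_type p q" "Im z > 0" "F z \<noteq> 0"
proof -
  have power: "(\<lambda>z. f z ^ n) \<in> theta_type (n * p) (n * q)" if "f \<in> theta_type p q" for f n p q
    using that by (induction n) (auto intro!: theta_type_const theta_type_mult)
  define F where "F = (\<lambda>z. theta (of_nat (1\<^sup>2) * z) ^ p * theta (of_nat (3 * 1\<^sup>2) * z) ^ q)"
  have 1: "(\<lambda>z. theta (of_nat (1\<^sup>2) * z)) \<in> theta_type 1 0" "(\<lambda>z. theta (of_nat (3 * 1\<^sup>2) * z)) \<in> theta_type 0 1"
    by (rule theta_scaled_type; simp)+
  have "F \<in> theta_type p q"
    using theta_type_mult[OF power[OF 1(1), of p] power[OF 1(2), of q]] by (simp add: F_def)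
  moreover have "F \<i> \<noteq> 0"
    using theta_nonzero_imaginary_axis[of 1] theta_nonzero_imaginary_axis[of 3] by (simp add: F_def mult.commute)
  ultimately show ?thesis using that[of F \<i>] by simp
qed

lemma Gamma0_with_entry:
  assumes "coprime d (int M)"
  obtains a b where "(a, b, int M, d) \<in> Gamma0 M"
proof -
  obtain x y where "d * x + int M * y = 1"
    using bezout_int[of d "int M"] assms by (auto simp: mult.commute)
  hence "(x, -y, int M, d) \<in> Gamma0 M" by (simp add: Gamma0_def SL2Z_def mult_ac)
  thus ?thesis by (rule that)
qed

lemma theta_mult_1: "theta_mult p q 1 = 1"
proof -
  have "{0..<1::int} = {0}" by auto
  thus ?thesis by (simp add: theta_mult_def gauss_sum_def)
qed

text \<open>The argument on the left is the lower right entry of the matrix product. Acting by the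
  product, or by one factor after the other, gives the same function, and a nonzero value is
  cancelled.\<close>

lemma theta_mult_mult:
  assumes ev: "even (p + q)" and G: "(a, b, c, m) \<in> Gamma0 192" "(a', b', c', n) \<in> Gamma0 192"
  shows "theta_mult p q (c * b' + m * n) = theta_mult p q m * theta_mult p q n"
proof -
  let ?k = "(p + q) div 2"
  obtain F z where F: "F \<in> theta_type p q" and z: "Im z > 0" "F z \<noteq> 0" by (rule theta_type_witness)
  note f = Gamma0_192_facts[OF G(1)] and f' = Gamma0_192_facts[OF G(2)]
  have "(a * a' + b * c') * (c * b' + m * n) - (a * b' + b * n) * (c * a' + m * c') = (a * m - b * c) * (a' * n - b' * c')"
    by (simp add: algebra_simps)
  hence G': "(a * a' + b * c', a * b' + b * n, c * a' + m * c', c * b' + m * n) \<in> Gamma0 192"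
    using f f' by (simp add: Gamma0_def SL2Z_def)
  have "theta_mult p q (c * b' + m * n) * F z = slash ?k (slash ?k F (a, b, c, m)) (a', b', c', n) z"
    unfolding slash_slash[OF f'(1) z(1)] by (rule slash_theta_type[OF F ev G' z(1), symmetric])
  also have "\<dots> = theta_mult p q m * slash ?k F (a', b', c', n) z"
    using slash_theta_type[OF F ev G(1) Im_moebius_pos[OF f'(1) z(1)]] by (simp add: slash_apply)
  also have "\<dots> = theta_mult p q m * theta_mult p q n * F z"
    using slash_theta_type[OF F ev G(2) z(1)] by simp
  finally show ?thesis using z(2) by simp
qed

text \<open>The translation z -> z + 1 has multiplier 1, and multiplying a matrix with lower row
  (192, d) by it produces the entry d + 192.\<close>

lemma theta_mult_periodic:
  assumes ev: "even (p + q)" and d: "coprime d 192"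
  shows "theta_mult p q (d + 192) = theta_mult p q d"
proof -
  obtain a b where G: "(a, b, 192, d) \<in> Gamma0 192" using Gamma0_with_entry[of d 192] d by auto
  have "(1, 1, 0, 1) \<in> Gamma0 192" by (simp add: Gamma0_def SL2Z_def)
  from theta_mult_mult[OF ev G this] show ?thesis by (simp add: theta_mult_1 add.commute)
qed

lemma theta_mult_cong:
  assumes ev: "even (p + q)" and d: "coprime d 192"
  shows "theta_mult p q (d + 192 * t) = theta_mult p q d"
proof -
  have nat: "theta_mult p q (d + 192 * int n) = theta_mult p q d" if "coprime d 192" for n d
  proof (induction n)
    case (Suc n)
    have "gcd (d + 192 * int n) 192 = gcd d 192" by (metis gcd_add_mult gcd.commute add.commute mult.commute)
    hence "coprime (d + 192 * int n) 192" using that by (simp only: coprime_iff_gcd_eq_1)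
    from theta_mult_periodic[OF ev this] Suc show ?case by (simp add: algebra_simps)
  qed simp
  show ?thesis
  proof (cases "t \<ge> 0")
    case True
    thus ?thesis using nat[OF d, of "nat t"] by simp
  next
    case False
    have "gcd (d + 192 * t) 192 = gcd d 192" by (metis gcd_add_mult gcd.commute add.commute mult.commute)
    hence "coprime (d + 192 * t) 192" using d by (simp only: coprime_iff_gcd_eq_1)
    from nat[OF this, of "nat (-t)"] False show ?thesis by simp
  qed
qed

definition theta_char :: "nat \<Rightarrow> nat \<Rightarrow> int \<Rightarrow> complex" where
  "theta_char p q d = (if coprime d 192 then theta_mult p q d else 0)"

lemma theta_char_multiplicative:
  assumes ev: "even (p + q)"
  shows "theta_char p q (m * n) = theta_char p q m * theta_char p q n"
proof (cases "coprime m 192 \<and> coprime n 192")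
  case True
  then obtain a b a' b' where G: "(a, b, 192, m) \<in> Gamma0 192" "(a', b', 192, n) \<in> Gamma0 192"
    using Gamma0_with_entry[of m 192] Gamma0_with_entry[of n 192] by (metis of_nat_numeral)
  \<comment> \<open>The product of the two matrices has lower right entry m n + 192 b', which
    differs from m n by a multiple of the modulus.\<close>
  have "theta_mult p q (m * n) = theta_mult p q (m * n + 192 * b')"
    using True by (intro theta_mult_cong[OF ev, symmetric]) simp
  also have "\<dots> = theta_mult p q m * theta_mult p q n"
    using theta_mult_mult[OF ev G] by (simp add: add.commute)
  finally show ?thesis using True by (simp add: theta_char_def)
qed (auto simp: theta_char_def)

lemma dirichlet_character_theta_char:
  assumes ev: "even (p + q)"
  shows "dirichlet_character 192 (theta_char p q)"
  unfolding dirichlet_character_def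
proof (intro conjI allI)
  show "theta_char p q (m * n) = theta_char p q m * theta_char p q n" for m n
    by (rule theta_char_multiplicative[OF ev])
  fix n :: int
  have c: "coprime (n + 192) 192 \<longleftrightarrow> coprime n 192" by (simp add: coprime_iff_gcd_eq_1)
  show "theta_char p q (n + int 192) = theta_char p q n"
    using theta_mult_periodic[OF ev, of n] c by (simp add: theta_char_def)
  \<comment> \<open>With x an inverse of n modulo 192, multiplicativity makes the two character
    values multiply to 1; no Gauss sum has to be shown nonzero.\<close>
  have "theta_char p q n \<noteq> 0" if n: "coprime n 192"
  proof -
    obtain x where "[n * x = 1] (mod 192)" using cong_solve_coprime_int[OF n] by auto
    then obtain t where t: "n * x = 1 + 192 * t" by (metis cong_iff_lin cong_sym)
    have "gcd (1 + 192 * t) 192 = gcd (1::int) 192" by (metis gcd_add_mult gcd.commute add.commute mult.commute)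
    hence "coprime (1 + 192 * t) 192" by (simp only: coprime_iff_gcd_eq_1) simp
    hence "theta_char p q (n * x) = 1"
      unfolding t using theta_mult_cong[OF ev, of 1 t] by (simp add: theta_char_def theta_mult_1)
    thus ?thesis using theta_char_multiplicative[OF ev, of n x] by auto
  qed
  thus "theta_char p q n \<noteq> 0 \<longleftrightarrow> coprime n (int 192)" by (auto simp: theta_char_def)
qed

section \<open>Behaviour at the cusps\<close>

lemma slash_holomorphic:
  assumes hol: "f holomorphic_on upper_half_plane" and det: "a * d - b * c = 1"
  shows "slash k f (a, b, c, d) holomorphic_on upper_half_plane"
proof -
  have nz: "of_int c * z + of_int d \<noteq> 0" if "z \<in> upper_half_plane" for z
    using denominator_nonzero[OF _ SL2Z_row_nonzero[OF det], of z] that by (simp add: upper_half_plane_def)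
  have "f \<circ> (\<lambda>z. (of_int a * z + of_int b) / (of_int c * z + of_int d)) holomorphic_on upper_half_plane"
    by (rule holomorphic_on_compose_gen[OF _ hol])
       (use nz Im_moebius_pos[OF det] in \<open>auto intro!: holomorphic_intros simp: upper_half_plane_def\<close>)
  hence "(\<lambda>z. (f \<circ> (\<lambda>z. (of_int a * z + of_int b) / (of_int c * z + of_int d))) z / (of_int c * z + of_int d) ^ k) holomorphic_on upper_half_plane"
    by (rule holomorphic_on_divide) (use nz in \<open>auto intro!: holomorphic_intros\<close>)
  thus ?thesis by (simp add: slash_def o_def)
qed

text \<open>On the strip with Im z >= 1 one has |c z + d| <= K Im z, so the reciprocal of the
  imaginary part of the image, |c z + d|^2 / Im z, is at most K^2 Im z. Moreover |c z + d| >= 1, so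
  dividing by its power only helps.\<close>

lemma slash_bound_at_infinity:
  assumes growth: "poly_growth f" and det: "a * d - b * c = 1" and h: "h \<ge> 0"
  shows "\<exists>C K A. K \<ge> 0 \<and> (\<forall>z. Im z \<ge> 1 \<longrightarrow> \<bar>Re z\<bar> \<le> h \<longrightarrow> norm (slash k f (a, b, c, d) z) \<le> C * (1 + K * Im z) ^ A)"
proof -
  obtain C A where CA: "C \<ge> 0" "\<And>z. Im z > 0 \<Longrightarrow> norm (f z) \<le> C * (1 + 1 / Im z) ^ A"
    using poly_growthD[OF growth] by blast
  define K where "K = \<bar>of_int c\<bar> * (h + 1) + \<bar>real_of_int d\<bar>"
  have K: "K \<ge> 0" using h by (simp add: K_def)
  have "norm (slash k f (a, b, c, d) z) \<le> C * (1 + K\<^sup>2 * Im z) ^ A" if y: "Im z \<ge> 1" and x: "\<bar>Re z\<bar> \<le> h" for z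
  proof -
    let ?j = "of_int c * z + of_int d" and ?w = "(of_int a * z + of_int b) / (of_int c * z + of_int d)"
    have z: "Im z > 0" using y by simp
    have j1: "norm ?j \<ge> 1"
    proof (cases "c = 0")
      case True
      hence "d \<noteq> 0" using det by auto
      hence "1 \<le> \<bar>real_of_int d\<bar>" by linarith
      thus ?thesis using True by simp
    next
      case False
      hence "1 * 1 \<le> \<bar>real_of_int c\<bar> * Im z" using y by (intro mult_mono) auto
      also have "\<dots> = \<bar>Im ?j\<bar>" using z by (simp add: abs_mult)
      also have "\<dots> \<le> norm ?j" by (rule abs_Im_le_cmod)
      finally show ?thesis by simp
    qed
    have "norm z \<le> h + Im z" using cmod_le[of z] x z by simp
    also have "\<dots> \<le> (h + 1) * Im z" using h y mult_left_mono[of 1 "Im z" h] by (simp add: distrib_right)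
    finally have nz: "norm z \<le> (h + 1) * Im z" .
    have "norm ?j \<le> \<bar>of_int c\<bar> * norm z + \<bar>of_int d\<bar>"
      using norm_triangle_ineq[of "of_int c * z" "of_int d"] by (simp add: norm_mult)
    also have "\<dots> \<le> \<bar>of_int c\<bar> * ((h + 1) * Im z) + \<bar>of_int d\<bar> * Im z"
      using nz y mult_left_mono[of 1 "Im z" "\<bar>real_of_int d\<bar>"] by (intro add_mono mult_left_mono) auto
    also have "\<dots> = K * Im z" by (simp add: K_def algebra_simps)
    finally have jK: "norm ?j \<le> K * Im z" .
    have "1 / Im ?w = norm ?j ^ 2 / Im z" using Im_moebius[OF det z] by simp
    also have "\<dots> \<le> (K * Im z) ^ 2 / Im z" using jK z by (intro divide_right_mono power_mono) auto
    also have "\<dots> = K\<^sup>2 * Im z" using z by (simp add: power2_eq_square)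
    finally have "(1 + 1 / Im ?w) ^ A \<le> (1 + K\<^sup>2 * Im z) ^ A"
      using Im_moebius_pos[OF det z] by (intro power_mono) auto
    hence "norm (f ?w) \<le> C * (1 + K\<^sup>2 * Im z) ^ A"
      using CA(2)[OF Im_moebius_pos[OF det z]] CA(1) mult_left_mono order.trans by blast
    moreover have p: "1 \<le> norm ?j ^ k" by (rule one_le_power[OF j1])
    have "norm (f ?w) / norm ?j ^ k \<le> norm (f ?w) / 1"
    proof (rule divide_left_mono[OF p])
      show "0 < norm ?j ^ k * 1" using p by linarith
    qed simp
    hence "norm (slash k f (a, b, c, d) z) \<le> norm (f ?w)"
      by (simp add: slash_apply norm_divide norm_power)
    ultimately show ?thesis by linarith
  qed
  thus ?thesis by (intro exI[of _ C] exI[of _ "K\<^sup>2"] exI[of _ A]) auto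
qed

text \<open>The translation by 192, conjugated into the coordinates of f, lies in
  \<open>Gamma0 192\<close> and has lower right entry congruent to 1, so its multiplier is 1 and f
  is invariant under it.\<close>

lemma slash_theta_type_periodic:
  assumes f: "f \<in> theta_type p q" and ev: "even (p + q)" and det: "a * d - b * c = 1" and z: "Im z > 0"
  shows "slash ((p + q) div 2) f (a, b, c, d) (z + of_nat 192) = slash ((p + q) div 2) f (a, b, c, d) z"
proof -
  let ?k = "(p + q) div 2"
  \<comment> \<open>With g = (a, b; c, d) and T the translation by 192, these are the entries of g T
    g^(-1).\<close>
  have "(1 - a * c * 192) * (1 + a * c * 192) - (a * a * 192) * (- c * c * 192) = 1"
    by (simp add: algebra_simps)
  hence G: "(1 - a * c * 192, a * a * 192, - c * c * 192, 1 + a * c * 192) \<in> Gamma0 192"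
    by (simp add: Gamma0_def SL2Z_def)
  have "theta_mult p q (1 + a * c * 192) = 1"
    using theta_mult_cong[OF ev, of 1 "a * c"] by (simp add: theta_mult_1 mult_ac)
  hence inv: "slash ?k f (1 - a * c * 192, a * a * 192, - c * c * 192, 1 + a * c * 192) w = f w" if "Im w > 0" for w
    using slash_theta_type[OF f ev G that] by simp
  have "(1 - a * c * 192) * b + a * a * 192 * d = a * 192 * (a * d - b * c) + b"
       "- c * c * 192 * b + (1 + a * c * 192) * d = c * 192 * (a * d - b * c) + d"
    by (simp_all add: algebra_simps)
  hence eqs: "(1 - a * c * 192) * a + a * a * 192 * c = a" "(1 - a * c * 192) * b + a * a * 192 * d = a * 192 + b"
    "- c * c * 192 * a + (1 + a * c * 192) * c = c" "- c * c * 192 * b + (1 + a * c * 192) * d = c * 192 + d"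
    unfolding det by (simp_all add: algebra_simps)
  have "slash ?k f (a, b, c, d) (z + of_nat 192) = slash ?k f (a, a * 192 + b, c, c * 192 + d) z"
    by (simp add: slash_apply algebra_simps)
  also have "\<dots> = slash ?k (slash ?k f (1 - a * c * 192, a * a * 192, - c * c * 192, 1 + a * c * 192)) (a, b, c, d) z"
    unfolding slash_slash[OF det z] eqs ..
  also have "\<dots> = slash ?k f (a, b, c, d) z"
    using inv[OF Im_moebius_pos[OF det z]] by (simp only: slash_apply[of _ _ a b c d])
  finally show ?thesis .
qed

theorem theta_type_modular_forms:
  assumes f: "f \<in> theta_type p q" and ev: "even (p + q)"
  shows "f \<in> modular_forms ((p + q) div 2) 192 (theta_char p q)"
  unfolding modular_forms_def mem_Collect_eq
proof (intro conjI ballI)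
  show hol: "f holomorphic_on upper_half_plane" using f by (simp add: theta_type_def)
  fix \<gamma> assume \<gamma>: "\<gamma> \<in> Gamma0 192"
  obtain a b c d where abcd: "\<gamma> = (a, b, c, d)" by (cases \<gamma>)
  have "theta_mult p q d = theta_char p q d"
    using Gamma0_coprime(1)[of a b c d 192] \<gamma> abcd by (simp add: theta_char_def)
  thus "case \<gamma> of (a, b, c, d) \<Rightarrow> \<forall>z\<in>upper_half_plane. slash ((p + q) div 2) f (a, b, c, d) z = theta_char p q d * f z"
    using slash_theta_type[OF f ev] \<gamma> by (simp add: abcd upper_half_plane_def)
next
  fix \<gamma> assume \<gamma>: "\<gamma> \<in> SL2Z"
  obtain a b c d where abcd: "\<gamma> = (a, b, c, d)" by (cases \<gamma>)
  have det: "a * d - b * c = 1" using \<gamma> by (simp add: abcd SL2Z_def)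
  have hol: "f holomorphic_on upper_half_plane" and gr: "poly_growth f" using f by (simp_all add: theta_type_def)
  obtain C K A where "K \<ge> 0" "\<And>z. Im z \<ge> 1 \<Longrightarrow> \<bar>Re z\<bar> \<le> real 192 \<Longrightarrow> norm (slash ((p + q) div 2) f (a, b, c, d) z) \<le> C * (1 + K * Im z) ^ A"
    using slash_bound_at_infinity[OF gr det, of "real 192"] by (metis of_nat_0_le_iff)
  thus "holomorphic_at_infinity (slash ((p + q) div 2) f \<gamma>)"
    unfolding abcd
    by (intro holomorphic_at_infinityI[of 192] slash_holomorphic[OF hol det] slash_theta_type_periodic[OF f ev det]) auto
qed


section \<open>The generating functions as sums of products of theta functions\<close>

definition sq_sum :: "int list \<Rightarrow> int" where
  "sq_sum xs = (\<Sum>x\<leftarrow>xs. x\<^sup>2)"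

definition tuples :: "(int \<Rightarrow> bool) \<Rightarrow> nat \<Rightarrow> int list set" where
  "tuples P n = {xs. length xs = n \<and> (\<forall>x\<in>set xs. P x)}"

lemma sq_sum_nonneg: "sq_sum xs \<ge> 0"
  unfolding sq_sum_def by (intro sum_list_nonneg) auto

lemma sq_sum_Cons [simp]: "sq_sum (x # xs) = x\<^sup>2 + sq_sum xs"
  by (simp add: sq_sum_def)

lemma sq_sum_Nil [simp]: "sq_sum [] = 0"
  by (simp add: sq_sum_def)

lemma theta_eq_nome: "theta z = (\<Sum>\<^sub>\<infinity>n::int. nome z ^ nat (n\<^sup>2))"
proof -
  have "exp (2 * of_real pi * \<i> * of_int n ^ 2 * z) = nome z ^ nat (n\<^sup>2)" for n :: int
    by (simp add: nome_def exp_of_nat_mult[symmetric] mult_ac)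
  thus ?thesis by (simp add: theta_def)
qed

lemma nome_scaled: "nome (of_nat t * z) = nome z ^ t"
  by (simp add: nome_def exp_of_nat_mult[symmetric] mult_ac)

lemma summable_nome_squares:
  assumes "Im z > 0" "t > 0"
  shows "(\<lambda>n::int. norm (nome z ^ (t * nat (n\<^sup>2)))) summable_on UNIV"
proof -
  have "exp (2 * of_real pi * \<i> * of_int n ^ 2 * (of_nat t * z)) = nome z ^ (t * nat (n\<^sup>2))" for n :: int
    by (simp add: nome_def exp_of_nat_mult[symmetric] mult_ac)
  thus ?thesis using theta_abs_summable[of "of_nat t * z"] assms by simp
qed

lemma theta_scaled_eq_infsum:
  "theta (of_nat t * z) = (\<Sum>\<^sub>\<infinity>n::int. nome z ^ (t * nat (n\<^sup>2)))"
  unfolding theta_eq_nome nome_scaled power_mult ..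

lemma infsum_multiples:
  assumes "k > 0"
  shows "(\<Sum>\<^sub>\<infinity>n | int k dvd n. nome z ^ (t * nat (n\<^sup>2))) = theta (of_nat (t * k\<^sup>2) * z)"
proof -
  have "(\<Sum>\<^sub>\<infinity>n::int. nome z ^ (t * k\<^sup>2 * nat (n\<^sup>2))) = (\<Sum>\<^sub>\<infinity>n | int k dvd n. nome z ^ (t * nat (n\<^sup>2)))"
    by (rule infsum_reindex_bij_witness[of _ "\<lambda>n. n div int k" "\<lambda>n. int k * n"])
       (use assms in \<open>auto simp: power_mult_distrib nat_mult_distrib nat_power_eq mult_ac\<close>)
  thus ?thesis unfolding theta_scaled_eq_infsum by simp
qed

lemma square_mod_8:
  fixes x :: int
  shows "x\<^sup>2 mod 8 = (if odd x then 1 else if 4 dvd x then 0 else 4)"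
proof -
  define m where "m = x mod 8"
  have "m = 0 \<or> m = 1 \<or> m = 2 \<or> m = 3 \<or> m = 4 \<or> m = 5 \<or> m = 6 \<or> m = 7"
    unfolding m_def by presburger
  moreover have "odd x \<longleftrightarrow> odd m" "4 dvd x \<longleftrightarrow> 4 dvd m" unfolding m_def by presburger+
  moreover have "x\<^sup>2 mod 8 = m\<^sup>2 mod 8" unfolding m_def by (simp add: power_mod)
  ultimately show ?thesis by auto
qed

text \<open>
  Up to restriction by \<open>P\<close>, the only nonempty classes give \<open>\<theta>(t z) - \<theta>(4 t z)\<close>, \<open>\<theta>(4 t z) - \<theta>(16 t z)\<close>
  and \<open>\<theta>(16 t z)\<close>.
\<close>

lemma squares_residue_type:
  fixes t :: nat and r :: int
  assumes t: "t = 1 \<or> t = 3" and P: "P \<in> {\<lambda>_. True, odd, even}"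
  shows "\<exists>h \<in> theta_type (if t = 1 then 1 else 0) (if t = 1 then 0 else 1). \<forall>z. Im z > 0 \<longrightarrow>
     h z = (\<Sum>\<^sub>\<infinity>n | P n \<and> [int t * n\<^sup>2 = r] (mod 8). nome z ^ (t * nat (n\<^sup>2)))"
proof -
  let ?T = "theta_type (if t = 1 then 1 else 0) (if t = 1 then 0 else 1)"
  let ?f = "\<lambda>z n::int. nome z ^ (t * nat (n\<^sup>2))"
  define \<theta> where "\<theta> = (\<lambda>k z. theta (of_nat (t * k\<^sup>2) * z))"
  have \<theta>: "\<theta> k \<in> ?T" if "k \<in> {1, 2, 4}" for k
    using theta_scaled_type[OF that] t by (auto simp: \<theta>_def)
  have summ: "?f z summable_on A" if "Im z > 0" for z A
    using summable_on_subset_banach[OF abs_summable_summable[OF summable_nome_squares[OF that, of t]]] t by auto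
  have sub: "(\<Sum>\<^sub>\<infinity>n\<in>A - B. ?f z n) = (\<Sum>\<^sub>\<infinity>n\<in>A. ?f z n) - (\<Sum>\<^sub>\<infinity>n\<in>B. ?f z n)" if "B \<subseteq> A" "Im z > 0" for A B z
    by (rule infsum_Diff) (use that summ in auto)
  have mult: "(\<Sum>\<^sub>\<infinity>n | int k dvd n. ?f z n) = \<theta> k z" if "k > 0" for k z
    unfolding \<theta>_def by (rule infsum_multiples[OF that])
  have all: "(\<Sum>\<^sub>\<infinity>n. ?f z n) = \<theta> 1 z" for z using mult[of 1 z] by simp
  have odd: "(\<Sum>\<^sub>\<infinity>n | odd n. ?f z n) = \<theta> 1 z - \<theta> 2 z" if "Im z > 0" for z
  proof -
    have "{n::int. odd n} = UNIV - {n. int 2 dvd n}" by auto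
    thus ?thesis using sub[of "{n. int 2 dvd n}" UNIV z] that mult[of 2 z] all[of z] by simp
  qed
  have two: "(\<Sum>\<^sub>\<infinity>n | even n \<and> \<not> 4 dvd n. ?f z n) = \<theta> 2 z - \<theta> 4 z" if "Im z > 0" for z
  proof -
    have "{n::int. even n \<and> \<not> 4 dvd n} = {n. int 2 dvd n} - {n. int 4 dvd n}" by auto
    moreover have "{n. int 4 dvd n} \<subseteq> {n. int 2 dvd n}" by (auto intro: dvd_trans[of 2 4])
    ultimately show ?thesis using sub[of "{n. int 4 dvd n}" "{n. int 2 dvd n}" z] that mult[of 2 z] mult[of 4 z] by simp
  qed
  have four: "(\<Sum>\<^sub>\<infinity>n | 4 dvd n. ?f z n) = \<theta> 4 z" for z using mult[of 4 z] by simp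
  define S where "S = {n. P n \<and> [int t * n\<^sup>2 = r] (mod 8)}"
  \<comment> \<open>Odd squares are 1 modulo 8, and 4 t is 4 modulo 8 because t is odd; so the three
    classes of n have the distinct residues t, 4 and 0.\<close>
  have mod: "(int t * n\<^sup>2) mod 8 = (if odd n then int t else if 4 dvd n then 0 else 4)" for n :: int
  proof -
    have "(int t * n\<^sup>2) mod 8 = (int t * (n\<^sup>2 mod 8)) mod 8" by (simp add: mod_mult_right_eq)
    thus ?thesis unfolding square_mod_8 using t by auto
  qed
  have S: "S = {n. P n \<and> (if odd n then int t else if 4 dvd n then 0 else 4) = r mod 8}"
    unfolding S_def cong_def mod ..
  \<comment> \<open>A residue fixes the class of n, and each class has a single parity, so the
    restriction \<open>P\<close> either keeps the class or empties it.\<close>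
  hence "S \<in> {{}, {n. odd n}, {n. even n \<and> \<not> 4 dvd n}, {n. 4 dvd n}}"
  proof -
    consider "r mod 8 = int t" | "r mod 8 = 4" | "r mod 8 = 0" | "r mod 8 \<notin> {int t, 4, 0}" by blast
    thus ?thesis
    proof cases
      case 1
      hence "S = {n. P n \<and> odd n}" using t S by auto
      thus ?thesis using P by auto
    next
      case 2
      hence "S = {n. P n \<and> even n \<and> \<not> 4 dvd n}" using t S by auto
      thus ?thesis using P by auto
    next
      case 3
      have "even n" if "4 dvd n" for n :: int using that by (rule dvd_trans[rotated]) simp
      hence "S = {n. P n \<and> 4 dvd n}" using t 3 S by auto
      thus ?thesis using P \<open>\<And>n. 4 dvd n \<Longrightarrow> even n\<close> by auto
    next
      case 4
      hence "S = {}" using S by auto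
      thus ?thesis by simp
    qed
  qed
  then consider "S = {}" | "S = {n. odd n}" | "S = {n. even n \<and> \<not> 4 dvd n}" | "S = {n. 4 dvd n}" by blast
  thus ?thesis unfolding S_def[symmetric]
  proof cases
    case 1
    thus "\<exists>h\<in>?T. \<forall>z. Im z > 0 \<longrightarrow> h z = (\<Sum>\<^sub>\<infinity>n\<in>S. ?f z n)"
      by (intro bexI[of _ "\<lambda>_. 0"] theta_type_zero) auto
  next
    case 2
    thus "\<exists>h\<in>?T. \<forall>z. Im z > 0 \<longrightarrow> h z = (\<Sum>\<^sub>\<infinity>n\<in>S. ?f z n)"
      using odd by (intro bexI[of _ "\<lambda>z. \<theta> 1 z - \<theta> 2 z"] theta_type_diff \<theta>) auto
  next
    case 3
    thus "\<exists>h\<in>?T. \<forall>z. Im z > 0 \<longrightarrow> h z = (\<Sum>\<^sub>\<infinity>n\<in>S. ?f z n)"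
      using two by (intro bexI[of _ "\<lambda>z. \<theta> 2 z - \<theta> 4 z"] theta_type_diff \<theta>) auto
  next
    case 4
    thus "\<exists>h\<in>?T. \<forall>z. Im z > 0 \<longrightarrow> h z = (\<Sum>\<^sub>\<infinity>n\<in>S. ?f z n)"
      using four by (intro bexI[of _ "\<theta> 4"] \<theta>) auto
  qed
qed

section \<open>Convolution over residues modulo 8\<close>

lemma abs_summable_times:
  fixes f :: "'i \<Rightarrow> complex" and g :: "'j \<Rightarrow> complex"
  assumes "(\<lambda>x. norm (f x)) summable_on A" "(\<lambda>y. norm (g y)) summable_on B"
  shows "(\<lambda>(x, y). norm (f x * g y)) summable_on A \<times> B"
    and "(\<Sum>\<^sub>\<infinity>(x, y)\<in>A \<times> B. f x * g y) = (\<Sum>\<^sub>\<infinity>x\<in>A. f x) * (\<Sum>\<^sub>\<infinity>y\<in>B. g y)"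
proof -
  have "(\<lambda>z. norm ((\<lambda>(x, y). f x * g y) z)) summable_on A \<times> B"
  proof (rule Infinite_Sum.abs_summable_on_Sigma_iff[THEN iffD2], intro conjI ballI)
    fix x
    show "(\<lambda>y. norm ((\<lambda>(x, y). f x * g y) (x, y))) summable_on B"
      using summable_on_cmult_right[OF assms(2), of "norm (f x)"] by (simp add: norm_mult)
  next
    have "(\<Sum>\<^sub>\<infinity>y\<in>B. norm ((\<lambda>(x, y). f x * g y) (x, y))) = norm (f x) * (\<Sum>\<^sub>\<infinity>y\<in>B. norm (g y))" for x
      by (simp add: norm_mult infsum_cmult_right')
    thus "(\<lambda>x. norm (\<Sum>\<^sub>\<infinity>y\<in>B. norm ((\<lambda>(x, y). f x * g y) (x, y)))) summable_on A"
      using summable_on_cmult_left[OF assms(1), of "norm (\<Sum>\<^sub>\<infinity>y\<in>B. norm (g y))"] by (simp add: abs_mult)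
  qed
  thus *: "(\<lambda>(x, y). norm (f x * g y)) summable_on A \<times> B" by (simp add: case_prod_unfold)
  have "(\<lambda>z. norm ((\<lambda>(x, y). f x * g y) z)) summable_on A \<times> B" using * by (simp add: case_prod_unfold)
  from infsum_Sigma'_banach[OF abs_summable_summable[OF this]]
  show "(\<Sum>\<^sub>\<infinity>(x, y)\<in>A \<times> B. f x * g y) = (\<Sum>\<^sub>\<infinity>x\<in>A. f x) * (\<Sum>\<^sub>\<infinity>y\<in>B. g y)"
    by (simp add: infsum_cmult_right' infsum_cmult_left')
qed

lemma summable_tuples:
  assumes "Im z > 0" "t > 0"
  shows "(\<lambda>xs. norm (nome z ^ (t * nat (sq_sum xs)))) summable_on {xs. length xs = n}"
proof (induction n)
  case (Suc n)
  have bij: "bij_betw (\<lambda>(x, xs). x # xs) (UNIV \<times> {xs. length xs = n}) {xs::int list. length xs = Suc n}"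
    by (rule bij_betw_byWitness[of _ "\<lambda>xs. (hd xs, tl xs)"]) (auto simp: length_Suc_conv)
  have "(\<lambda>(x, xs). norm (nome z ^ (t * nat (x\<^sup>2)) * nome z ^ (t * nat (sq_sum xs)))) summable_on UNIV \<times> {xs. length xs = n}"
    by (rule abs_summable_times(1)[OF summable_nome_squares[OF assms] Suc])
  also have "(\<lambda>(x, xs). norm (nome z ^ (t * nat (x\<^sup>2)) * nome z ^ (t * nat (sq_sum xs)))) =
      (\<lambda>p. norm (nome z ^ (t * nat (sq_sum ((\<lambda>(x, xs). x # xs) p)))))"
    by (auto simp: fun_eq_iff nat_add_distrib sq_sum_nonneg power_add distrib_left)
  finally show ?case by (subst (asm) summable_on_reindex_bij_betw[OF bij])
qed simp

lemma summable_subset_tuples: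
  assumes "Im z > 0" "t > 0" "A \<subseteq> {xs. length xs = n}"
  shows "(\<lambda>xs. norm (nome z ^ (t * nat (sq_sum xs)))) summable_on A"
  by (rule summable_on_subset_banach[OF summable_tuples[OF assms(1,2)] assms(3)])

lemma infsum_UN_disjoint:
  fixes f :: "'i \<Rightarrow> complex"
  assumes "finite I" "\<And>i. i \<in> I \<Longrightarrow> f summable_on A i" "\<And>i j. i \<in> I \<Longrightarrow> j \<in> I \<Longrightarrow> i \<noteq> j \<Longrightarrow> A i \<inter> A j = {}"
  shows "(\<Sum>\<^sub>\<infinity>x\<in>(\<Union>i\<in>I. A i). f x) = (\<Sum>i\<in>I. \<Sum>\<^sub>\<infinity>x\<in>A i. f x)"
  by (rule sum_infsum[symmetric]) (use assms in auto)


text \<open>The residue s of \<open>\<alpha> x\<close> forces \<open>\<beta> y\<close> to have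
  residue r - s. The summation set thus splits into eight disjoint rectangles, over each of which
  the double sum factors.\<close>

lemma infsum_residue_convolution:
  fixes f :: "'i \<Rightarrow> complex" and g :: "'j \<Rightarrow> complex" and \<alpha> :: "'i \<Rightarrow> int" and \<beta> :: "'j \<Rightarrow> int"
  assumes f: "(\<lambda>x. norm (f x)) summable_on A" and g: "(\<lambda>y. norm (g y)) summable_on B"
  shows "(\<Sum>\<^sub>\<infinity>(x, y)\<in>{(x, y). x \<in> A \<and> y \<in> B \<and> [\<alpha> x + \<beta> y = r] (mod 8)}. f x * g y) =
    (\<Sum>s\<in>{0..<8}. (\<Sum>\<^sub>\<infinity>x | x \<in> A \<and> [\<alpha> x = s] (mod 8). f x) * (\<Sum>\<^sub>\<infinity>y | y \<in> B \<and> [\<beta> y = r - s] (mod 8). g y))"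
proof -
  define A' B' where "A' = (\<lambda>s. {x. x \<in> A \<and> [\<alpha> x = s] (mod 8)})" and "B' = (\<lambda>s. {y. y \<in> B \<and> [\<beta> y = r - s] (mod 8)})"
  have f': "(\<lambda>x. norm (f x)) summable_on A' s" and g': "(\<lambda>y. norm (g y)) summable_on B' s" for s
    by (rule summable_on_subset_banach[OF f] summable_on_subset_banach[OF g]; auto simp: A'_def B'_def)+
  have eq: "{(x, y). x \<in> A \<and> y \<in> B \<and> [\<alpha> x + \<beta> y = r] (mod 8)} = (\<Union>s\<in>{0..<8}. A' s \<times> B' s)"
  proof (intro equalityI subsetI)
    fix p assume "p \<in> {(x, y). x \<in> A \<and> y \<in> B \<and> [\<alpha> x + \<beta> y = r] (mod 8)}"
    then obtain x y where p: "p = (x, y)" "x \<in> A" "y \<in> B" "[\<alpha> x + \<beta> y = r] (mod 8)" by auto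
    have "\<beta> y - (r - \<alpha> x mod 8) = (\<alpha> x + \<beta> y - r) - 8 * (\<alpha> x div 8)"
      by (simp add: minus_mult_div_eq_mod[symmetric])
    hence "[\<beta> y = r - \<alpha> x mod 8] (mod 8)"
      using p(4) by (simp only: cong_iff_dvd_diff) simp
    hence "p \<in> A' (\<alpha> x mod 8) \<times> B' (\<alpha> x mod 8)" using p by (simp add: A'_def B'_def cong_def)
    moreover have "\<alpha> x mod 8 \<in> {0..<8}" by simp
    ultimately show "p \<in> (\<Union>s\<in>{0..<8}. A' s \<times> B' s)" by blast
  next
    fix p assume "p \<in> (\<Union>s\<in>{0..<8}. A' s \<times> B' s)"
    then obtain s where s: "p \<in> A' s \<times> B' s" by (rule UN_E)
    obtain x y where xy: "p = (x, y)" by (cases p)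
    have p: "p = (x, y)" "x \<in> A" "y \<in> B" "[\<alpha> x = s] (mod 8)" "[\<beta> y = r - s] (mod 8)"
      using s unfolding xy A'_def B'_def by simp_all
    have "[\<alpha> x + \<beta> y = r] (mod 8)" using cong_add[OF p(4,5)] by simp
    thus "p \<in> {(x, y). x \<in> A \<and> y \<in> B \<and> [\<alpha> x + \<beta> y = r] (mod 8)}" using p by simp
  qed
  have summ: "(\<lambda>(x, y). f x * g y) summable_on A' s \<times> B' s" for s
  proof -
    have "(\<lambda>p. norm ((\<lambda>(x, y). f x * g y) p)) summable_on A' s \<times> B' s"
      using abs_summable_times(1)[OF f'[of s] g'[of s]] by (simp only: case_prod_unfold)
    thus ?thesis by (rule abs_summable_summable)
  qed
  have disj: "(A' s \<times> B' s) \<inter> (A' u \<times> B' u) = {}" if "s \<in> {0..<8}" "u \<in> {0..<8}" "s \<noteq> u" for s u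
    using that by (auto simp: A'_def cong_def)
  have "(\<Sum>\<^sub>\<infinity>(x, y)\<in>(\<Union>s\<in>{0..<8}. A' s \<times> B' s). f x * g y) = (\<Sum>s\<in>{0..<8}. \<Sum>\<^sub>\<infinity>(x, y)\<in>A' s \<times> B' s. f x * g y)"
    by (rule infsum_UN_disjoint) (use summ disj in auto)
  also have "\<dots> = (\<Sum>s\<in>{0..<8}. (\<Sum>\<^sub>\<infinity>x\<in>A' s. f x) * (\<Sum>\<^sub>\<infinity>y\<in>B' s. g y))"
    by (intro sum.cong abs_summable_times(2) f' g' refl)
  finally show ?thesis unfolding eq by (simp add: A'_def B'_def)
qed

text \<open>Determinant 1 keeps the transformed point in the half-plane, so the values there decide;
  the series defining the generating functions are controlled only there.\<close>

lemma theta_type_cong: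
  assumes "g \<in> theta_type p q" "\<And>z. Im z > 0 \<Longrightarrow> f z = g z"
  shows "f \<in> theta_type p q"
proof -
  have "f holomorphic_on upper_half_plane"
    using assms by (auto simp: theta_type_def upper_half_plane_def intro: holomorphic_transform[of g])
  moreover have "poly_growth f" using assms by (auto simp: theta_type_def poly_growth_def)
  moreover have "f ((of_int a * z + of_int b) / (of_int c * z + of_nat d)) =
     gauss_sum b d ^ p * gauss_sum (3 * b) d ^ q * theta_factor c d z ^ (p + q) * f z"
    if G: "(a, b, c, int d) \<in> Gamma0 192" and "d > 0" and z: "Im z > 0" for a b c d z
  proof -
    have "a * int d - b * c = 1" using G by (simp add: Gamma0_def SL2Z_def)
    from Im_moebius_pos[OF this z] show ?thesis
      using assms that by (simp add: theta_type_def)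
  qed
  ultimately show ?thesis by (simp add: theta_type_def)
qed

text \<open>Induction on the number of variables, peeling off the first entry. The residue r varies
  in the induction because the convolution calls for all residues r - s.\<close>

lemma residue_tuples_type:
  fixes t :: nat
  assumes t: "t = 1 \<or> t = 3" and P: "P \<in> {\<lambda>_. True, odd, even}"
  shows "(\<lambda>z. \<Sum>\<^sub>\<infinity>xs | xs \<in> tuples P n \<and> [int t * sq_sum xs = r] (mod 8). nome z ^ (t * nat (sq_sum xs)))
           \<in> theta_type (if t = 1 then n else 0) (if t = 1 then 0 else n)"
proof (induction n arbitrary: r)
  case 0
  have "{xs. xs \<in> tuples P 0 \<and> [int t * sq_sum xs = r] (mod 8)} = (if [0 = r] (mod 8) then {[]} else {})"
    by (auto simp: tuples_def)
  thus ?case by (simp add: theta_type_const)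
next
  case (Suc n)
  define F where "F = (\<lambda>r z. \<Sum>\<^sub>\<infinity>xs | xs \<in> tuples P n \<and> [int t * sq_sum xs = r] (mod 8). nome z ^ (t * nat (sq_sum xs)))"
  have "\<exists>H. \<forall>s. H s \<in> theta_type (if t = 1 then 1 else 0) (if t = 1 then 0 else 1) \<and>
     (\<forall>z. Im z > 0 \<longrightarrow> H s z = (\<Sum>\<^sub>\<infinity>n | P n \<and> [int t * n\<^sup>2 = s] (mod 8). nome z ^ (t * nat (n\<^sup>2))))"
    by (intro choice allI) (use squares_residue_type[OF t P] in blast)
  then obtain H where H: "\<And>s. H s \<in> theta_type (if t = 1 then 1 else 0) (if t = 1 then 0 else 1)"
    "\<And>s z. Im z > 0 \<Longrightarrow> H s z = (\<Sum>\<^sub>\<infinity>n | P n \<and> [int t * n\<^sup>2 = s] (mod 8). nome z ^ (t * nat (n\<^sup>2)))"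
    by blast
  have F: "F r \<in> theta_type (if t = 1 then n else 0) (if t = 1 then 0 else n)" for r
    unfolding F_def by (rule Suc.IH)
  have "(\<lambda>z. H s z * F (r - s) z) \<in> theta_type (if t = 1 then Suc n else 0) (if t = 1 then 0 else Suc n)" for s
    using theta_type_mult[OF H(1)[of s] F[of "r - s"]] by (auto split: if_splits)
  hence "(\<lambda>z. \<Sum>s\<in>{0..<8}. H s z * F (r - s) z) \<in> theta_type (if t = 1 then Suc n else 0) (if t = 1 then 0 else Suc n)"
    by (intro theta_type_sum)
  thus ?case
  proof (rule theta_type_cong)
    fix z :: complex assume z: "Im z > 0"
    have t0: "t > 0" using t by auto
    have bij: "bij_betw (\<lambda>(x, xs). x # xs) {(x, xs). x \<in> {x. P x} \<and> xs \<in> tuples P n \<and> [int t * x\<^sup>2 + int t * sq_sum xs = r] (mod 8)}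
       {xs. xs \<in> tuples P (Suc n) \<and> [int t * sq_sum xs = r] (mod 8)}"
      by (rule bij_betw_byWitness[of _ "\<lambda>xs. (hd xs, tl xs)"]) (auto simp: tuples_def length_Suc_conv distrib_left)
    have "(\<Sum>\<^sub>\<infinity>xs | xs \<in> tuples P (Suc n) \<and> [int t * sq_sum xs = r] (mod 8). nome z ^ (t * nat (sq_sum xs))) =
      (\<Sum>\<^sub>\<infinity>(x, xs)\<in>{(x, xs). x \<in> {x. P x} \<and> xs \<in> tuples P n \<and> [int t * x\<^sup>2 + int t * sq_sum xs = r] (mod 8)}.
         nome z ^ (t * nat (x\<^sup>2)) * nome z ^ (t * nat (sq_sum xs)))"
      unfolding infsum_reindex_bij_betw[OF bij, symmetric]
      by (rule infsum_cong) (auto simp: nat_add_distrib sq_sum_nonneg power_add distrib_left)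
    also have "\<dots> = (\<Sum>s\<in>{0..<8}. (\<Sum>\<^sub>\<infinity>x | x \<in> {x. P x} \<and> [int t * x\<^sup>2 = s] (mod 8). nome z ^ (t * nat (x\<^sup>2))) *
        (\<Sum>\<^sub>\<infinity>xs | xs \<in> tuples P n \<and> [int t * sq_sum xs = r - s] (mod 8). nome z ^ (t * nat (sq_sum xs))))"
      by (rule infsum_residue_convolution)
         (auto intro!: summable_on_subset_banach[OF summable_nome_squares[OF z t0]] summable_subset_tuples[OF z t0, of _ n] simp: tuples_def)
    also have "\<dots> = (\<Sum>s\<in>{0..<8}. H s z * F (r - s) z)"
      by (simp add: H(2)[OF z] F_def)
    finally show "(\<Sum>\<^sub>\<infinity>xs | xs \<in> tuples P (Suc n) \<and> [int t * sq_sum xs = r] (mod 8). nome z ^ (t * nat (sq_sum xs))) =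
      (\<Sum>s\<in>{0..<8}. H s z * F (r - s) z)" .
  qed
qed

text \<open>One count for three purposes: no restriction gives \<open>N\<close>, odd entries give
  \<open>Nstar\<close>, and even entries give the part of \<open>N\<close> to be removed for
  \<open>Ntilde\<close>.\<close>

definition restricted_count :: "(int \<Rightarrow> bool) \<Rightarrow> nat \<Rightarrow> nat \<Rightarrow> nat \<Rightarrow> nat" where
  "restricted_count P a b m = card {(xs, ys) \<in> representations a b m. (\<forall>x\<in>set xs. P x) \<and> (\<forall>y\<in>set ys. P y)}"

text \<open>Convolving the a variables of coefficient 1 with the b variables of coefficient 3 gives
  a sum over vectors; collecting the vectors by the represented value m turns it into the power
  series.\<close>

theorem restricted_count_type:
  assumes P: "P \<in> {\<lambda>_. True, odd, even}"
  shows "\<exists>h \<in> theta_type a b. \<forall>z. Im z > 0 \<longrightarrow>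
    (\<lambda>m. if [m = r] (mod 8) then of_nat (restricted_count P a b m) * nome z ^ m else 0) sums h z"
proof -
  define T where "T = (\<lambda>t n r z. \<Sum>\<^sub>\<infinity>xs | xs \<in> tuples P n \<and> [int t * sq_sum xs = r] (mod 8). nome z ^ (t * nat (sq_sum xs)))"
  have "(\<lambda>z. T 1 a s z * T 3 b (int r - s) z) \<in> theta_type a b" for s
    using theta_type_mult[OF residue_tuples_type[of 1, OF _ P, of a s] residue_tuples_type[of 3, OF _ P, of b "int r - s"]]
    unfolding T_def by simp
  hence type: "(\<lambda>z. \<Sum>s\<in>{0..<8}. T 1 a s z * T 3 b (int r - s) z) \<in> theta_type a b" by (intro theta_type_sum)
  have sums: "(\<lambda>m. if [m = r] (mod 8) then of_nat (restricted_count P a b m) * nome z ^ m else 0) sums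
      (\<Sum>s\<in>{0..<8}. T 1 a s z * T 3 b (int r - s) z)" if z: "Im z > 0" for z
  proof -
    define V where "V = (\<lambda>(xs, ys). nat (sq_sum xs + 3 * sq_sum ys))"
    define S where "S = {(xs, ys). xs \<in> tuples P a \<and> ys \<in> tuples P b \<and> [int 1 * sq_sum xs + int 3 * sq_sum ys = int r] (mod 8)}"
    have summ: "(\<lambda>xs. norm (nome z ^ (1 * nat (sq_sum xs)))) summable_on tuples P a"
      "(\<lambda>xs. norm (nome z ^ (3 * nat (sq_sum xs)))) summable_on tuples P b"
      using summable_subset_tuples[OF z, of 1 "tuples P a" a] summable_subset_tuples[OF z, of 3 "tuples P b" b]
      by (auto simp: tuples_def)
    have V: "nome z ^ V p = (\<lambda>(xs, ys). nome z ^ (1 * nat (sq_sum xs)) * nome z ^ (3 * nat (sq_sum ys))) p" for p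
      by (cases p) (simp add: V_def nat_add_distrib nat_mult_distrib sq_sum_nonneg power_add)
    have "(\<lambda>p. norm (nome z ^ V p)) summable_on tuples P a \<times> tuples P b"
      unfolding V using abs_summable_times(1)[OF summ] by (simp add: case_prod_unfold)
    hence "(\<lambda>p. norm (nome z ^ V p)) summable_on S"
      by (rule summable_on_subset_banach) (auto simp: S_def)
    hence sS: "(\<lambda>p. nome z ^ V p) summable_on S" by (rule abs_summable_summable)
    have sumS: "(\<Sum>\<^sub>\<infinity>p\<in>S. nome z ^ V p) = (\<Sum>s\<in>{0..<8}. T 1 a s z * T 3 b (int r - s) z)"
      unfolding V S_def T_def by (rule infsum_residue_convolution[OF summ])
    \<comment> \<open>The fibre over m consists of all restricted representations of m, and is empty
      when m lies in another class modulo 8.\<close>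
    have fib: "{p \<in> S. V p = m} = (if [m = r] (mod 8) then {(xs, ys) \<in> representations a b m. (\<forall>x\<in>set xs. P x) \<and> (\<forall>y\<in>set ys. P y)} else {})" for m
    proof -
      have sum3: "(\<Sum>y\<leftarrow>ys. 3 * y\<^sup>2) = 3 * sq_sum ys" for ys :: "int list"
        by (simp add: sq_sum_def sum_list_const_mult)
      have nat: "V (xs, ys) = m \<longleftrightarrow> int m = sq_sum xs + 3 * sq_sum ys" for xs ys
        using sq_sum_nonneg[of xs] sq_sum_nonneg[of ys] by (auto simp: V_def)
      have val: "int (V (xs, ys)) = sq_sum xs + 3 * sq_sum ys" for xs ys
        using sq_sum_nonneg[of xs] sq_sum_nonneg[of ys] by (simp add: V_def)
      have cong: "[int m = int r] (mod 8) \<longleftrightarrow> [m = r] (mod 8)"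
        using cong_int_iff[of m r 8] by simp
      show ?thesis
        unfolding S_def representations_def sum3 sq_sum_def[symmetric] cong[symmetric]
        by (auto simp: tuples_def nat val)
    qed
    \<comment> \<open>Pairing each vector with its value sets up the summation by fibres.\<close>
    have bij: "bij_betw snd (SIGMA m:UNIV. {p \<in> S. V p = m}) S"
      by (rule bij_betw_byWitness[of _ "\<lambda>p. (V p, p)"]) auto
    have "((\<lambda>p. nome z ^ V p) has_sum (\<Sum>s\<in>{0..<8}. T 1 a s z * T 3 b (int r - s) z)) S"
      using sS unfolding sumS[symmetric] by (rule has_sum_infsum)
    hence "((\<lambda>mp. nome z ^ V (snd mp)) has_sum (\<Sum>s\<in>{0..<8}. T 1 a s z * T 3 b (int r - s) z)) (SIGMA m:UNIV. {p \<in> S. V p = m})"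
      by (subst has_sum_reindex_bij_betw[OF bij])
    hence "((\<lambda>m. if [m = r] (mod 8) then of_nat (restricted_count P a b m) * nome z ^ m else 0) has_sum
      (\<Sum>s\<in>{0..<8}. T 1 a s z * T 3 b (int r - s) z)) UNIV"
    proof (rule has_sum_Sigma')
      fix m :: nat
      have fin: "finite {p \<in> S. V p = m}"
        unfolding fib by (auto intro: finite_subset[OF _ finite_representations[of a b m]])
      have "(\<Sum>p\<in>{p \<in> S. V p = m}. nome z ^ V (snd (m, p))) = of_nat (card {p \<in> S. V p = m}) * nome z ^ m"
        by simp
      also have "\<dots> = (if [m = r] (mod 8) then of_nat (restricted_count P a b m) * nome z ^ m else 0)"
        unfolding fib restricted_count_def by simp
      finally show "((\<lambda>p. nome z ^ V (snd (m, p))) has_sum (if [m = r] (mod 8) then of_nat (restricted_count P a b m) * nome z ^ m else 0)) {p \<in> S. V p = m}"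
        using fin by (intro has_sum_finiteI) auto
    qed
    thus ?thesis by (rule has_sum_imp_sums)
  qed
  show ?thesis by (intro bexI[OF _ type] allI impI sums)
qed

section \<open>Initial segments and the generating functions\<close>

lemma sums_shifted_progression:
  fixes u :: "nat \<Rightarrow> complex" and C :: nat
  assumes "(\<lambda>m. if [m = C] (mod 8) then u m else 0) sums S"
  shows "(\<lambda>n. u (8 * n + C)) sums
    (S - (\<Sum>l | 0 \<le> 8 * l + int C \<and> 8 * l + int C < int C. u (nat (8 * l + int C))))"
proof -
  define f where "f = (\<lambda>m. if [m = C] (mod 8) then u m else 0)"
  \<comment> \<open>The discarded nonzero terms have indices 8 l + C with l negative, which is the
    correction sum of the statement.\<close>
  have "(\<lambda>n. f (n + C)) sums (S - (\<Sum>m<C. f m))"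
    using assms unfolding f_def[symmetric] by (rule sums_split_initial_segment)
  \<comment> \<open>After the shift by C only multiples of 8 can carry nonzero terms, so the series
    may be thinned out.\<close>
  moreover have "(\<lambda>n. f (8 * n + C)) sums c \<longleftrightarrow> (\<lambda>n. f (n + C)) sums c" for c
  proof (rule sums_mono_reindex[of "\<lambda>n. 8 * n" "\<lambda>n. f (n + C)"])
    fix n :: nat assume "n \<notin> range (\<lambda>n. 8 * n)"
    hence "\<not> 8 dvd n" by auto
    hence "\<not> [n + C = C] (mod 8)" by (simp add: cong_add_rcancel_0_nat cong_0_iff)
    thus "f (n + C) = 0" by (simp add: f_def)
  qed (simp add: strict_mono_def)
  moreover have "f (8 * n + C) = u (8 * n + C)" for n by (simp add: f_def cong_def)
  moreover have "(\<Sum>m<C. f m) = (\<Sum>l | 0 \<le> 8 * l + int C \<and> 8 * l + int C < int C. u (nat (8 * l + int C)))"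
  proof -
    have "(\<Sum>m<C. f m) = (\<Sum>m\<in>{m\<in>{..<C}. [m = C] (mod 8)}. u m)"
      unfolding f_def by (rule sum.inter_filter[symmetric]) simp
    also have "\<dots> = (\<Sum>l | 0 \<le> 8 * l + int C \<and> 8 * l + int C < int C. u (nat (8 * l + int C)))"
    proof (rule sum.reindex_bij_witness[of _ "\<lambda>l. nat (8 * l + int C)" "\<lambda>m. (int m - int C) div 8"])
      fix m assume m: "m \<in> {m\<in>{..<C}. [m = C] (mod 8)}"
      hence "[int m = int C] (mod 8)" using cong_int_iff[of m C 8] by simp
      hence "8 dvd int m - int C" by (simp add: cong_iff_dvd_diff)
      hence eq: "8 * ((int m - int C) div 8) = int m - int C" by simp
      show "nat (8 * ((int m - int C) div 8) + int C) = m" unfolding eq by simp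
      show "(int m - int C) div 8 \<in> {l. 0 \<le> 8 * l + int C \<and> 8 * l + int C < int C}"
        unfolding mem_Collect_eq eq using m by auto
      show "u (nat (8 * ((int m - int C) div 8) + int C)) = u m" unfolding eq by simp
    next
      fix l assume l: "l \<in> {l. 0 \<le> 8 * l + int C \<and> 8 * l + int C < int C}"
      hence "int (nat (8 * l + int C)) = 8 * l + int C" by simp
      thus "(int (nat (8 * l + int C)) - int C) div 8 = l" by simp
      have "[int (nat (8 * l + int C)) = int C] (mod int 8)"
        using l by (simp add: cong_iff_dvd_diff)
      hence "[nat (8 * l + int C) = C] (mod 8)" by (subst (asm) cong_int_iff)
      thus "nat (8 * l + int C) \<in> {m\<in>{..<C}. [m = C] (mod 8)}" using l by auto
    qed
    finally show ?thesis .
  qed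
  ultimately show ?thesis by simp
qed

lemma sq_sum_ge_length:
  assumes "\<forall>x\<in>set xs. odd x"
  shows "sq_sum xs \<ge> int (length xs)"
  using assms
proof (induction xs)
  case (Cons x xs)
  hence "x\<^sup>2 \<noteq> 0" by auto
  hence "x\<^sup>2 \<ge> 1" using zero_le_power2[of x] by linarith
  thus ?case using Cons by simp
qed simp

text \<open>Odd entries have squares at least 1, so the represented value is at least a + 3 b. Hence
  the series of \<open>Nstar\<close> needs no correction by initial terms.\<close>

lemma Nstar_eq_0:
  assumes "m < a + 3 * b"
  shows "Nstar a b m = 0"
proof -
  have "{(xs, ys) \<in> representations a b m. (\<forall>x\<in>set xs. odd x) \<and> (\<forall>y\<in>set ys. odd y)} = {}"
  proof (intro equals0I, clarify)
    fix xs ys assume r: "(xs, ys) \<in> representations a b m" and o: "\<forall>x\<in>set xs. odd x" "\<forall>y\<in>set ys. odd y"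
    have "(\<Sum>y\<leftarrow>ys. 3 * y\<^sup>2) = 3 * sq_sum ys"
      by (simp add: sq_sum_def sum_list_const_mult)
    hence "int m = sq_sum xs + 3 * sq_sum ys" "length xs = a" "length ys = b"
      using r by (simp_all add: representations_def sq_sum_def)
    thus False using sq_sum_ge_length[OF o(1)] sq_sum_ge_length[OF o(2)] assms by linarith
  qed
  thus ?thesis unfolding Nstar_def by (simp only: card.empty)
qed

text \<open>Having some odd entry is not a condition on each entry separately, so
  \<open>Ntilde\<close> is reached through its complement, the representations with all entries
  even.\<close>

lemma N_eq_Ntilde_plus: "N a b m = Ntilde a b m + restricted_count even a b m"
proof -
  let ?A = "{(xs, ys) \<in> representations a b m. (\<exists>x\<in>set xs. odd x) \<or> (\<exists>y\<in>set ys. odd y)}"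
  let ?B = "{(xs, ys) \<in> representations a b m. (\<forall>x\<in>set xs. even x) \<and> (\<forall>y\<in>set ys. even y)}"
  have "representations a b m = ?A \<union> ?B" by auto
  moreover have "card (?A \<union> ?B) = card ?A + card ?B"
    by (rule card_Un_disjoint) (auto intro: finite_subset[OF _ finite_representations[of a b m]])
  ultimately show ?thesis unfolding N_def Ntilde_def restricted_count_def by simp
qed

text \<open>Weight (a + b) / 2 is a positive integer because a + b is even and nonzero; level and
  character are those of the theta products.\<close>

lemma modular_forms_exist:
  assumes "f \<in> theta_type a b" "(a, b) \<noteq> (0, 0)" "[a + b = 0] (mod 2)"
  shows "\<exists>k M \<psi>. k > 0 \<and> M > 0 \<and> dirichlet_character M \<psi> \<and> f \<in> modular_forms k M \<psi>"
proof (intro exI conjI)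
  have ev: "even (a + b)" using assms(3) by (simp add: cong_0_iff)
  show "f \<in> modular_forms ((a + b) div 2) 192 (theta_char a b)"
    by (rule theta_type_modular_forms[OF assms(1) ev])
  show "dirichlet_character 192 (theta_char a b)" by (rule dirichlet_character_theta_char[OF ev])
  have "a + b > 0" using assms(2) by auto
  thus "(a + b) div 2 > 0" using ev by presburger
qed simp

theorem proposition1p4:
  fixes a b :: nat
  assumes "(a, b) \<noteq> (0, 0)" and "[a + b = 0] (mod 2)"
  shows
    "(\<exists>k M \<psi>. k > 0 \<and> M > 0 \<and> dirichlet_character M \<psi> \<and> f_Nstar a b \<in> modular_forms k M \<psi>)
     \<and>
     (\<exists>k M \<psi>. k > 0 \<and> M > 0 \<and> dirichlet_character M \<psi> \<and> f_N a b \<in> modular_forms k M \<psi>)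
     \<and>
     (\<forall>z\<in>upper_half_plane.
        (\<lambda>n. of_nat (N a b (8 * n + a + 3 * b)) * nome z ^ (8 * n + a + 3 * b)) sums
        (f_N a b z -
          (\<Sum>l | 0 \<le> 8 * l + int (a + 3 * b) \<and> 8 * l + int (a + 3 * b) < int (a + 3 * b).
             of_nat (N a b (nat (8 * l + int (a + 3 * b)))) * nome z ^ nat (8 * l + int (a + 3 * b)))))
     \<and>
     ([a + 3 * b = 0] (mod 4) \<longrightarrow>
        (\<exists>k M \<psi>. k > 0 \<and> M > 0 \<and> dirichlet_character M \<psi> \<and> f_Ntilde a b \<in> modular_forms k M \<psi>)
        \<and>
        (\<forall>z\<in>upper_half_plane.
           (\<lambda>n. of_nat (Ntilde a b (8 * n + a + 3 * b)) * nome z ^ (8 * n + a + 3 * b)) sums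
           (f_Ntilde a b z -
             (\<Sum>l | 0 \<le> 8 * l + int (a + 3 * b) \<and> 8 * l + int (a + 3 * b) < int (a + 3 * b).
                of_nat (Ntilde a b (nat (8 * l + int (a + 3 * b)))) * nome z ^ nat (8 * l + int (a + 3 * b))))))"
proof -
  let ?C = "a + 3 * b"
  note exist = modular_forms_exist[OF _ assms]
  have N: "N a b m = restricted_count (\<lambda>_. True) a b m" for m
    by (simp add: N_def restricted_count_def)
  have Nstar: "Nstar a b m = restricted_count odd a b m" for m
    by (simp add: Nstar_def restricted_count_def)
  obtain hN where hN: "hN \<in> theta_type a b"
    "\<And>z. Im z > 0 \<Longrightarrow> (\<lambda>m. if [m = ?C] (mod 8) then of_nat (N a b m) * nome z ^ m else 0) sums hN z"
    using restricted_count_type[of "\<lambda>_. True" a b ?C] unfolding N by auto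
  obtain hS where hS: "hS \<in> theta_type a b"
    "\<And>z. Im z > 0 \<Longrightarrow> (\<lambda>m. if [m = ?C] (mod 8) then of_nat (Nstar a b m) * nome z ^ m else 0) sums hS z"
    using restricted_count_type[of odd a b ?C] unfolding Nstar by auto
  obtain hE where hE: "hE \<in> theta_type a b"
    "\<And>z. Im z > 0 \<Longrightarrow> (\<lambda>m. if [m = ?C] (mod 8) then of_nat (restricted_count even a b m) * nome z ^ m else 0) sums hE z"
    using restricted_count_type[of even a b ?C] by auto
  have hT: "(\<lambda>m. if [m = ?C] (mod 8) then of_nat (Ntilde a b m) * nome z ^ m else 0) sums (hN z - hE z)" if "Im z > 0" for z
  proof -
    have "(if [m = ?C] (mod 8) then of_nat (N a b m) * nome z ^ m else 0) - (if [m = ?C] (mod 8) then of_nat (restricted_count even a b m) * nome z ^ m else 0)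
       = (if [m = ?C] (mod 8) then of_nat (Ntilde a b m) * nome z ^ m else 0)" for m
      by (simp add: N_eq_Ntilde_plus algebra_simps)
    thus ?thesis using sums_diff[OF hN(2)[OF that] hE(2)[OF that]] by simp
  qed
  have fN: "f_N a b z = hN z" if "Im z > 0" for z
    unfolding f_N_def using hN(2)[OF that] by (rule sums_unique[symmetric])
  have fT: "f_Ntilde a b z = hN z - hE z" if "Im z > 0" for z
    unfolding f_Ntilde_def using hT[OF that] by (rule sums_unique[symmetric])
  have fS: "f_Nstar a b z = hS z" if "Im z > 0" for z
  proof -
    have "(\<Sum>l | 0 \<le> 8 * l + int ?C \<and> 8 * l + int ?C < int ?C.
        of_nat (Nstar a b (nat (8 * l + int ?C))) * nome z ^ nat (8 * l + int ?C)) = 0"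
      by (rule sum.neutral) (auto intro!: Nstar_eq_0 simp: nat_less_iff)
    from sums_shifted_progression[OF hS(2)[OF that], unfolded this]
    show ?thesis unfolding f_Nstar_def by (intro sums_unique[symmetric]) (simp add: add.assoc)
  qed
  have 1: "f_Nstar a b \<in> theta_type a b" by (rule theta_type_cong[OF hS(1) fS])
  have 2: "f_N a b \<in> theta_type a b" by (rule theta_type_cong[OF hN(1) fN])
  \<comment> \<open>Functions of one type share weight, level and multiplier, so subtracting the
    all-even part stays within the type.\<close>
  have 3: "f_Ntilde a b \<in> theta_type a b" by (rule theta_type_cong[OF theta_type_diff[OF hN(1) hE(1)] fT])
  have 4: "(\<lambda>n. of_nat (N a b (8 * n + a + 3 * b)) * nome z ^ (8 * n + a + 3 * b)) sums
        (f_N a b z - (\<Sum>l | 0 \<le> 8 * l + int ?C \<and> 8 * l + int ?C < int ?C.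
             of_nat (N a b (nat (8 * l + int ?C))) * nome z ^ nat (8 * l + int ?C)))"
    if "z \<in> upper_half_plane" for z
  proof -
    have z: "Im z > 0" using that by (simp add: upper_half_plane_def)
    show ?thesis unfolding fN[OF z] add.assoc by (rule sums_shifted_progression[OF hN(2)[OF z]])
  qed
  have 5: "(\<lambda>n. of_nat (Ntilde a b (8 * n + a + 3 * b)) * nome z ^ (8 * n + a + 3 * b)) sums
        (f_Ntilde a b z - (\<Sum>l | 0 \<le> 8 * l + int ?C \<and> 8 * l + int ?C < int ?C.
             of_nat (Ntilde a b (nat (8 * l + int ?C))) * nome z ^ nat (8 * l + int ?C)))"
    if "z \<in> upper_half_plane" for z
  proof -
    have z: "Im z > 0" using that by (simp add: upper_half_plane_def)
    show ?thesis unfolding fT[OF z] add.assoc by (rule sums_shifted_progression[OF hT[OF z]])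
  qed
  show ?thesis using exist[OF 1] exist[OF 2] exist[OF 3] 4 5 by blast
qed

end
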